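(* Let $(T_t)_{t\ge0}$ be a sublinear Markov semigroup on $\mathcal{H}$ with pointwise infinitesimal generator $(A^{(p)},\mathcal{D}(A^{(p)}))$. If $C_c^\infty(\mathbb{R}^d)\subseteq\mathcal{D}(A^{(p)})$, then there exists a family $q_\theta(x,\cdot)$, $\theta\in I$, $x\in\mathbb{R}^d$, of continuous negative definite functions such that $$A^{(p)}f(x)=\sup_{\theta\in I}(-q_\theta(x,D)f)(x)\quad\text{for all } f\in C_c^\infty(\mathbb{R}^d),\ x\in\mathbb{R}^d.$$ Equivalently, $$A^{(p)}f(x)=\sup_{\theta\in I}\Big(-c_\theta(x)f(x)+b_\theta(x)\cdot\nabla f(x)+\tfrac12\operatorname{tr}(Q_\theta(x)\cdot\nabla^2f(x))+\int_{y\ne0}\big(f(x+y)-f(x)-y\cdot\nabla f(x)\mathbf{1}_{(0,1)}(|y|)\big)\,\nu_\theta(x,dy)\Big),$$ where $(c_\theta(x),b_\theta(x),Q_\theta(x),\nu_\theta(x,\cdot))$ are the characteristics of $q_\theta(x,\cdot)$. For each $x\in\mathbb{R}^d$ the characteristics are uniformly bounded in $\theta$: $$\sup_{\theta\in I}\Big(c_\theta(x)+|b_\theta(x)|+|Q_\theta(x)|+\int_{y\ne0}\min\{1,|y|^2\}\,\nu_\theta(x,dy)\Big)<\infty.$$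
   Context: A family $\mathcal{H}$ of real-valued functions on $\mathbb{R}^d$ is called a convex cone if $\alpha f+\beta g\in\mathcal{H}$ for all $\alpha,\beta\in\mathbb{R}$, $f,g\in\mathcal{H}$, and all constant functions belong to $\mathcal{H}$. A family of operators $T_t:\mathcal{H}\to\mathcal{H}$, $t\ge0$, on a convex cone $\mathcal{H}$ is a sublinear Markov semigroup if each $T_t$ is sublinear ($T_t(f+g)\le T_tf+T_tg$, $T_t(\lambda f)=\lambda T_tf$ for $\lambda\ge0$) and: (1) $T_{t+s}=T_tT_s$, $T_0=\mathrm{id}$; (2) $f\le g$ implies $T_tf\le T_tg$; (3) $T_t(1)\le1$. Pointwise generator: $f\in\mathcal{D}(A^{(p)})$ iff $f\in\mathcal{H}$, the limit $g(x):=\lim_{t\downarrow0}t^{-1}(T_tf(x)-f(x))$ exists for all $x\in\mathbb{R}^d$, and $g\in\mathcal{H}$; then $A^{(p)}f:=g$. A continuous negative definite function with characteristics $(c(x),b(x),Q(x),\nu(x,\cdot))$ is $$q(x,\xi)=c(x)-ib(x)\cdot\xi+\tfrac12\xi\cdot Q(x)\xi+\int_{y\ne0}\big(1-e^{iy\cdot\xi}+iy\cdot\xi\,\mathbf{1}_{(0,1)}(|y|)\big)\,\nu(x,dy),$$ with $c(x)\ge0$, $b(x)\in\mathbb{R}^d$, $Q(x)$ positive semidefinite, $\nu(x,\cdot)$ a measure on $\mathbb{R}^d\setminus\{0\}$ with $\int\min\{1,|y|^2\}\,\nu(x,dy)<\infty$ for each $x$. The pseudo-differential operator is determined by $-q(x,D)f(x)=-\int_{\mathbb{R}^d}q(x,\xi)e^{ix\cdot\xi}\hat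 f(\xi)\,d\xi$, $\hat f(\xi)=(2\pi)^{-d}\int f(x)e^{-ix\cdot\xi}\,dx$; equivalently $$-q(x,D)f(x)=-c(x)f(x)+b(x)\cdot\nabla f(x)+\tfrac12\operatorname{tr}(Q(x)\nabla^2f(x))+\int_{y\ne0}\big(f(x+y)-f(x)-y\cdot\nabla f(x)\mathbf{1}_{(0,1)}(|y|)\big)\,\nu(x,dy).$$ *)

theory Defs
  imports "HOL-Analysis.Analysis"
begin

definition partial_derivative :: "'n::finite \<Rightarrow> (real^'n \<Rightarrow> real) \<Rightarrow> real^'n \<Rightarrow> real" where
  "partial_derivative i f x = frechet_derivative f (at x) (axis i 1)"

definition gradient :: "(real^'n::finite \<Rightarrow> real) \<Rightarrow> real^'n \<Rightarrow> real^'n" where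
  "gradient f x = (\<chi> i. partial_derivative i f x)"

definition hessian :: "(real^'n::finite \<Rightarrow> real) \<Rightarrow> real^'n \<Rightarrow> real^'n^'n" where
  "hessian f x = (\<chi> i j. partial_derivative i (partial_derivative j f) x)"

fun C_k :: "nat \<Rightarrow> (real^'n::finite \<Rightarrow> real) \<Rightarrow> bool" where
  "C_k 0 f \<longleftrightarrow> continuous_on UNIV f"
| "C_k (Suc k) f \<longleftrightarrow> (\<forall>x. f differentiable (at x)) \<and> (\<forall>i. C_k k (partial_derivative i f))"

definition Cc_infinity :: "(real^'n::finite \<Rightarrow> real) set" where
  "Cc_infinity = {f. (\<forall>k. C_k k f) \<and> compact (closure {x. f x \<noteq> 0})}"

text \<open>In this setting a convex cone of functions is closed under all real linear combinations
  and contains the constants; this is not the library's \<open>convex_cone\<close>.\<close>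

definition function_cone :: "('a \<Rightarrow> real) set \<Rightarrow> bool" where
  "function_cone H \<longleftrightarrow>
     (\<forall>\<alpha> \<beta> f g. f \<in> H \<longrightarrow> g \<in> H \<longrightarrow> (\<lambda>x. \<alpha> * f x + \<beta> * g x) \<in> H) \<and>
     (\<forall>a. (\<lambda>x. a) \<in> H)"

text \<open>Only the values \<open>T t f\<close> with \<open>t \<ge> 0\<close> and \<open>f \<in> H\<close> are relevant.  The order on functions is
  the pointwise one.\<close>

definition sublinear_operator_on ::
    "('a \<Rightarrow> real) set \<Rightarrow> (('a \<Rightarrow> real) \<Rightarrow> 'a \<Rightarrow> real) \<Rightarrow> bool" where
  "sublinear_operator_on H S \<longleftrightarrow>
     (\<forall>f\<in>H. S f \<in> H) \<and>
     (\<forall>f\<in>H. \<forall>g\<in>H. S (\<lambda>x. f x + g x) \<le> (\<lambda>x. S f x + S g x)) \<and>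
     (\<forall>f\<in>H. \<forall>a\<ge>0. S (\<lambda>x. a * f x) = (\<lambda>x. a * S f x))"

definition sublinear_markov_semigroup ::
    "('a \<Rightarrow> real) set \<Rightarrow> (real \<Rightarrow> ('a \<Rightarrow> real) \<Rightarrow> 'a \<Rightarrow> real) \<Rightarrow> bool" where
  "sublinear_markov_semigroup H T \<longleftrightarrow>
     function_cone H \<and>
     (\<forall>t\<ge>0. sublinear_operator_on H (T t)) \<and>
     (\<forall>s\<ge>0. \<forall>t\<ge>0. \<forall>f\<in>H. T (t + s) f = T t (T s f)) \<and>
     (\<forall>f\<in>H. T 0 f = f) \<and>
     (\<forall>t\<ge>0. \<forall>f\<in>H. \<forall>g\<in>H. f \<le> g \<longrightarrow> T t f \<le> T t g) \<and>
     (\<forall>t\<ge>0. T t (\<lambda>x. 1) \<le> (\<lambda>x. 1))"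

definition generator_domain ::
    "('a \<Rightarrow> real) set \<Rightarrow> (real \<Rightarrow> ('a \<Rightarrow> real) \<Rightarrow> 'a \<Rightarrow> real) \<Rightarrow> ('a \<Rightarrow> real) set" where
  "generator_domain H T =
     {f \<in> H. \<exists>g\<in>H. \<forall>x. ((\<lambda>t. (T t f x - f x) / t) \<longlongrightarrow> g x) (at_right 0)}"

definition generator ::
    "(real \<Rightarrow> ('a \<Rightarrow> real) \<Rightarrow> 'a \<Rightarrow> real) \<Rightarrow> ('a \<Rightarrow> real) \<Rightarrow> 'a \<Rightarrow> real" where
  "generator T f x = Lim (at_right 0) (\<lambda>t. (T t f x - f x) / t)"

text \<open>A measure on \<open>\<real>\<^sup>d\<close> without the origin is a measure whose space is \<open>- {0}\<close>, so that
  integration over \<open>y \<noteq> 0\<close> is integration over the whole space of \<open>\<nu>\<close>.\<close>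

definition levy_measure :: "(real^'n::finite) measure \<Rightarrow> bool" where
  "levy_measure \<nu> \<longleftrightarrow>
     sets \<nu> = sets (restrict_space borel (- {0})) \<and>
     (\<integral>\<^sup>+ y. ennreal (min 1 ((norm y)\<^sup>2)) \<partial>\<nu>) < \<infinity>"

definition negdef_symbol ::
    "real \<Rightarrow> real^'n::finite \<Rightarrow> real^'n^'n \<Rightarrow> (real^'n) measure \<Rightarrow> real^'n \<Rightarrow> complex" where
  "negdef_symbol c b Q \<nu> \<xi> =
     of_real c - \<i> * of_real (b \<bullet> \<xi>) + of_real (1/2 * (\<xi> \<bullet> (Q *v \<xi>))) +
     (\<integral>y. 1 - exp (\<i> * of_real (y \<bullet> \<xi>))
            + \<i> * of_real ((y \<bullet> \<xi>) * indicator {0<..<1} (norm y)) \<partial>\<nu>)"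

definition cnd_with_characteristics ::
    "(real^'n::finite \<Rightarrow> complex) \<Rightarrow>
     real \<Rightarrow> real^'n \<Rightarrow> real^'n^'n \<Rightarrow> (real^'n) measure \<Rightarrow> bool" where
  "cnd_with_characteristics q c b Q \<nu> \<longleftrightarrow>
     c \<ge> 0 \<and>
     transpose Q = Q \<and> (\<forall>\<xi>. \<xi> \<bullet> (Q *v \<xi>) \<ge> 0) \<and>
     levy_measure \<nu> \<and>
     q = negdef_symbol c b Q \<nu>"

definition fourier :: "(real^'n::finite \<Rightarrow> real) \<Rightarrow> real^'n \<Rightarrow> complex" where
  "fourier f \<xi> =
     (\<integral>x. of_real (f x) * exp (- \<i> * of_real (x \<bullet> \<xi>)) \<partial>lborel) / of_real ((2 * pi) ^ CARD('n))"

text \<open>\<open>pseudo_diff q f x\<close> is \<open>q(x,D) f (x)\<close>.\<close>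

definition pseudo_diff ::
    "(real^'n::finite \<Rightarrow> real^'n \<Rightarrow> complex) \<Rightarrow> (real^'n \<Rightarrow> real) \<Rightarrow> real^'n \<Rightarrow> complex" where
  "pseudo_diff q f x =
     (\<integral>\<xi>. q x \<xi> * exp (\<i> * of_real (x \<bullet> \<xi>)) * fourier f \<xi> \<partial>lborel)"

definition levy_operator ::
    "real \<Rightarrow> real^'n::finite \<Rightarrow> real^'n^'n \<Rightarrow> (real^'n) measure \<Rightarrow>
     (real^'n \<Rightarrow> real) \<Rightarrow> real^'n \<Rightarrow> real" where
  "levy_operator c b Q \<nu> f x =
     - c * f x + b \<bullet> gradient f x + 1/2 * trace (Q ** hessian f x) +
     (\<integral>y. f (x + y) - f x - (y \<bullet> gradient f x) * indicator {0<..<1} (norm y) \<partial>\<nu>)"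

text \<open>A type of indices for families of characteristics \<open>(c\<^sub>\<theta>(x), b\<^sub>\<theta>(x), Q\<^sub>\<theta>(x), \<nu>\<^sub>\<theta>(x,\<cdot>))\<close>.  HOL cannot
  quantify existentially over the type of the index set, but every family of characteristics can
  be indexed, without changing suprema over the family, by the set of its own members
  \<open>x \<mapsto> (c\<^sub>\<theta>(x), b\<^sub>\<theta>(x), Q\<^sub>\<theta>(x), \<nu>\<^sub>\<theta>(x,\<cdot>))\<close>, which have this type.\<close>

type_synonym 'n characteristics_field =
  "real^'n \<Rightarrow> real \<times> (real^'n) \<times> (real^'n^'n) \<times> (real^'n) measure"

end

theory Submission
  imports Defs "HOL-Probability.Probability"
begin

text \<open>For fixed \<open>x\<close> the map \<open>f \<mapsto> A f x\<close> is sublinear on test functions and satisfies the positive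
  maximum principle at \<open>x\<close>, so by the Hahn--Banach theorem it is the maximum of the linear functionals
  below it, all of which inherit the principle.  Such a linear functional \<open>l\<close> has Levy--Khintchine form.
  To see this, the sublinear functional is first extended, so that \<open>l\<close> is defined on all functions
  \<open>G w\<close> with \<open>G\<close> bounded and \<open>w = 1 - \<chi>\<close>, where \<open>\<chi>\<close> is a smooth bump with
  \<open>w y \<ge> min 1 |y|\<^sup>2\<close>.  Then \<open>G \<mapsto> l (G w)\<close> is a positive functional on all bounded functions; the
  finitely additive set function that it induces on the cells of a refining sequence of partitions is
  realized by nested intervals, and the limit of the corresponding step functions has a law \<open>\<mu>\<close> with
  \<open>\<integral> G d\<mu> = l (G w)\<close> for continuous \<open>G\<close> with compact support.  The Levy measure is \<open>\<mu> / w\<close> off the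
  origin.  Mass of \<open>l\<close> that \<open>\<mu>\<close> loses at infinity contributes to killing, and mass that concentrates at the
  origin contributes to the diffusion matrix.  The bounds on the extended sublinear functional do not
  depend on \<open>l\<close>, hence the uniform bound on the characteristics.  The symbol formula follows from
  Fourier inversion and Fubini's theorem.\<close>

section \<open>Smooth functions with compact support\<close>

text \<open>The constant 1 and the weight \<open>w\<close> are not test functions, so a functional
  that lives on \<open>Cc_infinity\<close> alone controls neither killing nor the total jump mass.
  Extending before Hahn--Banach makes \<open>l 1\<close> and \<open>l w\<close> meaningful, with
  bounds known in advance. The weight is a constant minus a test function, so bounded multiples of
  it can be compared at the origin from both sides. The functional on bounded functions is only
  finitely additive. Countable additivity comes from Lebesgue measure on the intervals, and the
  representation is exact only for continuous functions with compact support. Two kinds of functions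
  in the expansion of a test function fall outside this class: those that are a nonzero constant
  near infinity, and the quotients of y_i y_j \<open>bump\<close> by \<open>w\<close>, which are
  bounded but discontinuous at the origin. In both cases the positivity of \<open>l\<close> on
  nonnegative multiples of \<open>w\<close> gives the defect its sign. Different points x do not
  interact: a member of the family may choose its characteristics at each x separately, and the
  supremum is attained.\<close>

lemma partial_derivative_eqI:
  assumes "(f has_derivative D) (at x)"
  shows "partial_derivative i f x = D (axis i 1)"
  unfolding partial_derivative_def using frechet_derivative_at[OF assms] by simp

lemma C_k_SucD: "C_k (Suc k) f \<Longrightarrow> C_k k f"
proof (induction k arbitrary: f)
  case 0
  then show ?case
    by (auto intro!: continuous_at_imp_continuous_on differentiable_imp_continuous_within)
next
  case (Suc k)
  then have "\<forall>x. f differentiable (at x)" "C_k (Suc k) (partial_derivative i f)" for i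
    unfolding C_k.simps(2)[of "Suc k" f] by blast+
  with Suc.IH show ?case unfolding C_k.simps(2)[of k f] by blast
qed

lemma C_k_const: "C_k k (\<lambda>x. a)"
proof (induction k arbitrary: a)
  case (Suc k)
  have "partial_derivative i (\<lambda>x. a) = (\<lambda>x::real^'a. 0)" for i :: 'a
    by (rule ext) (simp add: partial_derivative_eqI[OF has_derivative_const])
  then show ?case using Suc by simp
qed simp

lemma partial_derivative_add:
  assumes "\<forall>x. f differentiable (at x)" "\<forall>x. g differentiable (at x)"
  shows "partial_derivative i (\<lambda>x. f x + g x) = (\<lambda>x. partial_derivative i f x + partial_derivative i g x)"
proof
  fix x
  have "((\<lambda>x. f x + g x) has_derivative
      (\<lambda>h. frechet_derivative f (at x) h + frechet_derivative g (at x) h)) (at x)"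
    using assms by (auto intro!: has_derivative_add simp: frechet_derivative_works)
  from partial_derivative_eqI[OF this, of i]
  show "partial_derivative i (\<lambda>x. f x + g x) x = partial_derivative i f x + partial_derivative i g x"
    by (simp add: partial_derivative_def)
qed

lemma partial_derivative_mult:
  assumes "\<forall>x. f differentiable (at x)" "\<forall>x. g differentiable (at x)"
  shows "partial_derivative i (\<lambda>x. f x * g x) =
    (\<lambda>x. f x * partial_derivative i g x + partial_derivative i f x * g x)"
proof
  fix x
  have "((\<lambda>x. f x * g x) has_derivative
      (\<lambda>h. f x * frechet_derivative g (at x) h + frechet_derivative f (at x) h * g x)) (at x)"
    using assms by (auto intro!: has_derivative_mult simp: frechet_derivative_works)
  from partial_derivative_eqI[OF this, of i]
  show "partial_derivative i (\<lambda>x. f x * g x) x =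
      f x * partial_derivative i g x + partial_derivative i f x * g x"
    by (simp add: partial_derivative_def)
qed

lemma C_k_add: "C_k k f \<Longrightarrow> C_k k g \<Longrightarrow> C_k k (\<lambda>x. f x + g x)"
proof (induction k arbitrary: f g)
  case (Suc k)
  then show ?case by (auto simp: partial_derivative_add)
qed (auto intro: continuous_intros)

lemma C_k_mult: "C_k k f \<Longrightarrow> C_k k g \<Longrightarrow> C_k k (\<lambda>x. f x * g x)"
proof (induction k arbitrary: f g)
  case (Suc k)
  \<comment> \<open>The product rule leaves one factor undifferentiated in each term, and that
    factor has to be known at level k.\<close>
  have "C_k k f" "C_k k g" using Suc.prems by (auto intro: C_k_SucD)
  then show ?case using Suc by (auto simp: partial_derivative_mult intro!: C_k_add)
qed (auto intro: continuous_intros)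

lemma has_derivative_nth: "((\<lambda>x::real^'n. x $ i) has_derivative (\<lambda>h. h $ i)) (at x)"
  by (rule bounded_linear_imp_has_derivative[OF bounded_linear_vec_nth])

lemma C_k_nth: "C_k k (\<lambda>x::real^'n::finite. x $ i)"
proof (cases k)
  case (Suc m)
  have "partial_derivative j (\<lambda>x::real^'n. x $ i) = (\<lambda>x. axis j 1 $ i)" for j
    by (rule ext) (simp add: partial_derivative_eqI[OF has_derivative_nth])
  then show ?thesis using Suc by (auto simp: C_k_const differentiable_def intro: has_derivative_nth)
qed (auto intro!: continuous_intros)

lemma has_derivative_translate:
  assumes "f differentiable (at (a + y))"
  shows "((\<lambda>y. f (a + y)) has_derivative frechet_derivative f (at (a + y))) (at y)"
proof -
  have "(f has_derivative frechet_derivative f (at (a + y))) (at (a + y))"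
    using assms by (simp add: frechet_derivative_works)
  then show ?thesis
    by (intro has_derivative_compose[of "\<lambda>y. a + y" "\<lambda>h. h" y UNIV f])
      (auto intro!: derivative_eq_intros)
qed

lemma partial_derivative_translate:
  assumes "\<forall>x. f differentiable (at x)"
  shows "partial_derivative i (\<lambda>y. f (a + y)) = (\<lambda>y. partial_derivative i f (a + y))"
proof
  fix y
  have "f differentiable (at (a + y))" using assms by blast
  from partial_derivative_eqI[OF has_derivative_translate[OF this], of i]
  show "partial_derivative i (\<lambda>y. f (a + y)) y = partial_derivative i f (a + y)"
    by (simp add: partial_derivative_def)
qed

lemma differentiable_translate:
  "f differentiable (at (a + y)) \<Longrightarrow> (\<lambda>y. f (a + y)) differentiable (at y)"
  by (rule differentiableI[OF has_derivative_translate])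

lemma C_k_translate: "C_k k f \<Longrightarrow> C_k k (\<lambda>y. f (a + y))"
proof (induction k arbitrary: f)
  case (Suc k)
  then show ?case by (auto simp: partial_derivative_translate differentiable_translate)
next
  case 0
  have "continuous_on UNIV f" using 0 by simp
  moreover have "continuous_on UNIV (\<lambda>y. a + y)" by (intro continuous_intros)
  ultimately have "continuous_on UNIV (\<lambda>y. f (a + y))" by (rule continuous_on_compose2) simp
  then show ?case by simp
qed

section \<open>Closure properties of the space of test functions\<close>

lemma Cc_infinity_iff:
  "f \<in> Cc_infinity \<longleftrightarrow> (\<forall>k. C_k k f) \<and> (\<exists>r. \<forall>x. norm x \<ge> r \<longrightarrow> f x = 0)"
proof -
  have 1: "\<exists>r. \<forall>x. norm x \<ge> r \<longrightarrow> f x = 0" if "compact (closure {x. f x \<noteq> 0})"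
  proof -
    have "bounded {x. f x \<noteq> 0}"
      by (rule bounded_subset[OF compact_imp_bounded[OF that] closure_subset])
    then obtain r where r: "\<And>x. x \<in> {x. f x \<noteq> 0} \<Longrightarrow> norm x \<le> r"
      unfolding bounded_iff by blast
    have "f x = 0" if "norm x \<ge> r + 1" for x
    proof (rule ccontr)
      assume "f x \<noteq> 0"
      then have "norm x \<le> r" using r[of x] by simp
      then show False using that by simp
    qed
    then show ?thesis by blast
  qed
  have 2: "compact (closure {x. f x \<noteq> 0})" if "\<exists>r. \<forall>x. norm x \<ge> r \<longrightarrow> f x = 0"
  proof -
    from that obtain r where r: "\<forall>x. norm x \<ge> r \<longrightarrow> f x = 0" by blast
    have "{x. f x \<noteq> 0} \<subseteq> cball 0 r"
    proof
      fix x assume "x \<in> {x. f x \<noteq> 0}"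
      then have "\<not> norm x \<ge> r" using r by blast
      then show "x \<in> cball 0 r" by simp
    qed
    then have "bounded {x. f x \<noteq> 0}" by (rule bounded_subset[OF bounded_cball])
    then show ?thesis by (simp add: compact_closure)
  qed
  have "compact (closure {x. f x \<noteq> 0}) \<longleftrightarrow> (\<exists>r. \<forall>x. norm x \<ge> r \<longrightarrow> f x = 0)"
    using 1 2 by (rule iffI)
  then show ?thesis unfolding Cc_infinity_def mem_Collect_eq by (rule arg_cong)
qed

lemma Cc_infinityI:
  "(\<And>k. C_k k f) \<Longrightarrow> (\<And>x. norm x \<ge> r \<Longrightarrow> f x = 0) \<Longrightarrow> f \<in> Cc_infinity"
  unfolding Cc_infinity_iff by blast

lemma Cc_C_k: "f \<in> Cc_infinity \<Longrightarrow> C_k k f"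
  unfolding Cc_infinity_iff by blast

lemma Cc_supportE:
  assumes "f \<in> Cc_infinity"
  obtains r where "\<And>x. norm x \<ge> r \<Longrightarrow> f x = 0"
  using assms unfolding Cc_infinity_iff by blast

lemma Cc_add:
  assumes "f \<in> Cc_infinity" "g \<in> Cc_infinity" shows "(\<lambda>x. f x + g x) \<in> Cc_infinity"
proof -
  obtain r where r: "\<And>x. norm x \<ge> r \<Longrightarrow> f x = 0" using Cc_supportE[OF assms(1)] by blast
  obtain s where s: "\<And>x. norm x \<ge> s \<Longrightarrow> g x = 0" using Cc_supportE[OF assms(2)] by blast
  show ?thesis
  proof (rule Cc_infinityI)
    show "C_k k (\<lambda>x. f x + g x)" for k using assms by (intro C_k_add Cc_C_k)
    show "f x + g x = 0" if "norm x \<ge> max r s" for x using that r[of x] s[of x] by simp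
  qed
qed

lemma Cc_mult_left:
  assumes "\<And>k. C_k k f" "g \<in> Cc_infinity" shows "(\<lambda>x. f x * g x) \<in> Cc_infinity"
proof -
  obtain s where s: "\<And>x. norm x \<ge> s \<Longrightarrow> g x = 0" using Cc_supportE[OF assms(2)] by blast
  show ?thesis
  proof (rule Cc_infinityI)
    show "C_k k (\<lambda>x. f x * g x)" for k by (rule C_k_mult[OF assms(1) Cc_C_k[OF assms(2)]])
    show "f x * g x = 0" if "norm x \<ge> s" for x using that s[of x] by simp
  qed
qed

lemma Cc_cmult: "g \<in> Cc_infinity \<Longrightarrow> (\<lambda>x. a * g x) \<in> Cc_infinity"
  by (rule Cc_mult_left[OF C_k_const])

lemma Cc_minus: "g \<in> Cc_infinity \<Longrightarrow> (\<lambda>x. - g x) \<in> Cc_infinity"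
  using Cc_cmult[of g "-1"] by simp

lemma Cc_diff: "f \<in> Cc_infinity \<Longrightarrow> g \<in> Cc_infinity \<Longrightarrow> (\<lambda>x. f x - g x) \<in> Cc_infinity"
  using Cc_add[OF _ Cc_minus] by fastforce

lemma Cc_zero: "(\<lambda>x. 0) \<in> Cc_infinity"
  by (rule Cc_infinityI) (auto intro: C_k_const)

lemma Cc_translate:
  assumes "f \<in> Cc_infinity" shows "(\<lambda>y. f (a + y)) \<in> Cc_infinity"
proof -
  obtain r where r: "\<And>x. norm x \<ge> r \<Longrightarrow> f x = 0" using Cc_supportE[OF assms] by blast
  show ?thesis
  proof (rule Cc_infinityI)
    show "C_k k (\<lambda>x. f (a + x))" for k using assms by (intro C_k_translate Cc_C_k)
    show "f (a + x) = 0" if "norm x \<ge> r + norm a" for x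
      using norm_triangle_ineq4[of "a + x" a] that by (intro r) simp
  qed
qed

lemma Cc_differentiable: "f \<in> Cc_infinity \<Longrightarrow> f differentiable (at x)"
  using Cc_C_k[of f "Suc 0"] by simp

lemma Cc_continuous: "f \<in> Cc_infinity \<Longrightarrow> continuous_on S f"
  using Cc_C_k[of f 0] continuous_on_subset by (simp, blast)

lemma Cc_partial_derivative:
  assumes "f \<in> Cc_infinity" shows "partial_derivative i f \<in> Cc_infinity"
proof -
  obtain r where r: "\<And>x. norm x \<ge> r \<Longrightarrow> f x = 0" using Cc_supportE[OF assms] by blast
  \<comment> \<open>Such x lie in the open set outside \<open>cball 0 r\<close>, where f coincides
    with 0; the 1 keeps them off the sphere.\<close>
  have "partial_derivative i f x = 0" if "norm x \<ge> r + 1" for x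
  proof -
    have "(f has_derivative (\<lambda>h. 0)) (at x)"
    proof (rule has_derivative_transform_within_open[of "\<lambda>x. 0" _ x UNIV "- cball 0 r"])
      show "0 = f y" if "y \<in> - cball 0 r" for y using that r by auto
      show "x \<in> - cball 0 r" using that by auto
    qed auto
    then show ?thesis by (simp add: partial_derivative_eqI)
  qed
  moreover have "C_k k (partial_derivative i f)" for k
    using Cc_C_k[OF assms, of "Suc k"] by simp
  ultimately show ?thesis by (intro Cc_infinityI)
qed

lemma Cc_bounded:
  assumes "f \<in> Cc_infinity" obtains B where "B \<ge> 0" "\<And>x. \<bar>f x\<bar> \<le> B"
proof -
  obtain r where r: "\<And>x. norm x \<ge> r \<Longrightarrow> f x = 0" using Cc_supportE[OF assms] by blast
  have "compact (f ` cball 0 r)"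
    using assms by (intro compact_continuous_image Cc_continuous) auto
  then obtain B where "\<forall>y\<in>f ` cball 0 r. norm y \<le> B"
    unfolding bounded_iff by (metis compact_imp_bounded bounded_iff)
  then have B: "\<bar>f x\<bar> \<le> B" if "norm x \<le> r" for x using that by simp
  have "\<bar>f x\<bar> \<le> max B 0" for x
    using B[of x] r[of x] by (cases "norm x \<le> r") auto
  then show ?thesis using that[of "max B 0"] by auto
qed

section \<open>The Hahn--Banach theorem for sublinear functionals on function spaces\<close>

text \<open>Subspaces are sets inside the full function space, so functionals are total functions
  whose values count on \<open>V\<close> only.\<close>

definition fun_subspace :: "('a \<Rightarrow> real) set \<Rightarrow> bool" where
  "fun_subspace V \<longleftrightarrow> (\<lambda>x. 0) \<in> V \<and> (\<forall>f\<in>V. \<forall>g\<in>V. (\<lambda>x. f x + g x) \<in> V) \<and>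
     (\<forall>f\<in>V. \<forall>a. (\<lambda>x. a * f x) \<in> V)"

definition sublinear_on :: "('a \<Rightarrow> real) set \<Rightarrow> (('a \<Rightarrow> real) \<Rightarrow> real) \<Rightarrow> bool" where
  "sublinear_on V p \<longleftrightarrow> (\<forall>f\<in>V. \<forall>g\<in>V. p (\<lambda>x. f x + g x) \<le> p f + p g) \<and>
     (\<forall>f\<in>V. \<forall>a\<ge>0. p (\<lambda>x. a * f x) = a * p f)"

lemma fun_subspaceD:
  assumes "fun_subspace V"
  shows "(\<lambda>x. 0) \<in> V" "f \<in> V \<Longrightarrow> g \<in> V \<Longrightarrow> (\<lambda>x. f x + g x) \<in> V" "f \<in> V \<Longrightarrow> (\<lambda>x. a * f x) \<in> V"
    "f \<in> V \<Longrightarrow> (\<lambda>x. - f x) \<in> V" "f \<in> V \<Longrightarrow> g \<in> V \<Longrightarrow> (\<lambda>x. f x - g x) \<in> V"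
proof -
  show 1: "(\<lambda>x. 0) \<in> V" using assms by (simp add: fun_subspace_def)
  show 2: "(\<lambda>x. f x + g x) \<in> V" if "f \<in> V" "g \<in> V" for f g
    using assms that by (simp add: fun_subspace_def)
  show 3: "(\<lambda>x. a * f x) \<in> V" if "f \<in> V" for a f
    using assms that by (simp add: fun_subspace_def)
  show 4: "(\<lambda>x. - f x) \<in> V" if "f \<in> V" for f using 3[OF that, of "-1"] by simp
  show "(\<lambda>x. f x - g x) \<in> V" if "f \<in> V" "g \<in> V" using 2[OF that(1) 4[OF that(2)]] by simp
qed

lemma sublinear_onD:
  assumes "sublinear_on V p"
  shows "f \<in> V \<Longrightarrow> g \<in> V \<Longrightarrow> p (\<lambda>x. f x + g x) \<le> p f + p g"
    "f \<in> V \<Longrightarrow> a \<ge> 0 \<Longrightarrow> p (\<lambda>x. a * f x) = a * p f"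
  using assms by (simp_all add: sublinear_on_def)

lemma sublinear_on_zero:
  assumes "sublinear_on V p" "fun_subspace V" shows "p (\<lambda>x. 0) = 0"
  using sublinear_onD(2)[OF assms(1) fun_subspaceD(1)[OF assms(2)], of 0] by simp

lemma sublinear_on_minus:
  assumes "sublinear_on V p" "fun_subspace V" "f \<in> V" shows "- p (\<lambda>x. - f x) \<le> p f"
  using sublinear_onD(1)[OF assms(1,3) fun_subspaceD(4)[OF assms(2,3)]] sublinear_on_zero[OF assms(1,2)]
  by simp

text \<open>The reduction of a sublinear functional in the direction \<open>v\<close>: a minimal functional coincides
  with its reductions, and this makes it additive.\<close>

lemma sublinear_on_reduction:
  fixes p :: "('a \<Rightarrow> real) \<Rightarrow> real"
  assumes p: "sublinear_on V p" and V: "fun_subspace V" and v: "v \<in> V"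
  obtains r where "sublinear_on V r" "\<And>f. f \<in> V \<Longrightarrow> r f \<le> p f"
    "\<And>f. f \<in> V \<Longrightarrow> r f \<le> p (\<lambda>x. f x + v x) - p v"
proof -
  \<comment> \<open>The infimum runs over t \<ge> 0. The value t = 0 gives the bound by p, and t = 1
    gives the last claim, which at f = -v bounds r(-v) by -p(v).\<close>
  define S where "S f = {p (\<lambda>x. f x + t * v x) - t * p v | t. t \<ge> 0}" for f
  define r where "r f = Inf (S f)" for f
  have mem: "p (\<lambda>x. f x + t * v x) - t * p v \<in> S f" if "t \<ge> 0" for f t
    using that by (auto simp: S_def)
  \<comment> \<open>Subadditivity applied to t v = (f + t v) + (-f) yields a lower bound free of t,
    so the infimum is finite.\<close>
  have lower: "- p (\<lambda>x. - f x) \<le> s" if f: "f \<in> V" and s: "s \<in> S f" for f s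
  proof -
    obtain t where t: "t \<ge> 0" "s = p (\<lambda>x. f x + t * v x) - t * p v" using s by (auto simp: S_def)
    have "t * p v = p (\<lambda>x. t * v x)" using sublinear_onD(2)[OF p v t(1)] by simp
    also have "\<dots> = p (\<lambda>x. (f x + t * v x) + - f x)" by simp
    also have "\<dots> \<le> p (\<lambda>x. f x + t * v x) + p (\<lambda>x. - f x)"
      by (intro sublinear_onD[OF p] fun_subspaceD[OF V] f v)
    finally show ?thesis using t by simp
  qed
  have bdd: "bdd_below (S f)" if "f \<in> V" for f using lower[OF that] by (auto simp: bdd_below_def)
  have ne: "S f \<noteq> {}" for f using mem[of 0 f] by auto
  have rle: "r f \<le> p (\<lambda>x. f x + t * v x) - t * p v" if "f \<in> V" "t \<ge> 0" for f t
    unfolding r_def by (rule cInf_lower[OF mem bdd]) (use that in auto)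
  have near: "\<exists>t\<ge>0. p (\<lambda>x. f x + t * v x) - t * p v < r f + e" if "e > 0" for f and e :: real
    using cInf_lessD[of "S f" "r f + e"] ne that by (auto simp: S_def r_def)
  have sub: "r (\<lambda>x. f x + g x) \<le> r f + r g" if f: "f \<in> V" and g: "g \<in> V" for f g
  proof (rule field_le_epsilon)
    fix e :: real assume e: "e > 0"
    obtain s where s: "s \<ge> 0" "p (\<lambda>x. f x + s * v x) - s * p v < r f + e/2"
      using near[of "e/2" f] e by auto
    obtain t where t: "t \<ge> 0" "p (\<lambda>x. g x + t * v x) - t * p v < r g + e/2"
      using near[of "e/2" g] e by auto
    have "r (\<lambda>x. f x + g x) \<le> p (\<lambda>x. (f x + g x) + (s + t) * v x) - (s + t) * p v"
      using s t by (intro rle fun_subspaceD[OF V] f g) auto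
    also have "(\<lambda>x. (f x + g x) + (s + t) * v x) = (\<lambda>x. (f x + s * v x) + (g x + t * v x))"
      by (simp add: algebra_simps)
    also have "p \<dots> \<le> p (\<lambda>x. f x + s * v x) + p (\<lambda>x. g x + t * v x)"
      by (intro sublinear_onD[OF p] fun_subspaceD[OF V] f g v)
    finally show "r (\<lambda>x. f x + g x) \<le> r f + r g + e" using s t by (simp add: algebra_simps)
  qed
  have scale_le: "r (\<lambda>x. a * f x) \<le> a * r f" if f: "f \<in> V" and a: "a > 0" for f a
  proof (rule field_le_epsilon)
    fix e :: real assume e: "e > 0"
    obtain s where s: "s \<ge> 0" "p (\<lambda>x. f x + s * v x) - s * p v < r f + e/a"
      using near[of "e/a" f] e a by auto
    \<comment> \<open>The parameter scales along: if s is nearly optimal for f, then a s is used for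
      a f.\<close>
    have "r (\<lambda>x. a * f x) \<le> p (\<lambda>x. a * f x + (a * s) * v x) - (a * s) * p v"
      using s a by (intro rle fun_subspaceD[OF V] f) auto
    also have "(\<lambda>x. a * f x + (a * s) * v x) = (\<lambda>x. a * (f x + s * v x))" by (simp add: algebra_simps)
    also have "p \<dots> = a * p (\<lambda>x. f x + s * v x)"
      using a by (intro sublinear_onD(2)[OF p] fun_subspaceD[OF V] f v) auto
    also have "a * p (\<lambda>x. f x + s * v x) - (a * s) * p v = a * (p (\<lambda>x. f x + s * v x) - s * p v)"
      by (simp add: algebra_simps)
    also have "\<dots> \<le> a * (r f + e/a)" using s a by (intro mult_left_mono) auto
    finally show "r (\<lambda>x. a * f x) \<le> a * r f + e" using a by (simp add: algebra_simps)
  qed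
  have r0: "r (\<lambda>x. 0) = 0"
  proof (rule antisym)
    show "r (\<lambda>x. 0) \<le> 0"
      using rle[OF fun_subspaceD(1)[OF V], of 0] sublinear_on_zero[OF p V] by simp
    show "0 \<le> r (\<lambda>x. 0)" unfolding r_def
      using lower[OF fun_subspaceD(1)[OF V]] sublinear_on_zero[OF p V] ne by (intro cInf_greatest) auto
  qed
  have scale: "r (\<lambda>x. a * f x) = a * r f" if f: "f \<in> V" and a: "a \<ge> 0" for f a
  proof (cases "a = 0")
    case True then show ?thesis using r0 by simp
  next
    case False
    then have a: "a > 0" using a by simp
    have "r f = r (\<lambda>x. (1/a) * (a * f x))" using a by simp
    also have "\<dots> \<le> (1/a) * r (\<lambda>x. a * f x)"
      using a by (intro scale_le fun_subspaceD[OF V] f) auto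
    finally have "a * r f \<le> r (\<lambda>x. a * f x)" using a by (simp add: field_simps)
    then show ?thesis using scale_le[OF f a] by simp
  qed
  show ?thesis
  proof (rule that[of r])
    show "sublinear_on V r" using sub scale by (auto simp: sublinear_on_def)
    show "r f \<le> p f" if "f \<in> V" for f using rle[OF that, of 0] by simp
    show "r f \<le> p (\<lambda>x. f x + v x) - p v" if "f \<in> V" for f using rle[OF that, of 1] by simp
  qed
qed

text \<open>Zorn's lemma for the reversed pointwise order, with infima as bounds of chains. These
  are finite because every sublinear q below p satisfies q(f) \<ge> -q(-f) \<ge> -p(-f), and
  subadditive because members of a chain are comparable.\<close>

lemma minimal_sublinear:
  fixes p :: "('a \<Rightarrow> real) \<Rightarrow> real"
  assumes p: "sublinear_on V p" and V: "fun_subspace V"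
  obtains m where "sublinear_on V m" "\<And>f. f \<in> V \<Longrightarrow> m f \<le> p f"
    "\<And>r f. sublinear_on V r \<Longrightarrow> (\<And>f. f \<in> V \<Longrightarrow> r f \<le> m f) \<Longrightarrow> f \<in> V \<Longrightarrow> r f = m f"
proof -
  \<comment> \<open>Candidates are 0 off \<open>V\<close>, so that comparing them on all functions
    amounts to comparing them on \<open>V\<close>.\<close>
  define A where "A = {q. sublinear_on V q \<and> (\<forall>f\<in>V. q f \<le> p f) \<and> (\<forall>f. f \<notin> V \<longrightarrow> q f = 0)}"
  define P where "P q r \<longleftrightarrow> (\<forall>f. r f \<le> q f)" for q r :: "('a \<Rightarrow> real) \<Rightarrow> real"
  define p0 where "p0 f = (if f \<in> V then p f else 0)" for f
  have p0: "p0 \<in> A"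
    using p fun_subspaceD[OF V] by (auto simp: A_def p0_def sublinear_on_def)
  have po: "partial_order_on A (relation_of P A)"
    unfolding partial_order_on_def preorder_on_def refl_on_def trans_def antisym_def relation_of_def P_def
    by (auto intro: order_trans intro!: ext antisym)
  have ch: "\<exists>u\<in>A. \<forall>a\<in>C. P a u" if C: "C \<in> Chains (relation_of P A)" for C
  proof (cases "C = {}")
    case True then show ?thesis using p0 by auto
  next
    case False
    have CA: "C \<subseteq> A" using C by (auto simp: Chains_def relation_of_def)
    have tot: "P q r \<or> P r q" if "q \<in> C" "r \<in> C" for q r
      using C that by (auto simp: Chains_def relation_of_def)
    have lower: "- p (\<lambda>x. - f x) \<le> q f" if "q \<in> C" "f \<in> V" for q f
    proof -
      have q: "sublinear_on V q" "q (\<lambda>x. - f x) \<le> p (\<lambda>x. - f x)"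
        using CA that fun_subspaceD(4)[OF V] by (auto simp: A_def)
      then show ?thesis using sublinear_on_minus[OF q(1) V that(2)] by simp
    qed
    have bdd: "bdd_below ((\<lambda>q. q f) ` C)" if "f \<in> V" for f
      using lower[OF _ that] by (auto simp: bdd_below_def)
    define u where "u f = (if f \<in> V then (INF q\<in>C. q f) else 0)" for f
    have ule: "u f \<le> q f" if "q \<in> C" "f \<in> V" for q f
      using that bdd by (auto simp: u_def intro: cINF_lower)
    have near: "\<exists>q\<in>C. q f < u f + e" if "f \<in> V" "e > 0" for f and e :: real
      using cInf_lessD[of "(\<lambda>q. q f) ` C" "u f + e"] that False by (auto simp: u_def)
    have sub: "u (\<lambda>x. f x + g x) \<le> u f + u g" if f: "f \<in> V" and g: "g \<in> V" for f g
    proof (rule field_le_epsilon)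
      fix e :: real assume e: "e > 0"
      obtain q where q: "q \<in> C" "q f < u f + e/2" using near[OF f, of "e/2"] e by auto
      obtain r where r: "r \<in> C" "r g < u g + e/2" using near[OF g, of "e/2"] e by auto
      \<comment> \<open>The smaller of the two nearly optimal members of the chain serves for f and
        g at once.\<close>
      obtain s where s: "s \<in> C" "s f \<le> q f" "s g \<le> r g"
        using tot[OF q(1) r(1)] q(1) r(1) unfolding P_def by (metis order_refl)
      have "u (\<lambda>x. f x + g x) \<le> s (\<lambda>x. f x + g x)" by (intro ule s fun_subspaceD[OF V] f g)
      also have "\<dots> \<le> s f + s g" using s CA f g by (auto simp: A_def sublinear_on_def)
      finally show "u (\<lambda>x. f x + g x) \<le> u f + u g + e" using s q r by simp
    qed
    have scale: "u (\<lambda>x. a * f x) = a * u f" if f: "f \<in> V" and a: "a \<ge> 0" for f a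
    proof -
      have "u (\<lambda>x. a * f x) = (INF q\<in>C. a * q f)"
        using f a CA fun_subspaceD(3)[OF V f, of a]
        unfolding u_def by (auto simp: A_def sublinear_on_def intro!: INF_cong)
      also have "\<dots> = a * (INF q\<in>C. q f)"
      proof (cases "a = 0")
        case True then show ?thesis using False by simp
      next
        case F: False
        have "mono ((*) a)" using a by (auto simp: mono_def intro: mult_left_mono)
        moreover have "continuous (at_right (INF q\<in>C. q f)) ((*) a)"
          by (intro continuous_intros)
        ultimately show ?thesis
          using continuous_at_Inf_mono[of "(*) a" "(\<lambda>q. q f) ` C"] False bdd[OF f]
          by (auto simp: image_image)
      qed
      finally show ?thesis using f by (simp add: u_def)
    qed
    have "u \<in> A"
    proof -
      obtain q where q: "q \<in> C" using False by auto
      have "u f \<le> p f" if "f \<in> V" for f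
        using ule[OF q that] q CA that by (auto simp: A_def intro: order_trans)
      then show ?thesis using sub scale by (auto simp: A_def sublinear_on_def u_def)
    qed
    moreover have "P q u" if "q \<in> C" for q
      using ule[OF that] CA that by (auto simp: P_def A_def u_def)
    ultimately show ?thesis by blast
  qed
  obtain m where m: "m \<in> A" "\<And>a. a \<in> A \<Longrightarrow> P m a \<Longrightarrow> a = m"
    using predicate_Zorn[OF po ch] by blast
  show ?thesis
  proof (rule that[of m])
    show "sublinear_on V m" "\<And>f. f \<in> V \<Longrightarrow> m f \<le> p f" using m(1) by (auto simp: A_def)
    show "r f = m f" if r: "sublinear_on V r" "\<And>f. f \<in> V \<Longrightarrow> r f \<le> m f" "f \<in> V" for r f
    proof -
      define r0 where "r0 f = (if f \<in> V then r f else 0)" for f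
      have "r0 f \<le> p f" if "f \<in> V" for f
        using r(2)[OF that] that m(1) by (fastforce simp: A_def r0_def)
      then have "r0 \<in> A"
        using r(1) fun_subspaceD[OF V] by (auto simp: A_def r0_def sublinear_on_def)
      moreover have "P m r0" using r(2) m(1) by (auto simp: P_def A_def r0_def)
      ultimately have "r0 = m" by (rule m(2))
      moreover have "r0 f = r f" using r(3) by (simp add: r0_def)
      ultimately show ?thesis by simp
    qed
  qed
qed

text \<open>One reduction in direction v pins the value at v before Zorn's lemma is applied. The
  minimal functional m equals its own reduction s in any direction g, and s(f) \<le> m(f + g) - m(g)
  then says that m is superadditive.\<close>

theorem hahn_banach:
  fixes p :: "('a \<Rightarrow> real) \<Rightarrow> real"
  assumes p: "sublinear_on V p" and V: "fun_subspace V" and v: "v \<in> V"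
  obtains l where "\<And>f g. f \<in> V \<Longrightarrow> g \<in> V \<Longrightarrow> l (\<lambda>x. f x + g x) = l f + l g"
    "\<And>f a. f \<in> V \<Longrightarrow> l (\<lambda>x. a * f x) = a * l f"
    "\<And>f. f \<in> V \<Longrightarrow> l f \<le> p f" "l v = p v"
proof -
  obtain r where r: "sublinear_on V r" "\<And>f. f \<in> V \<Longrightarrow> r f \<le> p f"
    "\<And>f. f \<in> V \<Longrightarrow> r f \<le> p (\<lambda>x. f x + v x) - p v"
    using sublinear_on_reduction[OF p V v] by blast
  obtain m where m: "sublinear_on V m" "\<And>f. f \<in> V \<Longrightarrow> m f \<le> r f"
    "\<And>r f. sublinear_on V r \<Longrightarrow> (\<And>f. f \<in> V \<Longrightarrow> r f \<le> m f) \<Longrightarrow> f \<in> V \<Longrightarrow> r f = m f"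
    using minimal_sublinear[OF r(1) V] by blast
  have add: "m (\<lambda>x. f x + g x) = m f + m g" if f: "f \<in> V" and g: "g \<in> V" for f g
  proof (rule antisym)
    show "m (\<lambda>x. f x + g x) \<le> m f + m g" by (rule sublinear_onD(1)[OF m(1) f g])
    obtain s where s: "sublinear_on V s" "\<And>f. f \<in> V \<Longrightarrow> s f \<le> m f"
      "\<And>f. f \<in> V \<Longrightarrow> s f \<le> m (\<lambda>x. f x + g x) - m g"
      using sublinear_on_reduction[OF m(1) V g] by blast
    have "s f = m f" using s(1,2) f by (rule m(3))
    then show "m f + m g \<le> m (\<lambda>x. f x + g x)" using s(3)[OF f] by simp
  qed
  have neg: "m (\<lambda>x. - f x) = - m f" if f: "f \<in> V" for f
    using add[OF f fun_subspaceD(4)[OF V f]] sublinear_on_zero[OF m(1) V] by simp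
  have scale: "m (\<lambda>x. a * f x) = a * m f" if f: "f \<in> V" for f a
  proof (cases "a \<ge> 0")
    case True then show ?thesis using sublinear_onD(2)[OF m(1) f] by simp
  next
    case False
    then show ?thesis
      using sublinear_onD(2)[OF m(1) f, of "-a"] neg[OF fun_subspaceD(3)[OF V f, of "-a"]] by simp
  qed
  have v': "(\<lambda>x. - v x) \<in> V" by (rule fun_subspaceD(4)[OF V v])
  \<comment> \<open>The chain m(-v) \<le> r(-v) \<le> p(0) - p(v) turns an upper bound at -v into
    the lower bound at v.\<close>
  have "- m v \<le> - p v"
    using m(2)[OF v'] r(3)[OF v'] neg[OF v] sublinear_on_zero[OF p V] by simp
  moreover have "m v \<le> p v" using m(2)[OF v] r(2)[OF v] by simp
  ultimately have "m v = p v" by simp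
  moreover have "m f \<le> p f" if "f \<in> V" for f using m(2)[OF that] r(2)[OF that] by simp
  ultimately show ?thesis using that[of m] add scale by blast
qed

section \<open>Measures representing positive functionals on bounded functions\<close>

text \<open>The hypothesis is convergence in the one-point compactification. If the sequence does
  not escape, a subsequence stays in a ball and has a cluster point, and tent functions at that
  point attract the whole sequence.\<close>

lemma vague_limit_cases:
  fixes x :: "nat \<Rightarrow> 'a::euclidean_space"
  assumes conv: "\<And>G :: 'a \<Rightarrow> real. \<And>r. continuous_on UNIV G \<Longrightarrow> (\<And>y. norm y \<ge> r \<Longrightarrow> G y = 0) \<Longrightarrow>
    convergent (\<lambda>n. G (x n))"
  shows "convergent x \<or> (\<forall>r. eventually (\<lambda>n. norm (x n) > r) sequentially)"
proof (rule disjCI)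
  assume "\<not> (\<forall>r. eventually (\<lambda>n. norm (x n) > r) sequentially)"
  then obtain r where "\<not> eventually (\<lambda>n. norm (x n) > r) sequentially" by blast
  from not_eventually_sequentiallyD[OF this]
  obtain s :: "nat \<Rightarrow> nat" where s: "strict_mono s" "\<forall>n. \<not> norm (x (s n)) > r" by blast
  have "\<forall>n. (x \<circ> s) n \<in> cball 0 r" using s(2) by (auto simp: not_less)
  then obtain l t where lt: "strict_mono t" "((x \<circ> s) \<circ> t) \<longlonglongrightarrow> l"
    using compact_cball[of "0::'a" r] unfolding compact_def by blast
  have "x \<longlonglongrightarrow> l"
  proof (rule tendstoI)
    fix e :: real assume e: "e > 0"
    \<comment> \<open>A tent of height 1 at \<open>l\<close> that vanishes from distance e on. Its
      values tend to 1 along a subsequence, hence along the whole sequence, which must come within e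
      of \<open>l\<close>.\<close>
    define G where "G y = max 0 (1 - dist y l / e)" for y
    have "continuous_on UNIV G" unfolding G_def using e by (intro continuous_intros) auto
    moreover have "G y = 0" if "norm y \<ge> norm l + e" for y
      using norm_triangle_ineq2[of y l] that e by (simp add: G_def dist_norm field_simps)
    ultimately have "convergent (\<lambda>n. G (x n))" by (rule conv)
    then obtain c where c: "(\<lambda>n. G (x n)) \<longlonglongrightarrow> c" by (auto simp: convergent_def)
    have "(\<lambda>n. G (x ((s \<circ> t) n))) \<longlonglongrightarrow> c"
      using LIMSEQ_subseq_LIMSEQ[OF c strict_mono_o[OF s(1) lt(1)]] by (simp add: o_def)
    moreover have "(\<lambda>n. G (((x \<circ> s) \<circ> t) n)) \<longlonglongrightarrow> G l"
      by (rule continuous_on_tendsto_compose[OF \<open>continuous_on UNIV G\<close> lt(2)]) auto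
    ultimately have "c = G l" by (intro LIMSEQ_unique) (auto simp: o_def)
    then have "c = 1" by (simp add: G_def)
    then have "eventually (\<lambda>n. G (x n) > 0) sequentially"
      using c by (intro order_tendstoD(1)) auto
    then show "eventually (\<lambda>n. dist (x n) l < e) sequentially"
      by eventually_elim (use e in \<open>auto simp: G_def field_simps max_def split: if_splits\<close>)
  qed
  then show "convergent x" by (auto simp: convergent_def)
qed

text \<open>Nested half-open intervals of prescribed lengths, indexed by binary words (last letter first).
  They realize a finitely additive set function on the cells of a sequence of partitions by Lebesgue
  measure.\<close>

fun left_end :: "(bool list \<Rightarrow> real) \<Rightarrow> bool list \<Rightarrow> real" where
  "left_end a [] = 0"
| "left_end a (True # w) = left_end a w"
| "left_end a (False # w) = left_end a w + a (True # w)"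

definition word_interval :: "(bool list \<Rightarrow> real) \<Rightarrow> bool list \<Rightarrow> real set" where
  "word_interval a w = {left_end a w ..< left_end a w + a w}"

text \<open>The head of a word is its most recent letter, so \<open>b # w\<close> tests
  \<open>B (length w)\<close> and \<open>drop\<close> leads back to a coarser cell. Words of length
  n index the cells of the partition generated by the first n sets; some cells may be empty.\<close>

fun word_cell :: "(nat \<Rightarrow> 'a set) \<Rightarrow> bool list \<Rightarrow> 'a set" where
  "word_cell B [] = UNIV"
| "word_cell B (b # w) = word_cell B w \<inter> (if b then B (length w) else - B (length w))"

lemma word_interval_split:
  assumes "\<And>w. a w = a (True # w) + a (False # w)" "\<And>w. a w \<ge> 0"
  shows "word_interval a w = word_interval a (True # w) \<union> word_interval a (False # w)"
    "word_interval a (True # w) \<inter> word_interval a (False # w) = {}"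
  using assms(1)[of w] assms(2)[of "True # w"] assms(2)[of "False # w"]
  by (auto simp: word_interval_def)

text \<open>The two children of an interval partition it; a child of length 0 is empty because the
  intervals are half-open.\<close>

lemma word_interval_unique:
  assumes "\<And>w. a w = a (True # w) + a (False # w)" "\<And>w. a w \<ge> 0" "t \<in> word_interval a []"
  shows "\<exists>!w. length w = n \<and> t \<in> word_interval a w"
proof (induction n)
  case 0
  then show ?case using assms(3) by auto
next
  case (Suc n)
  then obtain w where w: "length w = n" "t \<in> word_interval a w"
    "\<And>v. length v = n \<Longrightarrow> t \<in> word_interval a v \<Longrightarrow> v = w" by blast
  obtain b where b: "t \<in> word_interval a (b # w)" "t \<notin> word_interval a ((\<not> b) # w)"
  proof (cases "t \<in> word_interval a (True # w)")
    case True
    then show ?thesis using that[of True] word_interval_split(2)[of a w, OF assms(1,2)] by auto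
  next
    case False
    then show ?thesis using that[of False] w(2) word_interval_split(1)[of a w, OF assms(1,2)] by auto
  qed
  show ?case
  proof (rule ex1I[of _ "b # w"])
    show "length (b # w) = Suc n \<and> t \<in> word_interval a (b # w)" using w(1) b(1) by simp
    fix v assume v: "length v = Suc n \<and> t \<in> word_interval a v"
    then obtain c u where u: "v = c # u" "length u = n" by (cases v) auto
    have "t \<in> word_interval a u"
      using v u word_interval_split(1)[of a u, OF assms(1,2)] by (cases c) auto
    then have "u = w" using u(2) w(3) by simp
    then have "c = b" using u v b by (cases c; cases b) auto
    then show "v = b # w" using u \<open>u = w\<close> by simp
  qed
qed

lemma word_interval_drop:
  assumes "\<And>w. a w = a (True # w) + a (False # w)" "\<And>w. a w \<ge> 0"
  shows "word_interval a w \<subseteq> word_interval a (drop k w)"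
proof (induction w arbitrary: k)
  case (Cons b w)
  have "word_interval a (b # w) \<subseteq> word_interval a w"
    using word_interval_split(1)[of a w, OF assms] by (cases b) auto
  with Cons show ?case by (cases k) auto
qed simp

lemma word_cell_drop: "word_cell B w \<subseteq> word_cell B (drop k w)"
proof (induction w arbitrary: k)
  case (Cons b w)
  then show ?case by (cases k) auto
qed simp

lemma word_cell_agree: "y \<in> word_cell B w \<Longrightarrow> z \<in> word_cell B w \<Longrightarrow> i < length w \<Longrightarrow> y \<in> B i \<longleftrightarrow> z \<in> B i"
  by (induction w) (auto simp: less_Suc_eq split: if_splits)

lemma word_cell_unique: "\<exists>!w. length w = n \<and> y \<in> word_cell B w"
proof (induction n)
  case 0
  show ?case by (rule ex1I[of _ "[]"]) auto
next
  case (Suc n)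
  then obtain w where w: "length w = n" "y \<in> word_cell B w"
    "\<And>v. length v = n \<Longrightarrow> y \<in> word_cell B v \<Longrightarrow> v = w" by blast
  show ?case
  proof (rule ex1I[of _ "(y \<in> B n) # w"])
    show "length ((y \<in> B n) # w) = Suc n \<and> y \<in> word_cell B ((y \<in> B n) # w)"
      using w(1,2) by simp
    fix v assume v: "length v = Suc n \<and> y \<in> word_cell B v"
    then obtain c u where u: "v = c # u" "length u = n" by (cases v) auto
    then have "u = w" using w(3)[of u] v by simp
    then show "v = (y \<in> B n) # w" using u v by (auto split: if_splits)
  qed
qed

text \<open>By compactness finitely many basic sets on which G oscillates by less than e cover the
  ball; N exceeds their indices. If one of two points with the same membership pattern lies in the
  ball, they share such a set; otherwise G vanishes at both.\<close>

lemma basis_separates: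
  fixes G :: "'a::euclidean_space \<Rightarrow> real" and B :: "nat \<Rightarrow> 'a set"
  assumes B: "topological_basis (range B)"
    and G: "continuous_on UNIV G" "\<And>y. norm y \<ge> r \<Longrightarrow> G y = 0" and e: "e > 0"
  obtains N where "\<And>y z. (\<And>i. i < N \<Longrightarrow> y \<in> B i \<longleftrightarrow> z \<in> B i) \<Longrightarrow> \<bar>G y - G z\<bar> < e"
proof -
  define J where "J = {i. \<forall>y\<in>B i. \<forall>z\<in>B i. \<bar>G y - G z\<bar> < e}"
  have "cball 0 r \<subseteq> (\<Union>i\<in>J. B i)"
  proof
    fix x assume "x \<in> cball (0::'a) r"
    define U where "U = G -` ball (G x) (e/2)"
    have "open U" unfolding U_def using G(1) by (intro open_vimage) auto
    moreover have "x \<in> U" using e by (simp add: U_def)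
    ultimately obtain i where i: "x \<in> B i" "B i \<subseteq> U"
      using topological_basisE[OF B] by (metis imageE)
    have "\<bar>G y - G z\<bar> < e" if "y \<in> B i" "z \<in> B i" for y z
    proof -
      have "\<bar>G x - G y\<bar> < e/2" "\<bar>G x - G z\<bar> < e/2" using i that by (auto simp: U_def dist_real_def)
      then show ?thesis by linarith
    qed
    then show "x \<in> (\<Union>i\<in>J. B i)" using i(1) by (auto simp: J_def)
  qed
  moreover have "open (B i)" for i using topological_basis_open[OF B] by auto
  ultimately obtain D where D: "D \<subseteq> J" "finite D" "cball 0 r \<subseteq> (\<Union>i\<in>D. B i)"
    using compactE_image[OF compact_cball, of J B 0 r] by metis
  obtain N where N: "\<And>i. i \<in> D \<Longrightarrow> i < N" using D(2) finite_nat_set_iff_bounded by auto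
  show ?thesis
  proof (rule that[of N])
    fix y z assume yz: "\<And>i. i < N \<Longrightarrow> y \<in> B i \<longleftrightarrow> z \<in> B i"
    show "\<bar>G y - G z\<bar> < e"
    proof (cases "norm y \<le> r \<or> norm z \<le> r")
      case True
      then obtain i where i: "i \<in> D" "y \<in> B i \<or> z \<in> B i" using D(3) by auto
      then have "y \<in> B i" "z \<in> B i" using yz[OF N[OF i(1)]] by auto
      then show ?thesis using i(1) D(1) by (auto simp: J_def)
    next
      case False
      then show ?thesis using G(2)[of y] G(2)[of z] e by auto
    qed
  qed
qed

text \<open>Finite additivity suffices to lay out intervals of lengths \<open>a w\<close>. A point t
  of the base interval selects one cell at each level, and \<open>X n t\<close> is a point of that
  cell. Refinement makes \<open>G (X n t)\<close> converge for every t, and dominated convergence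
  carries the limit through the Lebesgue integral. Those t whose sequence escapes to infinity hold
  the lost mass, hence the mere inequality for the total mass.\<close>

theorem bounded_functional_representation:
  fixes I :: "('a::euclidean_space \<Rightarrow> real) \<Rightarrow> real"
  assumes add: "\<And>f g. bounded (range f) \<Longrightarrow> bounded (range g) \<Longrightarrow> I (\<lambda>x. f x + g x) = I f + I g"
    and scale: "\<And>f a. bounded (range f) \<Longrightarrow> I (\<lambda>x. a * f x) = a * I f"
    and pos: "\<And>f. bounded (range f) \<Longrightarrow> (\<And>x. 0 \<le> f x) \<Longrightarrow> 0 \<le> I f"
  obtains \<mu> where "sets \<mu> = sets borel" "finite_measure \<mu>" "measure \<mu> UNIV \<le> I (\<lambda>x. 1)"
    "\<And>G r. continuous_on UNIV G \<Longrightarrow> (\<And>y. norm y \<ge> r \<Longrightarrow> G y = 0) \<Longrightarrow> (\<integral>y. G y \<partial>\<mu>) = I G"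
proof -
  have bdI: "bounded (range f)" if "\<And>x. \<bar>f x\<bar> \<le> K" for f :: "'a \<Rightarrow> real" and K
    using that by (auto simp: bounded_iff)
  have bdE: "\<exists>K. \<forall>x. \<bar>f x\<bar> \<le> K" if "bounded (range f)" for f :: "'a \<Rightarrow> real"
    using that by (auto simp: bounded_iff)
  have bd_ind: "bounded (range (indicator S :: 'a \<Rightarrow> real))" for S
    by (rule bdI[of _ 1]) (auto simp: indicator_def)
  have bd_cmult: "bounded (range (\<lambda>x. a * f x))" if bf: "bounded (range f)" for f :: "'a \<Rightarrow> real" and a
  proof -
    obtain K where "\<forall>x. \<bar>f x\<bar> \<le> K" using bdE[OF bf] by blast
    then show ?thesis by (intro bdI[of _ "\<bar>a\<bar> * K"]) (simp add: abs_mult mult_left_mono)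
  qed
  have bd_mult_ind: "bounded (range (\<lambda>x. f x * indicator S x))" if bf: "bounded (range f)" for f :: "'a \<Rightarrow> real" and S
  proof -
    obtain K where "\<forall>x. \<bar>f x\<bar> \<le> K" using bdE[OF bf] by blast
    moreover then have "0 \<le> K" using abs_ge_zero order_trans by blast
    ultimately show ?thesis by (intro bdI[of _ K]) (simp add: indicator_def)
  qed
  have bd_add: "bounded (range (\<lambda>x. f x + g x))" if bf: "bounded (range f)" and bg: "bounded (range g)" for f g :: "'a \<Rightarrow> real"
  proof -
    obtain K where "\<forall>x. \<bar>f x\<bar> \<le> K" using bdE[OF bf] by blast
    moreover obtain L where "\<forall>x. \<bar>g x\<bar> \<le> L" using bdE[OF bg] by blast
    ultimately show ?thesis by (intro bdI[of _ "K + L"]) (meson abs_triangle_ineq add_mono order_trans)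
  qed
  have I_zero: "I (\<lambda>x. 0) = 0" using scale[of "\<lambda>x. 0" 0] bdI[of "\<lambda>x. 0" 0] by simp
  have bd_sum: "bounded (range (\<lambda>x. \<Sum>s\<in>S. f s x))"
    if "\<And>s. s \<in> S \<Longrightarrow> bounded (range (f s))" for S :: "bool list set" and f :: "bool list \<Rightarrow> 'a \<Rightarrow> real"
    using that
  proof (induction S rule: infinite_finite_induct)
    case (insert s S)
    then show ?case by (simp add: bd_add)
  qed (auto intro!: bdI[of "\<lambda>x. 0" 0])
  have I_sum: "I (\<lambda>x. \<Sum>s\<in>S. f s x) = (\<Sum>s\<in>S. I (f s))"
    if "finite S" "\<And>s. s \<in> S \<Longrightarrow> bounded (range (f s))" for S :: "bool list set" and f
    using that
  proof (induction S rule: finite_induct)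
    case (insert s S)
    have "I (\<lambda>x. f s x + (\<Sum>s\<in>S. f s x)) = I (f s) + I (\<lambda>x. \<Sum>s\<in>S. f s x)"
      using insert by (intro add bd_sum) auto
    then show ?case using insert by simp
  qed (simp add: I_zero)
  have I_mono: "I f \<le> I g" if "bounded (range f)" "bounded (range g)" "\<And>x. f x \<le> g x" for f g
  proof -
    have "0 \<le> I (\<lambda>x. g x + (-1) * f x)"
      using that by (intro pos bd_add bd_cmult) auto
    also have "\<dots> = I g - I f"
      using add[OF that(2) bd_cmult[OF that(1), of "-1"]] scale[OF that(1), of "-1"] by simp
    finally show ?thesis by simp
  qed

  obtain \<B> :: "'a set set" where \<B>: "countable \<B>" "topological_basis \<B>"
    using ex_countable_basis by blast
  define B where "B = from_nat_into \<B>"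
  have "\<B> \<noteq> {}" using topological_basisE[OF \<B>(2) open_UNIV UNIV_I] by blast
  then have B: "topological_basis (range B)"
    using \<B> by (simp add: B_def range_from_nat_into)

  define a where "a w = I (indicator (word_cell B w))" for w
  \<comment> \<open>On an empty cell the choice is arbitrary; there \<open>a w = 0\<close>, the
    interval is empty, and the chosen value has no weight.\<close>
  define pick where "pick w = (SOME y. y \<in> word_cell B w)" for w
  define C where "C n = {w :: bool list. length w = n}" for n
  define J where "J = word_interval a"
  define X where "X n t = (\<Sum>w\<in>C n. indicator (J w) t *\<^sub>R pick w)" for n t
  have finC: "finite (C n)" for n
    using finite_lists_length_eq[of "UNIV :: bool set" n] by (simp add: C_def)
  have a0: "a w \<ge> 0" for w unfolding a_def by (intro pos bd_ind) auto
  have a_split: "a w = a (True # w) + a (False # w)" for w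
  proof -
    have "indicator (word_cell B w) = (\<lambda>x. indicator (word_cell B (True # w)) x + indicator (word_cell B (False # w)) x :: real)"
      by (rule ext) (simp add: indicator_def)
    then show ?thesis unfolding a_def by (metis (no_types) add bd_ind)
  qed
  have a_Nil: "a [] = I (\<lambda>x. 1)" by (simp add: a_def indicator_def)
  have J_Nil: "J w \<subseteq> J []" for w
    using word_interval_drop[OF a_split a0, of w "length w"] by (simp add: J_def)
  have J_unique: "\<exists>!w. w \<in> C n \<and> t \<in> J w" if "t \<in> J []" for n t
    using word_interval_unique[OF a_split a0, of t n] that by (simp add: C_def J_def)
  have measJ: "J w \<in> sets lborel" for w by (simp add: J_def word_interval_def)
  have lenJ: "measure lborel (J w) = a w" "emeasure lborel (J w) < \<infinity>" for w
    using a0[of w] by (simp_all add: J_def word_interval_def)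
  have pick: "pick w \<in> word_cell B w" if "t \<in> J w" for t w
  proof -
    have "a w > 0" using that by (simp add: J_def word_interval_def)
    moreover have "indicator ({} :: 'a set) = (\<lambda>x. 0 :: real)" by auto
    ultimately have "word_cell B w \<noteq> {}" using I_zero by (auto simp: a_def)
    then show ?thesis unfolding pick_def by (simp add: some_in_eq)
  qed
  have delta: "(\<Sum>v\<in>C n. indicator (J v) t *\<^sub>R f v) = f w" if "w \<in> C n" "t \<in> J w"
    for n t w and f :: "bool list \<Rightarrow> 'c::real_vector"
  proof -
    have eq: "v = w" if "v \<in> C n" "t \<in> J v" for v
    proof -
      have "t \<in> J []" using J_Nil \<open>t \<in> J w\<close> by blast
      from J_unique[OF this, of n] show ?thesis using that \<open>w \<in> C n\<close> \<open>t \<in> J w\<close> by blast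
    qed
    have "(\<Sum>v\<in>C n. indicator (J v) t *\<^sub>R f v) = (\<Sum>v\<in>C n. if v = w then f v else 0)"
    proof (intro sum.cong refl)
      fix v assume "v \<in> C n"
      then show "indicator (J v) t *\<^sub>R f v = (if v = w then f v else 0)"
        using eq[of v] that(2) by (cases "t \<in> J v") auto
    qed
    then show ?thesis using finC that(1) by simp
  qed
  have X_pick: "X n t = pick w" if "w \<in> C n" "t \<in> J w" for n t w
    unfolding X_def using that by (rule delta)

  have bdG: "bounded (range G)" if "continuous_on UNIV G" "\<And>y. norm y \<ge> r \<Longrightarrow> G y = 0"
    for G :: "'a \<Rightarrow> real" and r
  proof -
    have "compact (G ` cball 0 r)"
      using that(1) by (intro compact_continuous_image) (auto intro: continuous_on_subset)
    then have "bounded (insert 0 (G ` cball 0 r))" by (simp add: compact_imp_bounded)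
    moreover have "range G \<subseteq> insert 0 (G ` cball 0 r)"
    proof
      fix z assume "z \<in> range G"
      then obtain y where "z = G y" by auto
      then show "z \<in> insert 0 (G ` cball 0 r)" using that(2)[of y] by (cases "norm y \<le> r") auto
    qed
    ultimately show ?thesis by (rule bounded_subset)
  qed

  have Cauchy: "convergent (\<lambda>n. G (X n t))"
    if t: "t \<in> J []" and G: "continuous_on UNIV G" "\<And>y. norm y \<ge> r \<Longrightarrow> G y = 0"
    for G :: "'a \<Rightarrow> real" and r t
  proof -
    have "Cauchy (\<lambda>n. G (X n t))"
    proof (rule metric_CauchyI)
      fix e :: real assume "e > 0"
      obtain N where N: "\<And>y z. (\<And>i. i < N \<Longrightarrow> y \<in> B i \<longleftrightarrow> z \<in> B i) \<Longrightarrow> \<bar>G y - G z\<bar> < e"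
        using basis_separates[OF B G \<open>e > 0\<close>] by blast
      obtain w where w: "w \<in> C N" "t \<in> J w" using J_unique[OF t] by blast
      \<comment> \<open>The word selected by t at level n \<ge> N has the word w selected at level N
        as its tail, so all later points stay in one cell of level N.\<close>
      have cell: "X n t \<in> word_cell B w" if n: "n \<ge> N" for n
      proof -
        obtain v where v: "v \<in> C n" "t \<in> J v" using J_unique[OF t] by blast
        have "drop (n - N) v \<in> C N" using v n by (simp add: C_def)
        moreover have "t \<in> J (drop (n - N) v)"
          using v(2) word_interval_drop[OF a_split a0] by (auto simp: J_def)
        ultimately have "drop (n - N) v = w" using J_unique[OF t, of N] w by blast
        then have "word_cell B v \<subseteq> word_cell B w" using word_cell_drop[of B v "n - N"] by simp
        then show ?thesis using X_pick[OF v] pick[OF v(2)] by auto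
      qed
      have "dist (G (X m t)) (G (X n t)) < e" if "m \<ge> N" "n \<ge> N" for m n
        unfolding dist_real_def
        using w(1) by (intro N word_cell_agree[OF cell[OF that(1)] cell[OF that(2)]]) (simp add: C_def)
      then show "\<exists>M. \<forall>m\<ge>M. \<forall>n\<ge>M. dist (G (X m t)) (G (X n t)) < e" by blast
    qed
    then show ?thesis by (rule Cauchy_convergent)
  qed

  have approx: "(\<lambda>n. \<Sum>w\<in>C n. a w * G (pick w)) \<longlonglongrightarrow> I G"
    if G: "continuous_on UNIV G" "\<And>y. norm y \<ge> r \<Longrightarrow> G y = 0" for G :: "'a \<Rightarrow> real" and r
  proof (rule LIMSEQ_I)
    fix d :: real assume d: "d > 0"
    \<comment> \<open>The summand 1 keeps the quotient positive when the total mass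
      \<open>a []\<close> is 0.\<close>
    define e where "e = d / (a [] + 1)"
    have e: "e > 0" "e * a [] < d" using d a0[of "[]"] by (simp_all add: e_def field_simps)
    obtain N where N: "\<And>y z. (\<And>i. i < N \<Longrightarrow> y \<in> B i \<longleftrightarrow> z \<in> B i) \<Longrightarrow> \<bar>G y - G z\<bar> < e"
      using basis_separates[OF B G e(1)] by blast
    have "norm ((\<Sum>w\<in>C n. a w * G (pick w)) - I G) < d" if n: "n \<ge> N" for n
    proof -
      have one: "(\<Sum>w\<in>C n. indicator (word_cell B w) x) = (1::real)" for x
      proof -
        have ex1: "\<exists>!w. w \<in> C n \<and> x \<in> word_cell B w"
          unfolding C_def mem_Collect_eq by (rule word_cell_unique)
        then obtain w where w: "w \<in> C n" "x \<in> word_cell B w" by blast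
        have eq: "v = w" if "v \<in> C n" "x \<in> word_cell B v" for v
          using ex1 w that by blast
        have "(\<Sum>v\<in>C n. indicator (word_cell B v) x) = (\<Sum>v\<in>C n. if v = w then 1 else (0::real))"
        proof (intro sum.cong refl)
          fix v assume "v \<in> C n"
          then show "indicator (word_cell B v) x = (if v = w then 1 else (0::real))"
            using w(2) eq[of v] by (cases "x \<in> word_cell B v") auto
        qed
        then show ?thesis using finC w(1) by simp
      qed
      have "(\<lambda>x. \<Sum>w\<in>C n. G x * indicator (word_cell B w) x) = G"
        by (rule ext) (simp add: one flip: sum_distrib_left)
      then have "I G = I (\<lambda>x. \<Sum>w\<in>C n. G x * indicator (word_cell B w) x)"
        by (simp only:)
      also have "\<dots> = (\<Sum>w\<in>C n. I (\<lambda>x. G x * indicator (word_cell B w) x))"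
        by (intro I_sum finC bd_mult_ind bdG[OF G])
      finally have "(\<Sum>w\<in>C n. a w * G (pick w)) - I G =
          (\<Sum>w\<in>C n. a w * G (pick w) - I (\<lambda>x. G x * indicator (word_cell B w) x))"
        by (simp add: sum_subtractf)
      also have "norm \<dots> \<le> (\<Sum>w\<in>C n. e * a w)"
      proof (intro sum_norm_le)
        fix w assume w: "w \<in> C n"
        \<comment> \<open>On a cell of level n \<ge> N the function G is within e of its value at
          the picked point; by positivity of I the error on the cell is at most e times its
          length.\<close>
        have near: "\<bar>G x - G (pick w)\<bar> < e" if "x \<in> word_cell B w" for x
        proof -
          have "pick w \<in> word_cell B w" unfolding pick_def using that by (rule someI)
          then show ?thesis using w n by (intro N word_cell_agree[OF that]) (auto simp: C_def)
        qed
        have "I (\<lambda>x. G x * indicator (word_cell B w) x) \<le> I (\<lambda>x. (G (pick w) + e) * indicator (word_cell B w) x)"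
        proof (rule I_mono[OF bd_mult_ind[OF bdG[OF G]] bd_cmult[OF bd_ind]])
          fix x show "G x * indicator (word_cell B w) x \<le> (G (pick w) + e) * indicator (word_cell B w) x"
            using near[of x] by (cases "x \<in> word_cell B w") auto
        qed
        moreover have "I (\<lambda>x. (G (pick w) - e) * indicator (word_cell B w) x) \<le> I (\<lambda>x. G x * indicator (word_cell B w) x)"
        proof (rule I_mono[OF bd_cmult[OF bd_ind] bd_mult_ind[OF bdG[OF G]]])
          fix x show "(G (pick w) - e) * indicator (word_cell B w) x \<le> G x * indicator (word_cell B w) x"
            using near[of x] by (cases "x \<in> word_cell B w") auto
        qed
        ultimately show "norm (a w * G (pick w) - I (\<lambda>x. G x * indicator (word_cell B w) x)) \<le> e * a w"
          unfolding scale[OF bd_ind] a_def[symmetric] by (simp add: algebra_simps abs_le_iff)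
      qed
      also have "\<dots> = e * a []"
      proof -
        have "(\<Sum>w\<in>C n. a w) = I (\<lambda>x. \<Sum>w\<in>C n. indicator (word_cell B w) x)"
          unfolding a_def by (subst I_sum) (auto intro: finC bd_ind)
        then show ?thesis by (simp add: one a_Nil flip: sum_distrib_left)
      qed
      finally show ?thesis using e by simp
    qed
    then show "\<exists>N. \<forall>n\<ge>N. norm ((\<Sum>w\<in>C n. a w * G (pick w)) - I G) < d" by blast
  qed

  \<comment> \<open>The indicator matters: off the base interval \<open>X n t\<close> is 0, where G
    need not vanish.\<close>
  have simple_integral: "(\<integral>t. indicator (J []) t * G (X n t) \<partial>lborel) = (\<Sum>w\<in>C n. a w * G (pick w))"
    for G :: "'a \<Rightarrow> real" and n
  proof -
    have "indicator (J []) t * G (X n t) = (\<Sum>w\<in>C n. indicator (J w) t *\<^sub>R G (pick w))" for t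
    proof (cases "t \<in> J []")
      case True
      then obtain w where w: "w \<in> C n" "t \<in> J w" using J_unique by blast
      show ?thesis using delta[OF w, of "\<lambda>w. G (pick w)"] X_pick[OF w] True by simp
    next
      case False
      then have "t \<notin> J w" for w using J_Nil by blast
      then show ?thesis using False by simp
    qed
    then show ?thesis
      using measJ lenJ by (simp add: Bochner_Integration.integral_sum)
  qed

  have measX [measurable]: "X n \<in> borel_measurable lborel" for n
    unfolding X_def using measJ by (intro borel_measurable_sum borel_measurable_scaleR) auto
  \<comment> \<open>Where the sequence diverges \<open>lim\<close> is arbitrary; restricting to
    \<open>K\<close> removes these t.\<close>
  define L where "L t = lim (\<lambda>n. X n t)" for t
  define K where "K = {t \<in> J []. convergent (\<lambda>n. X n t)}"
  have measL [measurable]: "L \<in> borel_measurable lborel" unfolding L_def by measurable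
  have measK: "K \<in> sets lborel"
  proof -
    have "{t \<in> space lborel. convergent (\<lambda>n. X n t)} \<in> sets lborel"
      unfolding Cauchy_convergent_iff[symmetric] by measurable
    moreover have "K = J [] \<inter> {t \<in> space lborel. convergent (\<lambda>n. X n t)}" by (auto simp: K_def)
    ultimately show ?thesis using measJ by auto
  qed
  define \<mu> where "\<mu> = distr (restrict_space lborel K) borel L"
  have measL': "L \<in> measurable (restrict_space lborel K) borel"
    by (rule measurable_restrict_space1) (rule measL)
  have Kfin: "emeasure lborel K \<le> emeasure lborel (J [])"
    using measJ by (intro emeasure_mono) (auto simp: K_def)
  have emu: "emeasure \<mu> UNIV = emeasure lborel K"
    using measK by (simp add: \<mu>_def emeasure_distr[OF measL'] space_restrict_space emeasure_restrict_space)
  have fin: "finite_measure \<mu>"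
    using emu Kfin lenJ(2)[of "[]"] by (intro finite_measureI) (auto simp: \<mu>_def)
  show thesis
  proof (rule that[of \<mu>])
    show "sets \<mu> = sets borel" by (simp add: \<mu>_def)
    show "finite_measure \<mu>" by (rule fin)
    have "measure lborel K \<le> measure lborel (J [])"
      unfolding measure_def using Kfin lenJ(2)[of "[]"] by (intro enn2real_mono) auto
    then show "measure \<mu> UNIV \<le> I (\<lambda>x. 1)"
      using emu by (simp add: measure_def lenJ(1)[unfolded measure_def] a_Nil)
  next
    fix G :: "'a \<Rightarrow> real" and r
    assume G: "continuous_on UNIV G" "\<And>y. norm y \<ge> r \<Longrightarrow> G y = 0"
    have Gm [measurable]: "G \<in> borel_measurable borel" using G(1) by (rule borel_measurable_continuous_onI)
    obtain D where D: "\<And>x. \<bar>G x\<bar> \<le> D" using bdE[OF bdG[OF G]] by blast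
    have "(\<lambda>n. \<integral>t. indicator (J []) t * G (X n t) \<partial>lborel) \<longlonglongrightarrow> (\<integral>t. indicator K t * G (L t) \<partial>lborel)"
    proof (rule integral_dominated_convergence[where w = "\<lambda>t. indicator (J []) t * D"])
      show "(\<lambda>t. indicator K t * G (L t)) \<in> borel_measurable lborel"
        using measK by measurable
      show "(\<lambda>t. indicator (J []) t * G (X n t)) \<in> borel_measurable lborel" for n
        using measJ by measurable
      show "integrable lborel (\<lambda>t. indicator (J []) t * D)" using measJ lenJ by simp
      show "AE t in lborel. norm (indicator (J []) t * G (X n t)) \<le> indicator (J []) t * D" for n
        using D by (auto simp: indicator_def)
      show "AE t in lborel. (\<lambda>n. indicator (J []) t * G (X n t)) \<longlonglongrightarrow> indicator K t * G (L t)"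
      proof (intro AE_I2)
        fix t
        \<comment> \<open>In the last case the sequence leaves the ball outside which G vanishes, so
          the integrands are eventually 0.\<close>
        consider "t \<notin> J []" | "t \<in> J []" "convergent (\<lambda>n. X n t)"
          | "t \<in> J []" "t \<notin> K" "\<forall>s. eventually (\<lambda>n. norm (X n t) > s) sequentially"
          using vague_limit_cases[of "\<lambda>n. X n t"] Cauchy unfolding K_def by blast
        then show "(\<lambda>n. indicator (J []) t * G (X n t)) \<longlonglongrightarrow> indicator K t * G (L t)"
        proof cases
          case 1 then show ?thesis by (simp add: K_def)
        next
          case 2
          then have "(\<lambda>n. X n t) \<longlonglongrightarrow> L t" by (simp add: L_def convergent_LIMSEQ_iff)
          then have "(\<lambda>n. G (X n t)) \<longlonglongrightarrow> G (L t)"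
            by (rule continuous_on_tendsto_compose[OF G(1)]) auto
          then show ?thesis using 2 by (simp add: K_def)
        next
          case 3
          have "eventually (\<lambda>n. G (X n t) = 0) sequentially"
            using 3(3)[rule_format, of r] by eventually_elim (simp add: G(2))
          then have "(\<lambda>n. G (X n t)) \<longlonglongrightarrow> 0" by (rule tendsto_eventually)
          then show ?thesis using 3 by simp
        qed
      qed
    qed
    then have "(\<integral>t. indicator K t * G (L t) \<partial>lborel) = I G"
      unfolding simple_integral using approx[OF G] by (rule LIMSEQ_unique)
    moreover have "(\<integral>y. G y \<partial>\<mu>) = (\<integral>t. indicator K t * G (L t) \<partial>lborel)"
      using measK measL' by (simp add: \<mu>_def integral_distr integral_restrict_space)
    ultimately show "(\<integral>y. G y \<partial>\<mu>) = I G" by simp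
  qed
qed

section \<open>A smooth bump function\<close>

text \<open>Functions of this shape are closed under differentiation, so carrying the polynomial
  along reduces smoothness to a single derivative formula.\<close>

definition flat :: "real poly \<Rightarrow> real \<Rightarrow> real" where
  "flat P u = (if u \<le> 0 then 0 else poly P (1 / u) * exp (- 1 / u))"

lemma poly_times_exp_minus_tendsto_0: "((\<lambda>v. poly P v * exp (- v)) \<longlongrightarrow> 0) (at_top :: real filter)"
proof -
  have "((\<lambda>v. \<Sum>i\<le>degree P. coeff P i * (v ^ i / exp v)) \<longlongrightarrow> (\<Sum>i\<le>degree P. coeff P i * 0)) at_top"
    by (intro tendsto_sum tendsto_mult tendsto_const tendsto_power_div_exp_0)
  moreover have "(\<lambda>v. \<Sum>i\<le>degree P. coeff P i * (v ^ i / exp v)) = (\<lambda>v. poly P v * exp (- v))"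
    by (rule ext) (simp add: poly_altdef sum_distrib_right exp_minus divide_inverse mult.assoc)
  ultimately show ?thesis by simp
qed

text \<open>For u > 0 the derivative is u^(-2) (P(1/u) - P'(1/u)) exp(-1/u), and u^(-2) is the
  polynomial X^2, written \<open>[:0, 0, 1:]\<close>, at 1/u. At u = 0 the right difference quotient
  is X P at 1/h times exp(-1/h), which tends to 0.\<close>

lemma flat_has_derivative:
  "(flat P has_real_derivative flat ([:0, 0, 1:] * (P - pderiv P)) u) (at u)"
proof -
  consider "u < 0" | "u = 0" | "u > 0" by linarith
  then show ?thesis
  proof cases
    case 1
    have "(flat P has_real_derivative 0) (at u)"
      by (rule has_field_derivative_transform_within_open[of "\<lambda>x. 0" _ _ "{..<0}"])
        (use 1 in \<open>auto simp: flat_def\<close>)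
    then show ?thesis using 1 by (simp add: flat_def)
  next
    case 2
    have "((\<lambda>h. flat P h / h) \<longlongrightarrow> 0) (at_left 0)"
      by (rule tendsto_eventually) (simp add: eventually_at_filter flat_def)
    moreover have "((\<lambda>h. flat P h / h) \<longlongrightarrow> 0) (at_right 0)"
    proof -
      have "((\<lambda>h. poly (pCons 0 P) (inverse h) * exp (- inverse h)) \<longlongrightarrow> 0) (at_right (0::real))"
        by (rule filterlim_compose[OF poly_times_exp_minus_tendsto_0 filterlim_inverse_at_top_right])
      moreover have "eventually (\<lambda>h. poly (pCons 0 P) (inverse h) * exp (- inverse h) = flat P h / h) (at_right (0::real))"
        unfolding eventually_at_filter by (rule always_eventually) (auto simp: flat_def field_simps)
      ultimately show ?thesis by (rule Lim_transform_eventually)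
    qed
    ultimately have "((\<lambda>h. flat P h / h) \<longlongrightarrow> 0) (at 0)" by (simp add: filterlim_split_at)
    then show ?thesis using 2 by (simp add: DERIV_def flat_def)
  next
    case 3
    have "((\<lambda>u. poly P (1 / u) * exp (- 1 / u)) has_real_derivative
        poly P (1 / u) * (exp (- 1 / u) * (1 / u\<^sup>2)) + poly (pderiv P) (1 / u) * (- 1 / u\<^sup>2) * exp (- 1 / u)) (at u)"
      using 3 by (auto intro!: derivative_eq_intros DERIV_chain2[OF poly_DERIV] simp: power2_eq_square field_simps)
    moreover have "poly P (1 / u) * (exp (- 1 / u) * (1 / u\<^sup>2)) + poly (pderiv P) (1 / u) * (- 1 / u\<^sup>2) * exp (- 1 / u) =
        flat ([:0, 0, 1:] * (P - pderiv P)) u"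
      using 3 by (simp add: flat_def power2_eq_square field_simps)
    ultimately have "((\<lambda>u. poly P (1 / u) * exp (- 1 / u)) has_real_derivative flat ([:0, 0, 1:] * (P - pderiv P)) u) (at u)"
      by simp
    then show ?thesis
      by (rule has_field_derivative_transform_within_open[of _ _ _ "{0<..}"])
        (use 3 in \<open>auto simp: flat_def\<close>)
  qed
qed

text \<open>A partial derivative reproduces the same form with another polynomial, times -2 y_i; the
  induction on k therefore runs over all P.\<close>

lemma C_k_flat: "C_k k (\<lambda>y::real^'n::finite. flat P (1 - y \<bullet> y))"
proof (induction k arbitrary: P)
  case 0
  have "continuous_on UNIV (flat P)"
    by (intro continuous_at_imp_continuous_on ballI DERIV_isCont[OF flat_has_derivative])
  moreover have "continuous_on UNIV (\<lambda>y::real^'n. 1 - y \<bullet> y)" by (intro continuous_intros)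
  ultimately have "continuous_on UNIV (\<lambda>y::real^'n. flat P (1 - y \<bullet> y))"
    by (rule continuous_on_compose2) simp
  then show ?case by simp
next
  case (Suc k)
  define R where "R = [:0, 0, 1:] * (P - pderiv P)"
  have D: "((\<lambda>y::real^'n. flat P (1 - y \<bullet> y)) has_derivative
      (\<lambda>h. (- (2 * (y \<bullet> h))) * flat R (1 - y \<bullet> y))) (at y)" for y
    unfolding R_def
    by (rule DERIV_compose_FDERIV[OF flat_has_derivative])
      (auto intro!: derivative_eq_intros simp: inner_commute)
  have "partial_derivative i (\<lambda>y::real^'n. flat P (1 - y \<bullet> y)) = (\<lambda>y. (- 2 * y $ i) * flat R (1 - y \<bullet> y))" for i
    by (rule ext) (simp add: partial_derivative_eqI[OF D] inner_axis)
  moreover have "C_k k (\<lambda>y::real^'n. (- 2 * y $ i) * flat R (1 - y \<bullet> y))" for i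
    by (intro C_k_mult C_k_const C_k_nth Suc)
  ultimately show ?case using D by (auto simp: differentiable_def)
qed

text \<open>The factor \<open>exp 1\<close> normalizes the value at the origin to 1, so that the
  weight vanishes there. The bump is 0 exactly for |y| \<ge> 1, which matches the truncation in the
  Levy operator.\<close>

definition bump :: "real^'n::finite \<Rightarrow> real" where
  "bump y = exp 1 * flat 1 (1 - y \<bullet> y)"

lemma bump_eq: "norm y < 1 \<Longrightarrow> bump y = exp (1 - 1 / (1 - (norm y)\<^sup>2))"
  by (simp add: bump_def flat_def dot_square_norm abs_square_less_1 not_le flip: exp_add)

lemma bump_eq_0: "norm y \<ge> 1 \<Longrightarrow> bump y = 0"
  by (simp add: bump_def flat_def dot_square_norm)

lemma bump_0 [simp]: "bump 0 = 1"
  by (simp add: bump_eq)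

lemma bump_Cc: "bump \<in> Cc_infinity"
proof (rule Cc_infinityI)
  show "C_k k bump" for k
    unfolding bump_def by (intro C_k_mult C_k_const C_k_flat)
  show "bump x = 0" if "norm x \<ge> 1" for x :: "real^'a" using that by (rule bump_eq_0)
qed

lemma bump_nonneg: "bump y \<ge> 0"
  by (simp add: bump_def flat_def)

text \<open>With s = |y|^2 < 1, the inequality exp t \<ge> 1 + t at t = 1/(1 - s) - 1 reads exp t
  \<ge> 1/(1 - s); inverting bounds the bump by 1 - s. Hence the weight dominates min(1, |y|^2) with
  constant 1.\<close>

lemma bump_le: "bump y \<le> 1 - min 1 ((norm y)\<^sup>2)"
proof (cases "norm y < 1")
  case True
  define s where "s = (norm y)\<^sup>2"
  have s: "0 \<le> s" "s < 1" using True by (auto simp: s_def abs_square_less_1)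
  have "inverse (1 - s) = 1 + (1 / (1 - s) - 1)" by (simp add: field_simps)
  also have "\<dots> \<le> exp (1 / (1 - s) - 1)" by (rule exp_ge_add_one_self)
  finally have "inverse (exp (1 / (1 - s) - 1)) \<le> 1 - s"
    using s by (metis inverse_inverse_eq le_imp_inverse_le positive_imp_inverse_positive diff_gt_0_iff_gt)
  then have "exp (1 - 1 / (1 - s)) \<le> 1 - s" by (simp flip: exp_minus)
  then show ?thesis using True s by (simp add: bump_eq s_def)
next
  case False
  then show ?thesis by (simp add: bump_eq_0)
qed

section \<open>Taylor expansion of test functions at the origin\<close>

lemma frechet_derivative_gradient:
  assumes "f differentiable (at x)"
  shows "frechet_derivative f (at x) h = h \<bullet> gradient f x"
proof -
  have lin: "linear (frechet_derivative f (at x))"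
    using assms by (intro has_derivative_linear) (simp add: frechet_derivative_works)
  have "h = (\<Sum>i\<in>UNIV. h $ i *\<^sub>R axis i 1)"
    using basis_expansion[of h] by (simp add: scalar_mult_eq_scaleR)
  then have "frechet_derivative f (at x) h = frechet_derivative f (at x) (\<Sum>i\<in>UNIV. h $ i *\<^sub>R axis i 1)"
    by (rule arg_cong)
  also have "\<dots> = (\<Sum>i\<in>UNIV. h $ i * partial_derivative i f x)"
    by (simp add: linear_sum[OF lin] linear_scale[OF lin] partial_derivative_def)
  also have "\<dots> = h \<bullet> gradient f x" by (simp add: inner_vec_def gradient_def)
  finally show ?thesis .
qed

lemma line_derivative:
  assumes "\<And>x. f differentiable (at x)"
  shows "((\<lambda>t. f (t *\<^sub>R y)) has_real_derivative y \<bullet> gradient f (t *\<^sub>R y)) (at t)"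
proof -
  have "(f has_derivative (\<lambda>h. h \<bullet> gradient f (t *\<^sub>R y))) (at (t *\<^sub>R y))"
    using assms[of "t *\<^sub>R y"]
    by (simp add: frechet_derivative_works flip: frechet_derivative_gradient[OF assms])
  moreover have "((\<lambda>t. t *\<^sub>R y) has_derivative (\<lambda>h. h *\<^sub>R y)) (at t)"
    by (intro bounded_linear_imp_has_derivative bounded_linear_scaleR_left)
  ultimately have "((\<lambda>t. f (t *\<^sub>R y)) has_derivative (\<lambda>h. (h *\<^sub>R y) \<bullet> gradient f (t *\<^sub>R y))) (at t)"
    by (rule has_derivative_compose[rotated])
  then show ?thesis by (simp add: has_field_derivative_def mult_commute_abs)
qed

lemma hessian_form: "y \<bullet> (hessian f x *v y) = (\<Sum>i\<in>UNIV. \<Sum>j\<in>UNIV. y $ i * y $ j * hessian f x $ i $ j)"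
  by (simp add: inner_vec_def matrix_vector_mult_def sum_distrib_left mult_ac)

text \<open>Maclaurin's formula with Lagrange remainder for the one-variable function t -> f(t y) on
  [0, 1].\<close>

lemma second_order_taylor:
  assumes f: "f \<in> Cc_infinity"
  obtains t where "0 < t" "t < 1"
    "f y = f 0 + y \<bullet> gradient f 0 + 1/2 * (y \<bullet> (hessian f (t *\<^sub>R y) *v y))"
proof -
  define diff where "diff = (\<lambda>m t. if m = (0::nat) then f (t *\<^sub>R y) else
    if m = 1 then y \<bullet> gradient f (t *\<^sub>R y) else y \<bullet> (hessian f (t *\<^sub>R y) *v y))"
  have "\<exists>t. 0 < t \<and> t < 1 \<and>
      f (1 *\<^sub>R y) = (\<Sum>m<2. diff m 0 / fact m * 1 ^ m) + diff 2 t / fact 2 * 1 ^ 2"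
  proof (rule Maclaurin)
    show "diff 0 = (\<lambda>t. f (t *\<^sub>R y))" by (simp add: diff_def)
    show "\<forall>m t. m < 2 \<and> 0 \<le> t \<and> t \<le> 1 \<longrightarrow> DERIV (diff m) t :> diff (Suc m) t"
    proof (intro allI impI)
      fix m :: nat and t :: real assume "m < 2 \<and> 0 \<le> t \<and> t \<le> 1"
      then consider "m = 0" | "m = 1" by linarith
      then show "DERIV (diff m) t :> diff (Suc m) t"
      proof cases
        case 1
        then show ?thesis using line_derivative[OF Cc_differentiable[OF f], of y t] by (simp add: diff_def)
      next
        case 2
        have "((\<lambda>t. \<Sum>j\<in>UNIV. y $ j * partial_derivative j f (t *\<^sub>R y)) has_real_derivative
            (\<Sum>j\<in>UNIV. y $ j * (y \<bullet> gradient (partial_derivative j f) (t *\<^sub>R y)))) (at t)"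
          by (intro DERIV_sum DERIV_cmult line_derivative Cc_differentiable Cc_partial_derivative f)
        moreover have "(\<Sum>j\<in>UNIV. y $ j * (y \<bullet> gradient (partial_derivative j f) (t *\<^sub>R y))) =
            y \<bullet> (hessian f (t *\<^sub>R y) *v y)"
          by (subst hessian_form, subst sum.swap)
            (simp add: inner_vec_def gradient_def hessian_def sum_distrib_left mult_ac)
        ultimately show ?thesis using 2 by (simp add: diff_def inner_vec_def gradient_def)
      qed
    qed
  qed simp_all
  then obtain t where t: "0 < t" "t < 1"
    "f y = (\<Sum>m<2. diff m 0 / fact m) + diff 2 t / fact 2" by auto
  show ?thesis
    by (rule that[OF t(1,2)]) (use t(3) in \<open>simp add: diff_def numeral_2_eq_2\<close>)
qed

text \<open>The intermediate point t y is no farther from the origin than y, so by continuity the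
  Hessian there is close to the Hessian at 0; half the difference of the two quadratic forms is the
  whole remainder.\<close>

lemma taylor_remainder:
  assumes f: "f \<in> Cc_infinity" and e: "e > 0"
  obtains d where "d > 0" "\<And>y. norm y < d \<Longrightarrow>
    \<bar>f y - f 0 - y \<bullet> gradient f 0 - 1/2 * (y \<bullet> (hessian f 0 *v y))\<bar> \<le> e * (norm y)\<^sup>2"
proof -
  \<comment> \<open>The entrywise sum of deviations controls the quadratic form, since |y_i y_j|
    \<le> |y|^2.\<close>
  define H where "H x = (\<Sum>i\<in>UNIV. \<Sum>j\<in>UNIV. \<bar>hessian f x $ i $ j - hessian f 0 $ i $ j\<bar>)" for x
  have hc: "continuous_on UNIV (\<lambda>x. hessian f x $ i $ j)" for i j
    unfolding hessian_def by (simp add: Cc_continuous Cc_partial_derivative f)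
  have "continuous_on UNIV H" unfolding H_def
    by (intro continuous_on_sum continuous_on_rabs continuous_on_diff continuous_on_const hc)
  then have "continuous (at 0) H" by (simp add: continuous_on_eq_continuous_at)
  then have "(H \<longlongrightarrow> H 0) (at 0)" by (simp add: continuous_at)
  then have "eventually (\<lambda>x. dist (H x) (H 0) < e) (at 0)" using e by (rule tendstoD)
  then obtain d where d: "d > 0" "\<And>x. x \<noteq> 0 \<Longrightarrow> norm x < d \<Longrightarrow> dist (H x) (H 0) < e"
    unfolding eventually_at by (auto simp: dist_norm)
  have H0: "H 0 = 0" by (simp add: H_def)
  have Hd: "H x \<le> e" if "norm x < d" for x
    using d(2)[of x] that H0 e by (cases "x = 0") (auto simp: dist_real_def)
  show ?thesis
  proof (rule that[OF d(1)])
    fix y :: "real^'a" assume y: "norm y < d"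
    obtain t where t: "0 < t" "t < 1"
      "f y = f 0 + y \<bullet> gradient f 0 + 1/2 * (y \<bullet> (hessian f (t *\<^sub>R y) *v y))"
      using second_order_taylor[OF f, of y] by blast
    have "norm (t *\<^sub>R y) \<le> 1 * norm y" using t by (simp add: mult_left_le_one_le)
    then have ty: "norm (t *\<^sub>R y) < d" using y by simp
    have "\<bar>f y - f 0 - y \<bullet> gradient f 0 - 1/2 * (y \<bullet> (hessian f 0 *v y))\<bar> =
        1/2 * \<bar>y \<bullet> (hessian f (t *\<^sub>R y) *v y) - y \<bullet> (hessian f 0 *v y)\<bar>"
    proof -
      have "f y - f 0 - y \<bullet> gradient f 0 - 1/2 * (y \<bullet> (hessian f 0 *v y)) =
          1/2 * (y \<bullet> (hessian f (t *\<^sub>R y) *v y) - y \<bullet> (hessian f 0 *v y))"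
        using t(3) by (simp add: right_diff_distrib)
      then show ?thesis by (simp only: abs_mult)
    qed
    also have "y \<bullet> (hessian f (t *\<^sub>R y) *v y) - y \<bullet> (hessian f 0 *v y) =
        (\<Sum>i\<in>UNIV. \<Sum>j\<in>UNIV. y $ i * y $ j * (hessian f (t *\<^sub>R y) $ i $ j - hessian f 0 $ i $ j))"
      by (simp add: hessian_form sum_subtractf right_diff_distrib)
    also have "\<bar>\<dots>\<bar> \<le> (\<Sum>i\<in>UNIV. \<Sum>j\<in>UNIV. (norm y)\<^sup>2 * \<bar>hessian f (t *\<^sub>R y) $ i $ j - hessian f 0 $ i $ j\<bar>)"
    proof (intro order_trans[OF sum_abs] sum_mono)
      fix i j
      have "\<bar>y $ i\<bar> * \<bar>y $ j\<bar> \<le> norm y * norm y"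
        by (intro mult_mono component_le_norm_cart) auto
      then show "\<bar>y $ i * y $ j * (hessian f (t *\<^sub>R y) $ i $ j - hessian f 0 $ i $ j)\<bar>
          \<le> (norm y)\<^sup>2 * \<bar>hessian f (t *\<^sub>R y) $ i $ j - hessian f 0 $ i $ j\<bar>"
        by (simp add: abs_mult power2_eq_square mult_right_mono)
    qed
    also have "\<dots> = (norm y)\<^sup>2 * H (t *\<^sub>R y)" by (simp add: H_def sum_distrib_left)
    also have "\<dots> \<le> (norm y)\<^sup>2 * e" by (intro mult_left_mono Hd ty) simp
    finally have "\<bar>f y - f 0 - y \<bullet> gradient f 0 - 1/2 * (y \<bullet> (hessian f 0 *v y))\<bar> \<le> 1/2 * ((norm y)\<^sup>2 * e)"
      by simp
    also have "\<dots> \<le> e * (norm y)\<^sup>2" using e by simp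
    finally show "\<bar>f y - f 0 - y \<bullet> gradient f 0 - 1/2 * (y \<bullet> (hessian f 0 *v y))\<bar> \<le> e * (norm y)\<^sup>2" .
  qed
qed

section \<open>Extension of functionals with the positive maximum principle\<close>

text \<open>A sublinear functional with the positive maximum principle at the origin is extended from
  test functions to the functions touched at the origin from both sides by a test function plus a
  nonnegative constant; nonnegative constants are given no weight.\<close>

definition touching :: "(real^'n::finite \<Rightarrow> real) \<Rightarrow> (real^'n \<Rightarrow> real) set" where
  "touching g = {f \<in> Cc_infinity. \<exists>a\<ge>0. (\<forall>y. g y \<le> f y + a) \<and> g 0 = f 0 + a}"

definition touchable :: "(real^'n::finite \<Rightarrow> real) set" where
  "touchable = {g. touching g \<noteq> {} \<and> touching (\<lambda>y. - g y) \<noteq> {}}"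

lemma touchingI:
  "f \<in> Cc_infinity \<Longrightarrow> a \<ge> 0 \<Longrightarrow> (\<And>y. g y \<le> f y + a) \<Longrightarrow> g 0 = f 0 + a \<Longrightarrow> f \<in> touching g"
  unfolding touching_def by blast

lemma touchingE:
  assumes "f \<in> touching g"
  obtains a where "f \<in> Cc_infinity" "a \<ge> 0" "\<And>y. g y \<le> f y + a" "g 0 = f 0 + a"
  using assms unfolding touching_def by blast

lemma touching_add:
  assumes "f \<in> touching g" "f' \<in> touching g'"
  shows "(\<lambda>y. f y + f' y) \<in> touching (\<lambda>y. g y + g' y)"
proof -
  obtain a where a: "f \<in> Cc_infinity" "a \<ge> 0" "\<And>y. g y \<le> f y + a" "g 0 = f 0 + a"
    using touchingE[OF assms(1)] by metis
  obtain b where b: "f' \<in> Cc_infinity" "b \<ge> 0" "\<And>y. g' y \<le> f' y + b" "g' 0 = f' 0 + b"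
    using touchingE[OF assms(2)] by metis
  show ?thesis
  proof (rule touchingI[of _ "a + b"])
    show "(\<lambda>y. f y + f' y) \<in> Cc_infinity" by (rule Cc_add[OF a(1) b(1)])
    show "g y + g' y \<le> f y + f' y + (a + b)" for y using a(3)[of y] b(3)[of y] by simp
  qed (use a(2,4) b(2,4) in auto)
qed

lemma touching_scale:
  assumes "f \<in> touching g" "c \<ge> 0"
  shows "(\<lambda>y. c * f y) \<in> touching (\<lambda>y. c * g y)"
proof -
  obtain a where a: "f \<in> Cc_infinity" "a \<ge> 0" "\<And>y. g y \<le> f y + a" "g 0 = f 0 + a"
    using touchingE[OF assms(1)] by metis
  show ?thesis
  proof (rule touchingI[of _ "c * a"])
    show "(\<lambda>y. c * f y) \<in> Cc_infinity" by (rule Cc_cmult[OF a(1)])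
    show "c * g y \<le> c * f y + c * a" for y
      using mult_left_mono[OF a(3)[of y] assms(2)] by (simp add: distrib_left)
  qed (use a(2,4) assms(2) in \<open>auto simp: distrib_left\<close>)
qed

lemma touching_self: "f \<in> Cc_infinity \<Longrightarrow> f \<in> touching f"
  by (rule touchingI[of _ 0]) auto

lemma touching_zero: "a \<ge> 0 \<Longrightarrow> g 0 = a \<Longrightarrow> (\<And>y. g y \<le> a) \<Longrightarrow> (\<lambda>y. 0) \<in> touching g"
  by (rule touchingI[of _ a]) (auto intro: Cc_zero)

lemma touchableI: "f \<in> touching g \<Longrightarrow> f' \<in> touching (\<lambda>y. - g y) \<Longrightarrow> g \<in> touchable"
  unfolding touchable_def by blast

lemma touchable_Cc: "f \<in> Cc_infinity \<Longrightarrow> f \<in> touchable"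
  by (rule touchableI[OF touching_self touching_self[OF Cc_minus]])

text \<open>From above, 1 is the zero function plus the admissible constant 1. For -1 the constant
  has the wrong sign, but -1 \<le> -\<open>bump\<close> with equality at the origin.\<close>

lemma touchable_one: "(\<lambda>y. 1) \<in> touchable"
proof (rule touchableI)
  show "(\<lambda>y. 0) \<in> touching (\<lambda>y. 1)" by (rule touching_zero[of 1]) auto
  show "(\<lambda>y. - bump y) \<in> touching (\<lambda>y. - 1)"
  proof (rule touchingI[of _ 0])
    show "- 1 \<le> - bump y + 0" for y :: "real^'n" using bump_le[of y] by (smt (verit) zero_le_power2 min_def)
  qed (auto intro: Cc_minus bump_Cc)
qed

text \<open>For K \<ge> 0 the bound K (1 - \<open>bump\<close>) is an admissible constant plus the
  test function -K \<open>bump\<close>, and it vanishes at the origin. So one function touches both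
  g and -g.\<close>

lemma touchable_dominated:
  assumes "\<And>y. \<bar>g y\<bar> \<le> K * (1 - bump y)"
  shows "g \<in> touchable"
proof (rule touchableI)
  have g0: "g 0 = 0" using assms[of 0] by simp
  have w: "0 \<le> 1 - bump y" for y :: "real^'a" using bump_le[of y] by (smt (verit) zero_le_power2 min_def)
  define K' where "K' = max K 0"
  have K': "\<bar>g y\<bar> \<le> K' * (1 - bump y)" for y
    using assms[of y] mult_right_mono[OF _ w[of y], of K K'] by (auto simp: K'_def)
  have K1: "g y \<le> - K' * bump y + K'" for y
    using abs_le_D1[OF K'[of y]] by (simp add: algebra_simps)
  have K2: "- g y \<le> - K' * bump y + K'" for y
    using abs_le_D2[OF K'[of y]] by (simp add: algebra_simps)
  have C: "(\<lambda>y. - K' * bump y) \<in> Cc_infinity" by (rule Cc_cmult[OF bump_Cc])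
  show "(\<lambda>y. - K' * bump y) \<in> touching g"
    by (rule touchingI[OF C, of K']) (use K1 K2 g0 in \<open>auto simp: K'_def\<close>)
  show "(\<lambda>y. - K' * bump y) \<in> touching (\<lambda>y. - g y)"
    by (rule touchingI[OF C, of K']) (use K1 K2 g0 in \<open>auto simp: K'_def\<close>)
qed

lemma touchable_subspace: "fun_subspace touchable"
  unfolding fun_subspace_def
proof (intro conjI ballI allI)
  show "(\<lambda>x. 0) \<in> touchable" by (intro touchable_Cc Cc_zero)
next
  fix f g :: "real^'n \<Rightarrow> real" assume "f \<in> touchable" "g \<in> touchable"
  then obtain f1 f2 g1 g2 where *: "f1 \<in> touching f" "f2 \<in> touching (\<lambda>y. - f y)"
    "g1 \<in> touching g" "g2 \<in> touching (\<lambda>y. - g y)"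
    unfolding touchable_def by blast
  show "(\<lambda>x. f x + g x) \<in> touchable"
    by (rule touchableI[OF touching_add[OF *(1,3)]]) (use touching_add[OF *(2,4)] in simp)
next
  fix f :: "real^'n \<Rightarrow> real" and a :: real assume "f \<in> touchable"
  then obtain f1 f2 where *: "f1 \<in> touching f" "f2 \<in> touching (\<lambda>y. - f y)"
    unfolding touchable_def by blast
  show "(\<lambda>x. a * f x) \<in> touchable"
  proof (cases "a \<ge> 0")
    case True
    show ?thesis
      by (rule touchableI[OF touching_scale[OF *(1) True]]) (use touching_scale[OF *(2) True] in simp)
  next
    case False
    then have a: "- a \<ge> 0" by simp
    show ?thesis
      by (rule touchableI[of "\<lambda>y. - a * f2 y" _ "\<lambda>y. - a * f1 y"])
        (use touching_scale[OF *(2) a] touching_scale[OF *(1) a] in simp_all)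
  qed
qed

text \<open>Models the generator at one point x, moved to the origin: in the application p f is the
  generator of f(-x + .) evaluated at x.\<close>

locale maximum_principle =
  fixes p :: "(real^'n::finite \<Rightarrow> real) \<Rightarrow> real"
  assumes sublinear: "sublinear_on Cc_infinity p"
    and pmp: "f \<in> Cc_infinity \<Longrightarrow> (\<And>y. f y \<le> f 0) \<Longrightarrow> 0 \<le> f 0 \<Longrightarrow> p f \<le> 0"
begin

text \<open>Used on \<open>touchable\<close> only: there the infimum is over a nonempty set, and
  functions touching -g supply a lower bound.\<close>

definition ext :: "(real^'n \<Rightarrow> real) \<Rightarrow> real" where
  "ext g = Inf (p ` touching g)"

lemma p_zero: "p (\<lambda>y. 0) = 0"
  using sublinear_onD(2)[OF sublinear Cc_zero, of 0] by simp

text \<open>The sum h = f + f' touches 0 from above, so -h has its maximum a \<ge> 0 at the origin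
  and p(-h) \<le> 0. Then 0 = p(h - h) \<le> p(h) + p(-h) forces p(h) \<ge> 0. This is what keeps
  the extension finite.\<close>

lemma touching_sum_nonneg:
  assumes "f \<in> touching g" "f' \<in> touching (\<lambda>y. - g y)"
  shows "0 \<le> p f + p f'"
proof -
  define h where "h = (\<lambda>y. f y + f' y)"
  have "h \<in> touching (\<lambda>y. 0)" using touching_add[OF assms] by (simp add: h_def)
  then obtain a where a: "h \<in> Cc_infinity" "a \<ge> 0" "\<And>y. 0 \<le> h y + a" "0 = h 0 + a"
    using touchingE[of h "\<lambda>y. 0"] by metis
  have "- h y \<le> - h 0" for y using a(3)[of y] a(4) by simp
  then have "p (\<lambda>y. - h y) \<le> 0"
    using a(2,4) by (intro pmp Cc_minus a(1)) auto
  moreover have "p (\<lambda>y. h y + - h y) \<le> p h + p (\<lambda>y. - h y)"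
    by (intro sublinear_onD[OF sublinear] a(1) Cc_minus)
  moreover have "p h \<le> p f + p f'"
    unfolding h_def using assms by (intro sublinear_onD[OF sublinear]) (auto simp: touching_def)
  ultimately show ?thesis using p_zero by simp
qed

lemma ext_lower:
  assumes "g \<in> touchable" "f \<in> touching g" shows "ext g \<le> p f"
proof -
  obtain f' where f': "f' \<in> touching (\<lambda>y. - g y)" using assms(1) unfolding touchable_def by blast
  have "- p f' \<le> p h" if "h \<in> touching g" for h using touching_sum_nonneg[OF that f'] by simp
  then have "bdd_below (p ` touching g)" by (rule bdd_belowI2)
  then show ?thesis unfolding ext_def using assms(2) by (intro cInf_lower) auto
qed

lemma ext_near:
  assumes "g \<in> touchable" "e > 0"
  obtains f where "f \<in> touching g" "p f < ext g + e"
proof -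
  have "p ` touching g \<noteq> {}" using assms(1) unfolding touchable_def by blast
  then have "\<exists>x\<in>p ` touching g. x < ext g + e"
    using cInf_lessD[of "p ` touching g" "ext g + e"] assms(2) unfolding ext_def by auto
  then show ?thesis using that by blast
qed

lemma ext_greatest:
  assumes "g \<in> touchable" "\<And>f. f \<in> touching g \<Longrightarrow> m \<le> p f" shows "m \<le> ext g"
  unfolding ext_def using assms by (intro cInf_greatest) (auto simp: touchable_def)

lemma ext_sublinear: "sublinear_on touchable ext"
  unfolding sublinear_on_def
proof (intro conjI ballI allI impI)
  fix f g :: "real^'n \<Rightarrow> real" assume f: "f \<in> touchable" and g: "g \<in> touchable"
  have fg: "(\<lambda>x. f x + g x) \<in> touchable" by (rule fun_subspaceD(2)[OF touchable_subspace f g])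
  show "ext (\<lambda>x. f x + g x) \<le> ext f + ext g"
  proof (rule field_le_epsilon)
    fix e :: real assume e: "e > 0"
    obtain f' where f': "f' \<in> touching f" "p f' < ext f + e/2" using ext_near[OF f, of "e/2"] e by auto
    obtain g' where g': "g' \<in> touching g" "p g' < ext g + e/2" using ext_near[OF g, of "e/2"] e by auto
    have "ext (\<lambda>x. f x + g x) \<le> p (\<lambda>x. f' x + g' x)" by (rule ext_lower[OF fg touching_add[OF f'(1) g'(1)]])
    also have "\<dots> \<le> p f' + p g'"
      using f'(1) g'(1) by (intro sublinear_onD[OF sublinear]) (auto simp: touching_def)
    finally show "ext (\<lambda>x. f x + g x) \<le> ext f + ext g + e" using f' g' by simp
  qed
next
  fix f :: "real^'n \<Rightarrow> real" and a :: real assume f: "f \<in> touchable" and a: "a \<ge> 0"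
  have le: "ext (\<lambda>x. a * f x) \<le> a * ext f" if f: "f \<in> touchable" and a: "a > 0"
    for f :: "real^'n \<Rightarrow> real" and a :: real
  proof (rule field_le_epsilon)
    fix e :: real assume e: "e > 0"
    obtain f' where f': "f' \<in> touching f" "p f' < ext f + e/a" using ext_near[OF f, of "e/a"] e a by auto
    have "ext (\<lambda>x. a * f x) \<le> p (\<lambda>x. a * f' x)"
      using a by (intro ext_lower[OF fun_subspaceD(3)[OF touchable_subspace f] touching_scale[OF f'(1)]]) simp
    also have "\<dots> = a * p f'"
      using f'(1) a by (intro sublinear_onD[OF sublinear]) (auto simp: touching_def)
    also have "\<dots> \<le> a * (ext f + e/a)" using f' a by (intro mult_left_mono) auto
    finally show "ext (\<lambda>x. a * f x) \<le> a * ext f + e" using a by (simp add: distrib_left)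
  qed
  show "ext (\<lambda>x. a * f x) = a * ext f"
  proof (cases "a = 0")
    case True
    have z: "(\<lambda>y. 0) \<in> touchable" by (rule fun_subspaceD(1)[OF touchable_subspace])
    have "ext (\<lambda>y. 0) \<le> 0" using ext_lower[OF z touching_self[OF Cc_zero]] p_zero by simp
    moreover have "0 \<le> ext (\<lambda>y. 0)"
    proof (rule ext_greatest[OF z])
      fix h :: "real^'n \<Rightarrow> real" assume h: "h \<in> touching (\<lambda>y. 0)"
      have "(\<lambda>y. 0) \<in> touching (\<lambda>y::real^'n. - 0)" by (rule touching_zero[of 0]) auto
      then show "0 \<le> p h" using touching_sum_nonneg[OF h, of "\<lambda>y. 0"] p_zero by simp
    qed
    ultimately show ?thesis using True by simp
  next
    case False
    then have a: "a > 0" using a by simp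
    have "ext f = ext (\<lambda>x. (1/a) * (a * f x))" using a by simp
    also have "\<dots> \<le> (1/a) * ext (\<lambda>x. a * f x)"
      using a by (intro le fun_subspaceD(3)[OF touchable_subspace f]) auto
    finally have "a * ext f \<le> ext (\<lambda>x. a * f x)" using a by (simp add: field_simps)
    then show ?thesis using le[OF f a] by simp
  qed
qed

text \<open>If h touches f, then f - h attains a nonnegative maximum at the origin, so p(f - h)
  \<le> 0 and p(f) \<le> p(h): no touching function does better than f itself.\<close>

lemma ext_Cc: assumes f: "f \<in> Cc_infinity" shows "ext f = p f"
proof (rule antisym)
  show "ext f \<le> p f" by (rule ext_lower[OF touchable_Cc[OF f] touching_self[OF f]])
  show "p f \<le> ext f"
  proof (rule ext_greatest[OF touchable_Cc[OF f]])
    fix h assume "h \<in> touching f"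
    then obtain a where a: "h \<in> Cc_infinity" "a \<ge> 0" "\<And>y. f y \<le> h y + a" "f 0 = h 0 + a"
      using touchingE by metis
    have "f y - h y \<le> f 0 - h 0" for y using a(3)[of y] a(4) by simp
    then have "p (\<lambda>y. f y - h y) \<le> 0" using a by (intro pmp Cc_diff f) auto
    moreover have "p (\<lambda>y. (f y - h y) + h y) \<le> p (\<lambda>y. f y - h y) + p h"
      by (intro sublinear_onD[OF sublinear] a(1) Cc_diff f)
    ultimately show "p f \<le> p h" by simp
  qed
qed

text \<open>The zero function, raised by the constant a, touches g. Through this bound every linear
  functional below \<open>ext\<close> obeys the maximum principle on all touchable functions,
  constants included.\<close>

lemma ext_nonpos:
  assumes "g \<in> touchable" "g 0 = a" "a \<ge> 0" "\<And>y. g y \<le> a" shows "ext g \<le> 0"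
  using ext_lower[OF assms(1) touching_zero[of a g]] assms p_zero by simp

end

section \<open>The weight and the localized Taylor remainder\<close>

abbreviation bump_weight :: "real^'n::finite \<Rightarrow> real" where
  "bump_weight y \<equiv> 1 - bump y"

lemma bump_weight_ge: "min 1 ((norm y)\<^sup>2) \<le> bump_weight y"
  using bump_le[of y] by simp

lemma bump_weight_ge_square: "norm y \<le> 1 \<Longrightarrow> (norm y)\<^sup>2 \<le> bump_weight y"
  using bump_weight_ge[of y] power_le_one[of "norm y" 2] by simp

lemma bump_weight_nonneg: "0 \<le> bump_weight y"
  by (rule order_trans[OF _ bump_weight_ge]) simp

lemma bump_weight_pos: "y \<noteq> 0 \<Longrightarrow> 0 < bump_weight y"
  by (rule less_le_trans[OF _ bump_weight_ge]) simp

lemma continuous_on_bump [continuous_intros]: "continuous_on S bump"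
  by (rule Cc_continuous[OF bump_Cc])

lemma bump_measurable [measurable]: "bump \<in> borel_measurable borel"
  by (rule borel_measurable_continuous_onI[OF continuous_on_bump])

lemma continuous_on_punctured:
  fixes G :: "real^'n::finite \<Rightarrow> real"
  assumes "continuous_on (- {0}) G" "(G \<longlongrightarrow> G 0) (at 0)"
  shows "continuous_on UNIV G"
proof -
  have "isCont G y" for y
  proof (cases "y = 0")
    case True
    then show ?thesis using assms(2) by (simp add: isCont_def)
  next
    case False
    then show ?thesis using assms(1) by (subst (asm) continuous_on_eq_continuous_at) auto
  qed
  then show ?thesis by (simp add: continuous_at_imp_continuous_on)
qed

text \<open>The first and second order terms are localized by the bump, while the constant f(0) is
  not; the remainder therefore vanishes to second order at the origin and equals -f(0) far
  away.\<close>

definition levy_remainder :: "(real^'n::finite \<Rightarrow> real) \<Rightarrow> real^'n \<Rightarrow> real" where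
  "levy_remainder f y = f y - f 0 - (\<Sum>i\<in>UNIV. gradient f 0 $ i * (y $ i * bump y)) -
     1/2 * (\<Sum>i\<in>UNIV. \<Sum>j\<in>UNIV. hessian f 0 $ i $ j * (y $ i * y $ j * bump y))"

text \<open>Adding f(0) to this quotient gives a continuous function with compact support, the kind
  for which the representing measure is exact.\<close>

lemma levy_remainder_quotient:
  fixes f :: "real^'n::finite \<Rightarrow> real"
  assumes f: "f \<in> Cc_infinity"
  shows "continuous_on UNIV (\<lambda>y. levy_remainder f y / bump_weight y)"
    and "\<exists>r. \<forall>y. norm y \<ge> r \<longrightarrow> levy_remainder f y / bump_weight y = - f 0"
proof -
  define P where "P y = y \<bullet> gradient f 0 + 1/2 * (y \<bullet> (hessian f 0 *v y))" for y
  define R where "R y = f y - f 0 - y \<bullet> gradient f 0 - 1/2 * (y \<bullet> (hessian f 0 *v y))" for y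
  have S: "levy_remainder f y = f y - f 0 - P y * bump y" for y
  proof -
    have "(\<Sum>i\<in>UNIV. gradient f 0 $ i * (y $ i * bump y)) = (y \<bullet> gradient f 0) * bump y"
      by (simp add: inner_vec_def sum_distrib_left mult_ac)
    moreover have "(\<Sum>i\<in>UNIV. \<Sum>j\<in>UNIV. hessian f 0 $ i $ j * (y $ i * y $ j * bump y)) =
        (y \<bullet> (hessian f 0 *v y)) * bump y"
      by (simp add: hessian_form sum_distrib_left mult_ac)
    ultimately show ?thesis by (simp add: levy_remainder_def P_def distrib_right)
  qed
  have contP: "continuous_on UNIV P"
    unfolding P_def by (intro continuous_intros linear_continuous_on matrix_vector_mul_bounded_linear)
  \<comment> \<open>Writing P \<open>bump\<close> as P - P w isolates the true Taylor remainder R.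
    Both R / w and P tend to 0 at the origin, which agrees with the value 0 / 0 = 0 there.\<close>
  have quot: "R y / bump_weight y + P y = levy_remainder f y / bump_weight y" if "y \<noteq> 0" for y
    using bump_weight_pos[OF that] by (simp add: S R_def P_def field_simps)
  have "((\<lambda>y. R y / bump_weight y) \<longlongrightarrow> 0) (at 0)"
  proof (rule tendstoI)
    fix e :: real assume e: "e > 0"
    obtain d where d: "d > 0" "\<And>y. norm y < d \<Longrightarrow> \<bar>R y\<bar> \<le> (e/2) * (norm y)\<^sup>2"
      using taylor_remainder[OF f, of "e/2"] e unfolding R_def by auto
    have "dist (R y / bump_weight y) 0 < e" if y: "y \<noteq> 0" "norm y < min d 1" for y
    proof -
      have "(norm y)\<^sup>2 \<le> bump_weight y"
        using y by (intro bump_weight_ge_square) auto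
      then have "(e/2) * (norm y)\<^sup>2 \<le> (e/2) * bump_weight y" using e by (intro mult_left_mono) auto
      then have "\<bar>R y\<bar> \<le> (e/2) * bump_weight y" using d(2)[of y] y by simp
      also have "\<dots> < e * bump_weight y" using e bump_weight_pos[OF y(1)] by simp
      finally show ?thesis using bump_weight_pos[OF y(1)] by (simp add: dist_real_def field_simps)
    qed
    then show "eventually (\<lambda>y. dist (R y / bump_weight y) 0 < e) (at 0)"
      unfolding eventually_at using d(1) by (intro exI[of _ "min d 1"]) auto
  qed
  moreover have "(P \<longlongrightarrow> 0) (at 0)"
  proof -
    have "isCont P 0" using contP by (simp add: continuous_on_eq_continuous_at)
    moreover have "P 0 = 0" by (simp add: P_def)
    ultimately show ?thesis by (simp add: isCont_def)
  qed
  ultimately have "((\<lambda>y. R y / bump_weight y + P y) \<longlongrightarrow> 0 + 0) (at 0)" by (rule tendsto_add)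
  then have "((\<lambda>y. R y / bump_weight y + P y) \<longlongrightarrow> 0) (at 0)" by (simp only: add_0)
  moreover have "eventually (\<lambda>y. R y / bump_weight y + P y = levy_remainder f y / bump_weight y) (at 0)"
    unfolding eventually_at by (intro exI[of _ 1]) (auto simp: quot)
  ultimately have "((\<lambda>y. levy_remainder f y / bump_weight y) \<longlongrightarrow> 0) (at 0)"
    by (rule Lim_transform_eventually)
  moreover have "continuous_on (- {0}) (\<lambda>y. levy_remainder f y / bump_weight y)"
  proof -
    have "bump_weight y \<noteq> 0" if "y \<in> - {0}" for y :: "real^'n" using bump_weight_pos[of y] that by simp
    then show ?thesis unfolding S
      by (intro continuous_on_divide continuous_on_diff continuous_on_mult continuous_on_const
          continuous_on_bump Cc_continuous[OF f] continuous_on_subset[OF contP]) auto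
  qed
  ultimately show "continuous_on UNIV (\<lambda>y. levy_remainder f y / bump_weight y)"
    by (intro continuous_on_punctured) auto
  obtain r where r: "\<And>x. norm x \<ge> r \<Longrightarrow> f x = 0" using Cc_supportE[OF f] by blast
  have "levy_remainder f y / bump_weight y = - f 0" if "norm y \<ge> max r 1" for y
    using that r[of y] by (simp add: S bump_eq_0)
  then show "\<exists>r. \<forall>y. norm y \<ge> r \<longrightarrow> levy_remainder f y / bump_weight y = - f 0" by blast
qed

section \<open>Passage from the finite measure to the Levy measure\<close>

text \<open>The density at the origin is \<open>1 / 0 = 0\<close>, so integrals of \<open>h\<close> over \<open>y \<noteq> 0\<close> with respect to
  this measure are integrals of \<open>h / w\<close> over the whole space.\<close>

definition unweighted :: "(real^'n::finite) measure \<Rightarrow> (real^'n) measure" where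
  "unweighted \<mu> = density (restrict_space \<mu> (- {0})) (\<lambda>y. ennreal (1 / bump_weight y))"

lemma integral_unweighted:
  fixes h :: "real^'n::finite \<Rightarrow> real"
  assumes [measurable_cong]: "sets \<mu> = sets borel" and [measurable]: "h \<in> borel_measurable borel"
  shows "(\<integral>y. h y \<partial>unweighted \<mu>) = (\<integral>y. h y / bump_weight y \<partial>\<mu>)"
proof -
  have sp: "space \<mu> = UNIV" using sets_eq_imp_space_eq[OF assms(1)] by simp
  have "(\<integral>y. h y \<partial>unweighted \<mu>) = (\<integral>y. (1 / bump_weight y) *\<^sub>R h y \<partial>restrict_space \<mu> (- {0}))"
    unfolding unweighted_def using bump_weight_nonneg
    by (intro integral_density) (auto intro!: measurable_restrict_space1)
  also have "\<dots> = (\<integral>y. indicator (- {0}) y *\<^sub>R ((1 / bump_weight y) *\<^sub>R h y) \<partial>\<mu>)"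
    using assms(1) by (intro integral_restrict_space) (simp add: sp)
  also have "\<dots> = (\<integral>y. h y / bump_weight y \<partial>\<mu>)"
    by (intro Bochner_Integration.integral_cong refl) (auto simp: indicator_def)
  finally show ?thesis .
qed

text \<open>Since the weight dominates min(1, |y|^2), that function times the density is at most 1
  off the origin.\<close>

lemma unweighted_bound:
  assumes [measurable_cong]: "sets \<mu> = sets borel"
  shows "(\<integral>\<^sup>+ y. ennreal (min 1 ((norm y)\<^sup>2)) \<partial>unweighted \<mu>) \<le> emeasure \<mu> UNIV"
proof -
  have sp: "space \<mu> = UNIV" using sets_eq_imp_space_eq[OF assms(1)] by simp
  have "(\<integral>\<^sup>+ y. ennreal (min 1 ((norm y)\<^sup>2)) \<partial>unweighted \<mu>) =
      (\<integral>\<^sup>+ y. ennreal (1 / bump_weight y) * ennreal (min 1 ((norm y)\<^sup>2)) \<partial>restrict_space \<mu> (- {0}))"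
    unfolding unweighted_def by (rule nn_integral_density) (auto intro!: measurable_restrict_space1)
  also have "\<dots> \<le> (\<integral>\<^sup>+ y. 1 \<partial>restrict_space \<mu> (- {0}))"
  proof (intro nn_integral_mono)
    fix y assume "y \<in> space (restrict_space \<mu> (- {0}))"
    then have "y \<noteq> 0" by (simp add: space_restrict_space)
    then have "1 / bump_weight y * min 1 ((norm y)\<^sup>2) \<le> 1"
      using bump_weight_ge[of y] bump_weight_pos[of y] by (simp add: field_simps)
    then show "ennreal (1 / bump_weight y) * ennreal (min 1 ((norm y)\<^sup>2)) \<le> 1"
      by (simp add: ennreal_mult''[symmetric])
  qed
  also have "\<dots> = emeasure \<mu> (- {0})"
    using assms by (simp add: emeasure_restrict_space space_restrict_space sp)
  also have "\<dots> \<le> emeasure \<mu> UNIV" using assms by (intro emeasure_mono) auto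
  finally show ?thesis .
qed

lemma levy_measure_unweighted:
  assumes "sets \<mu> = sets borel" "finite_measure \<mu>"
  shows "levy_measure (unweighted \<mu>)"
proof -
  interpret finite_measure \<mu> by fact
  have "sets (unweighted \<mu>) = sets (restrict_space borel (- {0}))"
    unfolding unweighted_def sets_density by (rule sets_restrict_space_cong[OF assms(1)])
  moreover have "emeasure \<mu> UNIV < \<infinity>" by (simp add: less_top[symmetric])
  ultimately show ?thesis
    unfolding levy_measure_def using unweighted_bound[OF assms(1)] by (auto intro: le_less_trans)
qed

section \<open>Linear functionals with the positive maximum principle\<close>

text \<open>The values of l on localized coordinates and their products are first and second moments
  at the origin; drift and diffusion are these moments corrected for the jumps.\<close>

definition coord_test :: "'n::finite \<Rightarrow> real^'n \<Rightarrow> real" where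
  "coord_test i y = y $ i * bump y"

definition quad_test :: "'n::finite \<Rightarrow> 'n \<Rightarrow> real^'n \<Rightarrow> real" where
  "quad_test i j y = y $ i * y $ j * bump y"

lemma coord_test_Cc: "coord_test i \<in> Cc_infinity"
  unfolding coord_test_def by (intro Cc_mult_left C_k_nth bump_Cc)

lemma quad_test_Cc: "quad_test i j \<in> Cc_infinity"
  unfolding quad_test_def by (intro Cc_mult_left C_k_mult C_k_nth bump_Cc)

text \<open>Inside the unit ball |y_i y_j| \<le> |y|^2 \<le> w. So the localized product is w times
  a bounded function, within reach of the positivity of l even though that function is discontinuous
  at 0.\<close>

lemma quad_test_bound: "\<bar>quad_test i j y / bump_weight y\<bar> \<le> 1"
proof (cases "y = 0 \<or> norm y \<ge> 1")
  case True
  then show ?thesis by (auto simp: quad_test_def bump_eq_0)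
next
  case False
  have "\<bar>y $ i\<bar> * \<bar>y $ j\<bar> \<le> norm y * norm y" by (intro mult_mono component_le_norm_cart) auto
  also have "\<dots> \<le> bump_weight y"
    using bump_weight_ge_square[of y] False by (simp add: power2_eq_square)
  finally have "\<bar>y $ i\<bar> * \<bar>y $ j\<bar> \<le> bump_weight y" .
  moreover have "\<bar>quad_test i j y\<bar> \<le> \<bar>y $ i\<bar> * \<bar>y $ j\<bar>"
    using bump_nonneg[of y] bump_weight_nonneg[of y]
    by (auto simp: quad_test_def abs_mult intro!: mult_right_le_one_le)
  ultimately show ?thesis using bump_weight_pos[of y] False by (simp add: abs_divide)
qed

lemma fun_subspace_sum:
  assumes "fun_subspace V" "\<And>i. i \<in> S \<Longrightarrow> f i \<in> V"
  shows "(\<lambda>x. \<Sum>i\<in>S. f i x) \<in> V"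
  using assms(2)
proof (induction S rule: infinite_finite_induct)
  case (insert i S)
  then show ?case using fun_subspaceD(2)[OF assms(1), of "f i" "\<lambda>x. \<Sum>i\<in>S. f i x"] by simp
qed (use fun_subspaceD(1)[OF assms(1)] in auto)

locale touchable_functional =
  fixes l :: "(real^'n::finite \<Rightarrow> real) \<Rightarrow> real"
  assumes add: "f \<in> touchable \<Longrightarrow> g \<in> touchable \<Longrightarrow> l (\<lambda>x. f x + g x) = l f + l g"
    and scale: "f \<in> touchable \<Longrightarrow> l (\<lambda>x. a * f x) = a * l f"
    and nonpos: "g \<in> touchable \<Longrightarrow> g 0 \<ge> 0 \<Longrightarrow> (\<And>y. g y \<le> g 0) \<Longrightarrow> l g \<le> 0"
begin

lemma diff: "f \<in> touchable \<Longrightarrow> g \<in> touchable \<Longrightarrow> l (\<lambda>x. f x - g x) = l f - l g"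
  using add[of f "\<lambda>x. -1 * g x"] scale[of g "-1"] fun_subspaceD(3)[OF touchable_subspace, of g "-1"] by simp

lemma sum:
  assumes "\<And>i. i \<in> S \<Longrightarrow> f i \<in> touchable"
  shows "l (\<lambda>x. \<Sum>i\<in>S. f i x) = (\<Sum>i\<in>S. l (f i))"
proof -
  have z: "l (\<lambda>x. 0) = 0" using scale[OF fun_subspaceD(1)[OF touchable_subspace], of 0] by simp
  show ?thesis using assms
  proof (induction S rule: infinite_finite_induct)
    case (insert i S)
    then show ?case using add[of "f i" "\<lambda>x. \<Sum>i\<in>S. f i x"] fun_subspace_sum[OF touchable_subspace, of S f] by simp
  qed (auto simp: z)
qed

lemma touchable_weighted:
  assumes "bounded (range G)" shows "(\<lambda>y. G y * bump_weight y) \<in> touchable"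
proof -
  obtain K where K: "\<forall>y. \<bar>G y\<bar> \<le> K" using assms by (auto simp: bounded_iff)
  show ?thesis
  proof (rule touchable_dominated[of _ K])
    fix y
    have "\<bar>G y * bump_weight y\<bar> = \<bar>G y\<bar> * bump_weight y"
      using bump_weight_nonneg[of y] by (simp add: abs_mult)
    also have "\<dots> \<le> K * bump_weight y" using K bump_weight_nonneg[of y] by (intro mult_right_mono) auto
    finally show "\<bar>G y * bump_weight y\<bar> \<le> K * bump_weight y" .
  qed
qed

text \<open>The function -G w is nonpositive and vanishes at the origin, so it has its maximum 0
  there.\<close>

lemma nonneg_weighted:
  assumes "bounded (range G)" "\<And>y. 0 \<le> G y" shows "0 \<le> l (\<lambda>y. G y * bump_weight y)"
proof -
  have t: "(\<lambda>y. G y * bump_weight y) \<in> touchable" by (rule touchable_weighted[OF assms(1)])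
  have "l (\<lambda>y. -1 * (G y * bump_weight y)) \<le> 0"
  proof (rule nonpos[OF fun_subspaceD(3)[OF touchable_subspace t]])
    fix y
    have "0 \<le> G y * bump_weight y" by (rule mult_nonneg_nonneg[OF assms(2) bump_weight_nonneg])
    then show "-1 * (G y * bump_weight y) \<le> -1 * (G 0 * bump_weight 0)" by simp
  qed simp
  then show ?thesis unfolding scale[OF t] by simp
qed

lemma levy_measure_exists:
  obtains \<mu> where "sets \<mu> = sets borel" "finite_measure \<mu>" "measure \<mu> UNIV \<le> l bump_weight"
    "\<And>G r. continuous_on UNIV G \<Longrightarrow> (\<And>y. norm y \<ge> r \<Longrightarrow> G y = 0) \<Longrightarrow>
      (\<integral>y. G y \<partial>\<mu>) = l (\<lambda>y. G y * bump_weight y)"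
proof -
  define I where "I G = l (\<lambda>y. G y * bump_weight y)" for G
  have 1: "I (\<lambda>x. f x + g x) = I f + I g" if "bounded (range f)" "bounded (range g)" for f g
    using add[OF touchable_weighted[OF that(1)] touchable_weighted[OF that(2)]]
    by (simp add: I_def distrib_right)
  have 2: "I (\<lambda>x. a * f x) = a * I f" if "bounded (range f)" for f a
    using scale[OF touchable_weighted[OF that], of a] by (simp add: I_def mult.assoc)
  have 3: "0 \<le> I f" if "bounded (range f)" "\<And>x. 0 \<le> f x" for f
    unfolding I_def using that by (rule nonneg_weighted)
  obtain \<mu> where \<mu>: "sets \<mu> = sets borel" "finite_measure \<mu>" "measure \<mu> UNIV \<le> I (\<lambda>x. 1)"
    "\<And>G r. continuous_on UNIV G \<Longrightarrow> (\<And>y. norm y \<ge> r \<Longrightarrow> G y = 0) \<Longrightarrow> (\<integral>y. G y \<partial>\<mu>) = I G"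
    using bounded_functional_representation[of I, OF 1 2 3] by blast
  show ?thesis
  proof (rule that[OF \<mu>(1,2)])
    show "measure \<mu> UNIV \<le> l bump_weight" using \<mu>(3) by (simp add: I_def)
    show "(\<integral>y. G y \<partial>\<mu>) = l (\<lambda>y. G y * bump_weight y)"
      if "continuous_on UNIV G" "\<And>y. norm y \<ge> r \<Longrightarrow> G y = 0" for G r
      using \<mu>(4)[OF that] by (simp only: I_def)
  qed
qed

end

text \<open>The quotient F is bounded but may jump at the origin. Multiplied by a ramp it becomes
  continuous with support in the unit ball, so its integral is a value of l, and positivity lets l
  only grow when the ramp is dropped. The ramps increase to 1 off the origin, where F = 0 by
  division by zero, so an atom of the measure at 0 adds nothing to the integral. The defect becomes
  the quadratic form of Q.\<close>

lemma (in touchable_functional) quadratic_form_nonneg: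
  fixes \<xi> :: "real^'n"
  assumes \<mu>: "sets \<mu> = sets borel" "finite_measure \<mu>"
    "\<And>G r. continuous_on UNIV G \<Longrightarrow> (\<And>y. norm y \<ge> r \<Longrightarrow> G y = 0) \<Longrightarrow>
      (\<integral>y. G y \<partial>\<mu>) = l (\<lambda>y. G y * bump_weight y)"
  shows "(\<integral>y. (\<xi> \<bullet> y)\<^sup>2 * bump y / bump_weight y \<partial>\<mu>) \<le> l (\<lambda>y. (\<xi> \<bullet> y)\<^sup>2 * bump y)"
proof -
  interpret finite_measure \<mu> by fact
  note \<mu>(1)[measurable_cong]
  define F where "F y = (\<xi> \<bullet> y)\<^sup>2 * bump y / bump_weight y" for y
  \<comment> \<open>The ramp is 0 at the origin and 1 as soon as |y| \<ge> 1/n, for n > 0.\<close>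
  define \<theta> where "\<theta> n y = min 1 (real n * norm y)" for n and y :: "real^'n"
  have F_sum: "F y = (\<Sum>i\<in>UNIV. \<Sum>j\<in>UNIV. \<xi> $ i * \<xi> $ j * (quad_test i j y / bump_weight y))" for y
  proof -
    have "(\<xi> \<bullet> y)\<^sup>2 = (\<Sum>i\<in>UNIV. \<Sum>j\<in>UNIV. (\<xi> $ i * y $ i) * (\<xi> $ j * y $ j))"
      by (simp add: power2_eq_square inner_vec_def sum_product)
    then show ?thesis
      by (simp add: F_def quad_test_def sum_distrib_left sum_divide_distrib mult_ac)
  qed
  define B where "B = (\<Sum>i\<in>UNIV. \<Sum>j\<in>UNIV. \<bar>\<xi> $ i * \<xi> $ j\<bar>)"
  have F_le: "\<bar>F y\<bar> \<le> B" for y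
    unfolding F_sum B_def
  proof (intro order_trans[OF sum_abs] sum_mono)
    fix i j show "\<bar>\<xi> $ i * \<xi> $ j * (quad_test i j y / bump_weight y)\<bar> \<le> \<bar>\<xi> $ i * \<xi> $ j\<bar>"
      using mult_left_mono[OF quad_test_bound[of i j y], of "\<bar>\<xi> $ i * \<xi> $ j\<bar>"] by (simp add: abs_mult)
  qed
  have F0: "F y \<ge> 0" for y unfolding F_def using bump_nonneg[of y] bump_weight_nonneg[of y] by simp
  have \<theta>: "0 \<le> \<theta> n y" "\<theta> n y \<le> 1" for n y by (auto simp: \<theta>_def)
  have Fm [measurable]: "F \<in> borel_measurable borel" unfolding F_def by measurable
  have bdF: "bounded (range F)" using F_le by (auto simp: bounded_iff)
  have F\<theta>_le: "\<bar>F y * \<theta> n y\<bar> \<le> B" for n y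
    using F_le[of y] \<theta>[of n y] F0[of y] mult_left_le[of "\<theta> n y" "F y"] by (simp add: abs_mult)
  have cont: "continuous_on UNIV (\<lambda>y. F y * \<theta> n y)" for n
  proof (rule continuous_on_punctured)
    show "continuous_on (- {0}) (\<lambda>y. F y * \<theta> n y)"
    proof -
      have "bump_weight y \<noteq> 0" if "y \<in> - {0}" for y :: "real^'n" using bump_weight_pos[of y] that by simp
      then show ?thesis unfolding F_def \<theta>_def by (intro continuous_intros) auto
    qed
    have "((\<lambda>y. \<theta> n y * B) \<longlongrightarrow> \<theta> n 0 * B) (at 0)"
      unfolding \<theta>_def by (intro tendsto_intros)
    then have "((\<lambda>y. \<theta> n y * B) \<longlongrightarrow> 0) (at 0)" by (simp add: \<theta>_def)
    moreover have "eventually (\<lambda>y. norm (F y * \<theta> n y) \<le> \<theta> n y * B) (at 0)"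
    proof (rule always_eventually, rule allI)
      fix y show "norm (F y * \<theta> n y) \<le> \<theta> n y * B"
        using mult_right_mono[OF F_le[of y] \<theta>(1)[of n y]] \<theta>(1)[of n y] by (simp add: abs_mult mult.commute)
    qed
    ultimately have "((\<lambda>y. F y * \<theta> n y) \<longlongrightarrow> 0) (at 0)"
      by (rule Lim_null_comparison[rotated])
    then show "((\<lambda>y. F y * \<theta> n y) \<longlongrightarrow> F 0 * \<theta> n 0) (at 0)" by (simp add: F_def)
  qed
  have Fw: "F y * bump_weight y = (\<xi> \<bullet> y)\<^sup>2 * bump y" for y
    using bump_weight_pos[of y] by (cases "y = 0") (auto simp: F_def)
  have le: "(\<integral>y. F y * \<theta> n y \<partial>\<mu>) \<le> l (\<lambda>y. (\<xi> \<bullet> y)\<^sup>2 * bump y)" for n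
  proof -
    have 1: "(\<integral>y. F y * \<theta> n y \<partial>\<mu>) = l (\<lambda>y. F y * \<theta> n y * bump_weight y)"
      by (rule \<mu>(3)[OF cont, of 1]) (simp add: F_def bump_eq_0)
    have bd: "bounded (range (\<lambda>y. F y * \<theta> n y))" using F\<theta>_le[of _ n] by (auto simp: bounded_iff)
    have 2: "0 \<le> l (\<lambda>y. (F y - F y * \<theta> n y) * bump_weight y)"
    proof (rule nonneg_weighted)
      show nn: "0 \<le> F y - F y * \<theta> n y" for y using mult_left_le[OF \<theta>(2)[of n y] F0[of y]] by simp
      have "\<bar>F y - F y * \<theta> n y\<bar> \<le> B" for y
        using F_le[of y] nn[of y] mult_nonneg_nonneg[OF F0[of y] \<theta>(1)[of n y]] by linarith
      then show "bounded (range (\<lambda>y. F y - F y * \<theta> n y))" by (auto simp: bounded_iff)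
    qed
    have 3: "l (\<lambda>y. (F y - F y * \<theta> n y) * bump_weight y) = l (\<lambda>y. F y * bump_weight y) - l (\<lambda>y. F y * \<theta> n y * bump_weight y)"
      using diff[OF touchable_weighted[OF bdF] touchable_weighted[OF bd]] by (simp add: left_diff_distrib)
    show ?thesis using 1 2 unfolding 3 Fw by simp
  qed
  have "(\<lambda>n. \<integral>y. F y * \<theta> n y \<partial>\<mu>) \<longlonglongrightarrow> (\<integral>y. F y \<partial>\<mu>)"
  proof (rule integral_dominated_convergence[where w = "\<lambda>y. B"])
    show "(\<lambda>y. F y * \<theta> n y) \<in> borel_measurable \<mu>" for n unfolding \<theta>_def by measurable
    show "AE y in \<mu>. (\<lambda>n. F y * \<theta> n y) \<longlonglongrightarrow> F y"
    proof (intro AE_I2)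
      fix y :: "real^'n"
      show "(\<lambda>n. F y * \<theta> n y) \<longlonglongrightarrow> F y"
      proof (cases "y = 0")
        case True then show ?thesis by (simp add: F_def)
      next
        case False
        obtain N :: nat where N: "1 / norm y < real N" using reals_Archimedean2 by blast
        have "eventually (\<lambda>n. F y * \<theta> n y = F y) sequentially"
        proof (rule eventually_sequentiallyI[of N])
          fix n assume "N \<le> n"
          then have "1 / norm y \<le> real n" using N by linarith
          then have "1 \<le> real n * norm y" using False by (simp add: field_simps)
          then show "F y * \<theta> n y = F y" by (simp add: \<theta>_def)
        qed
        then show ?thesis by (rule tendsto_eventually)
      qed
    qed
    show "AE y in \<mu>. norm (F y * \<theta> n y) \<le> B" for n using F\<theta>_le by auto
  qed auto
  then have "(\<integral>y. F y \<partial>\<mu>) \<le> l (\<lambda>y. (\<xi> \<bullet> y)\<^sup>2 * bump y)"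
    by (rule LIMSEQ_le_const2) (use le in auto)
  then show ?thesis by (simp add: F_def)
qed

lemma trace_mult_symmetric:
  fixes Q A :: "real^'n::finite^'n"
  assumes "\<And>i j. Q $ i $ j = Q $ j $ i"
  shows "trace (Q ** A) = (\<Sum>i\<in>UNIV. \<Sum>j\<in>UNIV. A $ i $ j * Q $ i $ j)"
proof -
  have "trace (Q ** A) = (\<Sum>i\<in>UNIV. \<Sum>j\<in>UNIV. A $ j $ i * Q $ j $ i)"
    by (simp add: trace_def matrix_matrix_mult_def mult.commute assms[of i j for i j])
  also have "\<dots> = (\<Sum>i\<in>UNIV. \<Sum>j\<in>UNIV. A $ i $ j * Q $ i $ j)" by (rule sum.swap)
  finally show ?thesis .
qed

text \<open>A test function is split inside \<open>touchable\<close> into its remainder, a multiple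
  of 1, and localized first and second order terms. Only the remainder is evaluated through the
  measure; the other values of l enter the coefficients, corrected by what the compensated integral
  already contains.\<close>

lemma (in touchable_functional) levy_representation:
  obtains c b Q \<nu> where "0 \<le> c" "transpose Q = Q" "\<And>\<xi>. 0 \<le> \<xi> \<bullet> (Q *v \<xi>)" "levy_measure \<nu>"
    "(\<integral>\<^sup>+ y. ennreal (min 1 ((norm y)\<^sup>2)) \<partial>\<nu>) \<le> ennreal (l bump_weight)"
    "c \<le> l bump_weight - l (\<lambda>y. 1)"
    "\<And>i. \<bar>b $ i\<bar> \<le> \<bar>l (coord_test i)\<bar> + l bump_weight"
    "\<And>i j. \<bar>Q $ i $ j\<bar> \<le> \<bar>l (quad_test i j)\<bar> + l bump_weight"
    "\<And>f. f \<in> Cc_infinity \<Longrightarrow> levy_operator c b Q \<nu> f 0 = l f"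
proof -
  obtain \<mu> where \<mu>: "sets \<mu> = sets borel" "finite_measure \<mu>" "measure \<mu> UNIV \<le> l bump_weight"
    "\<And>G r. continuous_on UNIV G \<Longrightarrow> (\<And>y. norm y \<ge> r \<Longrightarrow> G y = 0) \<Longrightarrow>
      (\<integral>y. G y \<partial>\<mu>) = l (\<lambda>y. G y * bump_weight y)"
    using levy_measure_exists by blast
  interpret finite_measure \<mu> by fact
  note \<mu>(1)[measurable_cong]
  have sp: "space \<mu> = UNIV" using sets_eq_imp_space_eq[OF \<mu>(1)] by simp
  define m where "m = measure \<mu> UNIV"
  have int_bound: "integrable \<mu> h" if [measurable]: "h \<in> borel_measurable borel" and "\<And>y. \<bar>h y\<bar> \<le> K"
    for h :: "real^'n \<Rightarrow> real" and K
    by (rule integrable_const_bound[of _ K]) (use that in auto)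
  have abs_bound: "\<bar>\<integral>y. h y \<partial>\<mu>\<bar> \<le> m" if [measurable]: "h \<in> borel_measurable borel" and "\<And>y. \<bar>h y\<bar> \<le> 1"
    for h :: "real^'n \<Rightarrow> real"
  proof -
    have "\<bar>\<integral>y. h y \<partial>\<mu>\<bar> \<le> (\<integral>y. \<bar>h y\<bar> \<partial>\<mu>)" by (rule integral_abs_bound)
    also have "\<dots> \<le> (\<integral>y. 1 \<partial>\<mu>)"
      using int_bound[OF that] that by (intro integral_mono) auto
    finally show ?thesis by (simp add: m_def sp)
  qed
  define u where "u i y = y $ i * indicator {0<..<1} (norm y)" for i and y :: "real^'n"
  define q where "q i j y = quad_test i j y / bump_weight y" for i j and y :: "real^'n"
  have um [measurable]: "u i \<in> borel_measurable borel" for i unfolding u_def by measurable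
  have qm [measurable]: "q i j \<in> borel_measurable borel" for i j
    unfolding q_def quad_test_def by measurable
  have u1: "\<bar>u i y\<bar> \<le> 1" for i y
    using component_le_norm_cart[of y i] by (auto simp: u_def indicator_def)
  have q1: "\<bar>q i j y\<bar> \<le> 1" for i j y unfolding q_def by (rule quad_test_bound)
  \<comment> \<open>Killing has two sources: the mass l(w) - m lost at infinity and -l(1), both
    nonnegative. The integrals in b and Q convert the localization by the bump into the truncation
    at |y| < 1 and remove the second order part from the jumps.\<close>
  define c where "c = l bump_weight - m - l (\<lambda>y. 1)"
  define b where "b = (\<chi> i. l (coord_test i) + (\<integral>y. u i y \<partial>\<mu>))"
  define Q where "Q = (\<chi> i j. l (quad_test i j) - (\<integral>y. q i j y \<partial>\<mu>))"
  have Qsym: "Q $ i $ j = Q $ j $ i" for i j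
  proof -
    have "quad_test i j = quad_test j i" by (rule ext) (simp add: quad_test_def mult_ac)
    then show ?thesis by (simp add: Q_def q_def)
  qed
  show ?thesis
  proof (rule that[of c Q "unweighted \<mu>" b])
    have "l (\<lambda>y. 1) \<le> 0" by (rule nonpos[OF touchable_one]) auto
    then show "0 \<le> c" using \<mu>(3) by (simp add: c_def m_def)
    show "transpose Q = Q" by (simp add: transpose_def vec_eq_iff Qsym)
    show "levy_measure (unweighted \<mu>)" by (rule levy_measure_unweighted[OF \<mu>(1,2)])
    have "emeasure \<mu> UNIV = ennreal m" by (simp add: m_def emeasure_eq_measure)
    also have "\<dots> \<le> ennreal (l bump_weight)" using \<mu>(3) by (simp add: m_def ennreal_leI)
    finally show "(\<integral>\<^sup>+ y. ennreal (min 1 ((norm y)\<^sup>2)) \<partial>unweighted \<mu>) \<le> ennreal (l bump_weight)"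
      using unweighted_bound[OF \<mu>(1)] by (rule order_trans[rotated])
    show "c \<le> l bump_weight - l (\<lambda>y. 1)" by (simp add: c_def m_def)
    show "\<bar>b $ i\<bar> \<le> \<bar>l (coord_test i)\<bar> + l bump_weight" for i
      using abs_bound[OF um[of i] u1[of i]] \<mu>(3) by (simp add: b_def m_def)
    show "\<bar>Q $ i $ j\<bar> \<le> \<bar>l (quad_test i j)\<bar> + l bump_weight" for i j
      using abs_bound[OF qm[of i j] q1[of i j]] \<mu>(3) by (simp add: Q_def m_def)
    show "0 \<le> \<xi> \<bullet> (Q *v \<xi>)" for \<xi>
    proof -
      have sq: "(\<xi> \<bullet> y)\<^sup>2 * bump y = (\<Sum>i\<in>UNIV. \<Sum>j\<in>UNIV. (\<xi> $ i * \<xi> $ j) * quad_test i j y)" for y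
      proof -
        have "(\<xi> \<bullet> y)\<^sup>2 = (\<Sum>i\<in>UNIV. \<Sum>j\<in>UNIV. (\<xi> $ i * y $ i) * (\<xi> $ j * y $ j))"
          by (simp add: power2_eq_square inner_vec_def sum_product)
        then show ?thesis by (simp add: quad_test_def sum_distrib_left mult_ac)
      qed
      have t: "(\<lambda>y. (\<xi> $ i * \<xi> $ j) * quad_test i j y) \<in> touchable" for i j
        by (rule fun_subspaceD(3)[OF touchable_subspace touchable_Cc[OF quad_test_Cc]])
      have "l (\<lambda>y. (\<xi> \<bullet> y)\<^sup>2 * bump y) = (\<Sum>i\<in>UNIV. \<Sum>j\<in>UNIV. (\<xi> $ i * \<xi> $ j) * l (quad_test i j))"
        unfolding sq by (simp add: sum fun_subspace_sum[OF touchable_subspace] t scale touchable_Cc quad_test_Cc)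
      moreover have "(\<integral>y. (\<xi> \<bullet> y)\<^sup>2 * bump y / bump_weight y \<partial>\<mu>) =
          (\<Sum>i\<in>UNIV. \<Sum>j\<in>UNIV. (\<xi> $ i * \<xi> $ j) * (\<integral>y. q i j y \<partial>\<mu>))"
      proof -
        have "(\<xi> \<bullet> y)\<^sup>2 * bump y / bump_weight y = (\<Sum>i\<in>UNIV. \<Sum>j\<in>UNIV. (\<xi> $ i * \<xi> $ j) * q i j y)" for y
          unfolding sq q_def by (simp add: sum_divide_distrib)
        then show ?thesis using int_bound[OF qm q1] by (simp add: Bochner_Integration.integral_sum)
      qed
      moreover have "\<xi> \<bullet> (Q *v \<xi>) = (\<Sum>i\<in>UNIV. \<Sum>j\<in>UNIV. (\<xi> $ i * \<xi> $ j) * (l (quad_test i j) - (\<integral>y. q i j y \<partial>\<mu>)))"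
        by (simp add: inner_vec_def matrix_vector_mult_def Q_def sum_distrib_left mult_ac)
      moreover have "(\<integral>y. (\<xi> \<bullet> y)\<^sup>2 * bump y / bump_weight y \<partial>\<mu>) \<le> l (\<lambda>y. (\<xi> \<bullet> y)\<^sup>2 * bump y)"
        by (rule quadratic_form_nonneg[OF \<mu>(1,2)]) (rule \<mu>(4))
      ultimately show ?thesis by (simp add: right_diff_distrib sum_subtractf)
    qed
  next
    fix f :: "real^'n \<Rightarrow> real" assume f: "f \<in> Cc_infinity"
    define g where "g = gradient f 0"
    define H where "H = hessian f 0"
    define G where "G y = levy_remainder f y / bump_weight y" for y
    have Gcont: "continuous_on UNIV G" unfolding G_def by (rule levy_remainder_quotient(1)[OF f])
    have Gm [measurable]: "G \<in> borel_measurable borel" by (rule borel_measurable_continuous_onI[OF Gcont])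
    obtain r where r': "\<forall>y. norm y \<ge> r \<longrightarrow> G y = - f 0"
      using levy_remainder_quotient(2)[OF f] unfolding G_def by blast
    have r: "G y + f 0 = 0" if "norm y \<ge> r" for y using r' that by simp
    have Gc: "continuous_on UNIV (\<lambda>y. G y + f 0)" by (intro continuous_intros Gcont)
    have Gbd: "\<exists>K. \<forall>y. \<bar>G y\<bar> \<le> K"
    proof -
      have "compact (G ` cball 0 r)"
        by (intro compact_continuous_image continuous_on_subset[OF Gcont]) auto
      then have "bounded (G ` cball 0 r)" by (rule compact_imp_bounded)
      then obtain K where K: "\<forall>x\<in>G ` cball 0 r. norm x \<le> K" unfolding bounded_iff by blast
      have "\<bar>G y\<bar> \<le> max K \<bar>f 0\<bar>" for y
      proof (cases "norm y \<le> r")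
        case True then show ?thesis using K by (simp add: le_max_iff_disj)
      next
        case False
        then have "G y = - f 0" using r[of y] by simp
        then show ?thesis by simp
      qed
      then show ?thesis by blast
    qed
    then obtain K where K: "\<And>y. \<bar>G y\<bar> \<le> K" by blast
    have Gint: "integrable \<mu> G" by (rule int_bound[OF Gm K])
    have Gw: "G y * bump_weight y = levy_remainder f y" for y
      using bump_weight_pos[of y] by (cases "y = 0") (auto simp: G_def levy_remainder_def)
    have Gt: "levy_remainder f \<in> touchable"
      using touchable_weighted[of G] K unfolding Gw by (auto simp: bounded_iff)
    have wt: "bump_weight \<in> touchable"
      using touchable_weighted[of "\<lambda>y. 1"] by simp
    have cwt: "(\<lambda>y. f 0 * bump_weight y) \<in> touchable"
      by (rule fun_subspaceD(3)[OF touchable_subspace wt])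
    \<comment> \<open>Only G + f(0) has compact support. Returning to G leaves the defect f(0) (l(w)
      - m), which reappears in c.\<close>
    have "(\<integral>y. G y + f 0 \<partial>\<mu>) = l (\<lambda>y. (G y + f 0) * bump_weight y)"
      by (rule \<mu>(4)[OF Gc r])
    also have "(\<lambda>y. (G y + f 0) * bump_weight y) = (\<lambda>y. levy_remainder f y + f 0 * bump_weight y)"
      by (rule ext) (simp only: distrib_right Gw)
    also have "l \<dots> = l (levy_remainder f) + f 0 * l bump_weight"
      by (simp only: add[OF Gt cwt] scale[OF wt])
    finally have intG: "(\<integral>y. G y \<partial>\<mu>) = l (levy_remainder f) + f 0 * l bump_weight - f 0 * m"
      using Gint by (simp add: m_def sp mult.commute)

    have t1: "(\<lambda>y. g $ i * coord_test i y) \<in> touchable" for i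
      by (rule fun_subspaceD(3)[OF touchable_subspace touchable_Cc[OF coord_test_Cc]])
    have t2: "(\<lambda>y. H $ i $ j * quad_test i j y) \<in> touchable" for i j
      by (rule fun_subspaceD(3)[OF touchable_subspace touchable_Cc[OF quad_test_Cc]])
    define A where "A y = (\<Sum>i\<in>UNIV. g $ i * coord_test i y)" for y
    define B where "B y = (\<Sum>i\<in>UNIV. \<Sum>j\<in>UNIV. H $ i $ j * quad_test i j y)" for y
    have At: "A \<in> touchable" unfolding A_def by (rule fun_subspace_sum[OF touchable_subspace t1])
    have Bt: "B \<in> touchable" unfolding B_def
      by (intro fun_subspace_sum[OF touchable_subspace] t2)
    have lA: "l A = (\<Sum>i\<in>UNIV. g $ i * l (coord_test i))"
      unfolding A_def by (simp add: sum t1 scale touchable_Cc coord_test_Cc)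
    have lB: "l B = (\<Sum>i\<in>UNIV. \<Sum>j\<in>UNIV. H $ i $ j * l (quad_test i j))"
      unfolding B_def by (simp add: sum fun_subspace_sum[OF touchable_subspace] t2 scale touchable_Cc quad_test_Cc)
    have rem: "levy_remainder f y = f y - f 0 - A y - 1/2 * B y" for y
      by (simp add: levy_remainder_def A_def B_def coord_test_def quad_test_def g_def H_def)
    have lf: "l f = l (levy_remainder f) + f 0 * l (\<lambda>y. 1) + l A + 1/2 * l B"
    proof -
      note tt = fun_subspaceD(2)[OF touchable_subspace] fun_subspaceD(3)[OF touchable_subspace]
        Gt At Bt touchable_one
      have "f = (\<lambda>y. levy_remainder f y + f 0 * 1 + A y + 1/2 * B y)" by (rule ext) (simp add: rem)
      then have "l f = l (\<lambda>y. levy_remainder f y + f 0 * 1 + A y + 1/2 * B y)" by (rule arg_cong)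
      also have "\<dots> = l (\<lambda>y. levy_remainder f y + f 0 * 1 + A y) + l (\<lambda>y. 1/2 * B y)"
        by (rule add) (intro tt)+
      also have "l (\<lambda>y. levy_remainder f y + f 0 * 1 + A y) = l (\<lambda>y. levy_remainder f y + f 0 * 1) + l A"
        by (rule add) (intro tt)+
      also have "l (\<lambda>y. levy_remainder f y + f 0 * 1) = l (levy_remainder f) + l (\<lambda>y. f 0 * 1)"
        by (rule add) (intro tt)+
      finally show ?thesis by (simp only: scale[OF Bt] scale[OF touchable_one])
    qed

    define L where "L y = f (0 + y) - f 0 - (y \<bullet> gradient f 0) * indicator {0<..<1} (norm y)" for y
    have fm [measurable]: "f \<in> borel_measurable borel"
      by (rule borel_measurable_continuous_onI[OF Cc_continuous[OF f]])
    have Lm [measurable]: "L \<in> borel_measurable borel" unfolding L_def by measurable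
    have Lw: "L y / bump_weight y = G y - (\<Sum>i\<in>UNIV. g $ i * u i y) + 1/2 * (\<Sum>i\<in>UNIV. \<Sum>j\<in>UNIV. H $ i $ j * q i j y)" for y
    proof -
      have Bq: "B y / bump_weight y = (\<Sum>i\<in>UNIV. \<Sum>j\<in>UNIV. H $ i $ j * q i j y)"
        by (simp add: B_def q_def sum_divide_distrib)
      have gi: "(y \<bullet> gradient f 0) * indicator {0<..<1} (norm y) = (\<Sum>i\<in>UNIV. g $ i * u i y)"
        by (simp add: u_def g_def inner_vec_def sum_distrib_left mult_ac)
      have Au: "(A y - (\<Sum>i\<in>UNIV. g $ i * u i y)) / bump_weight y = - (\<Sum>i\<in>UNIV. g $ i * u i y)"
      proof -
        \<comment> \<open>For 0 < |y| < 1 the difference is y_i (\<open>bump\<close> - 1) = -y_i w,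
          so the weight cancels; elsewhere both terms vanish.\<close>
        have "(coord_test i y - u i y) / bump_weight y = - u i y" for i
        proof -
          consider "y = 0" | "norm y \<ge> 1" | "y \<noteq> 0" "norm y < 1" by linarith
          then show ?thesis
          proof cases
            case 3
            then show ?thesis using bump_weight_pos[OF 3(1)]
              by (simp add: coord_test_def u_def field_simps)
          qed (auto simp: coord_test_def u_def bump_eq_0)
        qed
        then have "g $ i * ((coord_test i y - u i y) / bump_weight y) = - (g $ i * u i y)" for i by simp
        then have "(\<Sum>i\<in>UNIV. g $ i * ((coord_test i y - u i y) / bump_weight y)) = - (\<Sum>i\<in>UNIV. g $ i * u i y)"
          by (simp only: sum_negf)
        then show ?thesis
          by (simp add: A_def sum_divide_distrib sum_subtractf right_diff_distrib diff_divide_distrib)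
      qed
      have "L y = levy_remainder f y + (A y - (\<Sum>i\<in>UNIV. g $ i * u i y)) + 1/2 * B y"
        by (simp add: L_def gi rem)
      then have "L y / bump_weight y = levy_remainder f y / bump_weight y
          + (A y - (\<Sum>i\<in>UNIV. g $ i * u i y)) / bump_weight y + 1/2 * (B y / bump_weight y)"
        by (simp only: add_divide_distrib times_divide_eq_right)
      then show ?thesis unfolding Au Bq G_def by simp
    qed
    have intu: "integrable \<mu> (u i)" for i by (rule int_bound[OF um u1])
    have intq: "integrable \<mu> (q i j)" for i j by (rule int_bound[OF qm q1])
    have "(\<integral>y. L y \<partial>unweighted \<mu>) = (\<integral>y. L y / bump_weight y \<partial>\<mu>)"
      by (rule integral_unweighted[OF \<mu>(1) Lm])
    also have "\<dots> = (\<integral>y. G y \<partial>\<mu>) - (\<Sum>i\<in>UNIV. g $ i * (\<integral>y. u i y \<partial>\<mu>)) +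
        1/2 * (\<Sum>i\<in>UNIV. \<Sum>j\<in>UNIV. H $ i $ j * (\<integral>y. q i j y \<partial>\<mu>))"
      unfolding Lw using Gint intu intq
      by (simp add: Bochner_Integration.integral_sum Bochner_Integration.integral_add Bochner_Integration.integral_diff)
    finally have intL: "(\<integral>y. L y \<partial>unweighted \<mu>) = \<dots>" .
    have "levy_operator c b Q (unweighted \<mu>) f 0 =
        - c * f 0 + b \<bullet> g + 1/2 * (\<Sum>i\<in>UNIV. \<Sum>j\<in>UNIV. H $ i $ j * Q $ i $ j) + (\<integral>y. L y \<partial>unweighted \<mu>)"
      by (simp add: levy_operator_def trace_mult_symmetric[OF Qsym] L_def g_def H_def)
    also have "b \<bullet> g = (\<Sum>i\<in>UNIV. g $ i * l (coord_test i)) + (\<Sum>i\<in>UNIV. g $ i * (\<integral>y. u i y \<partial>\<mu>))"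
      by (simp add: inner_vec_def b_def sum.distrib distrib_left distrib_right mult_ac)
    also have "(\<Sum>i\<in>UNIV. \<Sum>j\<in>UNIV. H $ i $ j * Q $ i $ j) =
        l B - (\<Sum>i\<in>UNIV. \<Sum>j\<in>UNIV. H $ i $ j * (\<integral>y. q i j y \<partial>\<mu>))"
      by (simp add: lB Q_def right_diff_distrib sum_subtractf)
    finally show "levy_operator c b Q (unweighted \<mu>) f 0 = l f"
      unfolding intL intG lf lA by (simp add: c_def algebra_simps)
  qed
qed

section \<open>Bounds that do not depend on the linear functional\<close>

lemma norm_matrix_le_sum: "norm (Q :: real^'n::finite^'m::finite) \<le> (\<Sum>i\<in>UNIV. \<Sum>j\<in>UNIV. \<bar>Q $ i $ j\<bar>)"
proof -
  have "norm Q \<le> (\<Sum>i\<in>UNIV. norm (Q $ i))" unfolding norm_vec_def[of Q] by (rule L2_set_le_sum) auto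
  also have "\<dots> \<le> (\<Sum>i\<in>UNIV. \<Sum>j\<in>UNIV. \<bar>Q $ i $ j\<bar>)" by (intro sum_mono norm_le_l1_cart)
  finally show ?thesis .
qed

definition levy_triplet_bound ::
    "real \<Rightarrow> real \<Rightarrow> real^'n::finite \<Rightarrow> real^'n^'n \<Rightarrow> (real^'n) measure \<Rightarrow> bool" where
  "levy_triplet_bound K c b Q \<nu> \<longleftrightarrow>
     0 \<le> c \<and> transpose Q = Q \<and> (\<forall>\<xi>. 0 \<le> \<xi> \<bullet> (Q *v \<xi>)) \<and> levy_measure \<nu> \<and>
     ennreal (c + norm b + norm Q) + (\<integral>\<^sup>+ y. ennreal (min 1 ((norm y)\<^sup>2)) \<partial>\<nu>) \<le> ennreal K"

text \<open>The number K precedes the choice of f: it is made from finitely many values of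
  \<open>ext\<close>, which control every linear functional below it.\<close>

theorem (in maximum_principle) levy_family:
  obtains K where "\<And>f. f \<in> Cc_infinity \<Longrightarrow> \<exists>c b Q \<nu>. levy_triplet_bound K c b Q \<nu> \<and>
    (\<forall>g\<in>Cc_infinity. levy_operator c b Q \<nu> g 0 \<le> p g) \<and> levy_operator c b Q \<nu> f 0 = p f"
proof -
  \<comment> \<open>Linearity gives -ext(-g) \<le> l(g) \<le> ext(g), hence |l(g)| \<le> e(g) for
    every l below \<open>ext\<close>.\<close>
  define e where "e g = \<bar>ext g\<bar> + \<bar>ext (\<lambda>y. - g y)\<bar>" for g
  define W where "W = e bump_weight"
  \<comment> \<open>The summands bound c, |b|, |Q| and the jump integral, in this order.\<close>
  define K where "K = (W + e (\<lambda>y. 1)) + (\<Sum>i\<in>UNIV. e (coord_test i) + W) +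
    (\<Sum>i\<in>UNIV. \<Sum>j\<in>UNIV. e (quad_test i j) + W) + W"
  show ?thesis
  proof (rule that[of K])
    fix f :: "real^'n \<Rightarrow> real" assume f: "f \<in> Cc_infinity"
    \<comment> \<open>The supporting functional at f is taken on \<open>touchable\<close>. Since
      \<open>ext\<close> agrees with p on test functions, domination and contact at f hold for p as
      well.\<close>
    obtain l where l: "\<And>f g. f \<in> touchable \<Longrightarrow> g \<in> touchable \<Longrightarrow> l (\<lambda>x. f x + g x) = l f + l g"
      "\<And>f a. f \<in> touchable \<Longrightarrow> l (\<lambda>x. a * f x) = a * l f"
      "\<And>f. f \<in> touchable \<Longrightarrow> l f \<le> ext f" "l f = ext f"
      by (rule hahn_banach[OF ext_sublinear touchable_subspace touchable_Cc[OF f]]) (rule that)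
    interpret touchable_functional l
    proof
      show "l g \<le> 0" if "g \<in> touchable" "0 \<le> g 0" "\<And>y. g y \<le> g 0" for g
        using l(3)[OF that(1)] ext_nonpos[OF that(1) refl that(2,3)] by (rule order_trans)
    qed (use l(1,2) in auto)
    have le: "\<bar>l g\<bar> \<le> e g" if g: "g \<in> touchable" for g
    proof -
      have "l (\<lambda>y. - g y) = - l g" using l(2)[OF g, of "-1"] by simp
      then show ?thesis
        using l(3)[OF g] l(3)[OF fun_subspaceD(4)[OF touchable_subspace g]] by (simp add: e_def)
    qed
    have lw: "\<bar>l bump_weight\<bar> \<le> W"
      unfolding W_def using touchable_weighted[of "\<lambda>y. 1"] by (intro le) simp
    obtain c b Q \<nu> where r: "0 \<le> c" "transpose Q = Q" "\<And>\<xi>. 0 \<le> \<xi> \<bullet> (Q *v \<xi>)" "levy_measure \<nu>"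
      "(\<integral>\<^sup>+ y. ennreal (min 1 ((norm y)\<^sup>2)) \<partial>\<nu>) \<le> ennreal (l bump_weight)"
      "c \<le> l bump_weight - l (\<lambda>y. 1)"
      "\<And>i. \<bar>b $ i\<bar> \<le> \<bar>l (coord_test i)\<bar> + l bump_weight"
      "\<And>i j. \<bar>Q $ i $ j\<bar> \<le> \<bar>l (quad_test i j)\<bar> + l bump_weight"
      "\<And>f. f \<in> Cc_infinity \<Longrightarrow> levy_operator c b Q \<nu> f 0 = l f"
      by (rule levy_representation) (rule that)
    have "c \<le> W + e (\<lambda>y. 1)" using r(6) lw le[OF touchable_one] by linarith
    moreover have "norm b \<le> (\<Sum>i\<in>UNIV. e (coord_test i) + W)"
    proof (rule order_trans[OF norm_le_l1_cart sum_mono])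
      fix i show "\<bar>b $ i\<bar> \<le> e (coord_test i) + W"
        using r(7)[of i] lw le[OF touchable_Cc[OF coord_test_Cc], of i] by linarith
    qed
    moreover have "norm Q \<le> (\<Sum>i\<in>UNIV. \<Sum>j\<in>UNIV. e (quad_test i j) + W)"
    proof (rule order_trans[OF norm_matrix_le_sum], intro sum_mono)
      fix i j show "\<bar>Q $ i $ j\<bar> \<le> e (quad_test i j) + W"
        using r(8)[of i j] lw le[OF touchable_Cc[OF quad_test_Cc], of i j] by linarith
    qed
    ultimately have "c + norm b + norm Q \<le> K - W" by (simp add: K_def)
    moreover have "0 \<le> W" by (simp add: W_def e_def)
    moreover have "0 \<le> c + norm b + norm Q" using r(1) by simp
    moreover have "(\<integral>\<^sup>+ y. ennreal (min 1 ((norm y)\<^sup>2)) \<partial>\<nu>) \<le> ennreal W"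
      using r(5) lw by (meson abs_le_D1 ennreal_leI order_trans)
    ultimately have "ennreal (c + norm b + norm Q) + (\<integral>\<^sup>+ y. ennreal (min 1 ((norm y)\<^sup>2)) \<partial>\<nu>)
        \<le> ennreal (K - W) + ennreal W"
      by (intro add_mono ennreal_leI)
    also have "\<dots> = ennreal K"
      using \<open>0 \<le> W\<close> \<open>c + norm b + norm Q \<le> K - W\<close> \<open>0 \<le> c + norm b + norm Q\<close>
      by (subst ennreal_plus[symmetric]) auto
    finally have "levy_triplet_bound K c b Q \<nu>" using r(1-4) by (simp add: levy_triplet_bound_def)
    moreover have "levy_operator c b Q \<nu> g 0 \<le> p g" if "g \<in> Cc_infinity" for g
      using r(9)[OF that] l(3)[OF touchable_Cc[OF that]] ext_Cc[OF that] by simp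
    moreover have "levy_operator c b Q \<nu> f 0 = p f" using r(9)[OF f] l(4) ext_Cc[OF f] by simp
    ultimately show "\<exists>c b Q \<nu>. levy_triplet_bound K c b Q \<nu> \<and>
        (\<forall>g\<in>Cc_infinity. levy_operator c b Q \<nu> g 0 \<le> p g) \<and> levy_operator c b Q \<nu> f 0 = p f"
      by blast
  qed
qed

section \<open>The Fourier transform of test functions\<close>

lemma integral_lborel_affine:
  fixes h :: "'a::euclidean_space \<Rightarrow> 'b::{banach, second_countable_topology}"
  assumes [measurable]: "h \<in> borel_measurable borel" and c: "c \<noteq> 0"
  shows "(\<integral>x. h x \<partial>lborel) = (\<integral>x. \<bar>c\<bar> ^ DIM('a) *\<^sub>R h (t + c *\<^sub>R x) \<partial>lborel)"
proof -
  have "(\<integral>x. h x \<partial>lborel) = (\<integral>x. h x \<partial>density (distr lborel borel (\<lambda>x. t + c *\<^sub>R x)) (\<lambda>_. ennreal (\<bar>c\<bar> ^ DIM('a))))"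
    using lborel_affine[OF c, of t] by (simp add: ennreal_power)
  also have "\<dots> = (\<integral>x. \<bar>c\<bar> ^ DIM('a) *\<^sub>R h x \<partial>distr lborel borel (\<lambda>x. t + c *\<^sub>R x))"
    by (rule integral_density) auto
  also have "\<dots> = (\<integral>x. \<bar>c\<bar> ^ DIM('a) *\<^sub>R h (t + c *\<^sub>R x) \<partial>lborel)"
    by (rule integral_distr) auto
  finally show ?thesis .
qed

lemma integral_lborel_translate:
  fixes h :: "'a::euclidean_space \<Rightarrow> 'b::{banach, second_countable_topology}"
  assumes "h \<in> borel_measurable borel"
  shows "(\<integral>x. h (t + x) \<partial>lborel) = (\<integral>x. h x \<partial>lborel)"
  using integral_lborel_affine[OF assms, of 1 t] by simp

section \<open>Product integrals and Gaussians\<close>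

context
  fixes \<phi> :: "'a::euclidean_space \<Rightarrow> real \<Rightarrow> 'b::{real_normed_field, banach, second_countable_topology}"
  assumes \<phi>: "\<And>b. b \<in> Basis \<Longrightarrow> integrable lborel (\<phi> b)"
begin

interpretation product_sigma_finite "\<lambda>b::'a. lborel :: real measure"
  by (rule product_sigma_finite.intro) (rule sigma_finite_lborel)

lemma coordinate_sum_measurable [measurable]:
  "(\<lambda>f. \<Sum>b\<in>Basis. f b *\<^sub>R b) \<in> measurable (\<Pi>\<^sub>M b\<in>(Basis::'a set). lborel) (borel :: 'a measure)"
  by measurable

lemma coordinate_prod_measurable: "(\<lambda>x. \<Prod>b\<in>Basis. \<phi> b (x \<bullet> b)) \<in> borel_measurable (borel :: 'a measure)"
proof (intro borel_measurable_prod)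
  fix b :: 'a assume "b \<in> Basis"
  then have [measurable]: "\<phi> b \<in> borel_measurable borel" using \<phi> by auto
  show "(\<lambda>x. \<phi> b (x \<bullet> b)) \<in> borel_measurable borel" by measurable
qed

lemma integrable_coordinate_prod: "integrable lborel (\<lambda>x::'a. \<Prod>b\<in>Basis. \<phi> b (x \<bullet> b))"
proof -
  have "integrable (\<Pi>\<^sub>M b\<in>(Basis::'a set). lborel) (\<lambda>f. \<Prod>b\<in>Basis. \<phi> b (f b))"
    by (rule product_integrable_prod) (auto intro: \<phi>)
  then have "integrable (\<Pi>\<^sub>M b\<in>(Basis::'a set). lborel) (\<lambda>f. \<Prod>b\<in>Basis. \<phi> b ((\<Sum>c\<in>Basis. f c *\<^sub>R c) \<bullet> b))"
    by (simp add: inner_sum_left_Basis)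
  then show ?thesis
    by (subst lborel_eq, subst integrable_distr_eq) (auto intro: coordinate_prod_measurable coordinate_sum_measurable)
qed

lemma integral_coordinate_prod:
  "(\<integral>x. (\<Prod>b\<in>Basis. \<phi> b (x \<bullet> b)) \<partial>lborel) = (\<Prod>b\<in>Basis. (\<integral>t. \<phi> b t \<partial>lborel))"
proof -
  have "(\<integral>x. (\<Prod>b\<in>Basis. \<phi> b (x \<bullet> b)) \<partial>lborel) =
      (\<integral>f. (\<Prod>b\<in>Basis. \<phi> b ((\<Sum>c\<in>Basis. f c *\<^sub>R c) \<bullet> b)) \<partial>(\<Pi>\<^sub>M b\<in>(Basis::'a set). lborel))"
    by (subst lborel_eq, subst integral_distr) (auto intro: coordinate_prod_measurable coordinate_sum_measurable)
  also have "\<dots> = (\<integral>f. (\<Prod>b\<in>Basis. \<phi> b (f b)) \<partial>(\<Pi>\<^sub>M b\<in>(Basis::'a set). lborel))"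
    by (simp add: inner_sum_left_Basis)
  also have "\<dots> = (\<Prod>b\<in>Basis. (\<integral>t. \<phi> b t \<partial>lborel))"
    by (rule product_integral_prod) (auto intro: \<phi>)
  finally show ?thesis .
qed

end

definition gauss :: "'a::euclidean_space \<Rightarrow> real" where
  "gauss x = exp (- (norm x)\<^sup>2 / 2)"

lemma gauss_measurable [measurable]: "gauss \<in> borel_measurable borel"
  unfolding gauss_def by measurable

lemma gauss_nonneg: "0 \<le> gauss x" and gauss_le_1: "gauss x \<le> 1" and gauss_0: "gauss 0 = 1"
  by (simp_all add: gauss_def)

lemma gauss_prod: "gauss x = (\<Prod>b\<in>Basis. exp (- (x \<bullet> b)\<^sup>2 / 2))"
proof -
  have "(norm x)\<^sup>2 = (\<Sum>b\<in>Basis. (x \<bullet> b)\<^sup>2)"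
    by (subst euclidean_inner[of x x, unfolded dot_square_norm]) (simp add: power2_eq_square)
  then show ?thesis
    by (simp add: gauss_def exp_sum[symmetric] sum_negf sum_divide_distrib[symmetric])
qed

text \<open>Up to the factor sqrt(2 pi) the integral is the characteristic function of the standard
  normal distribution.\<close>

lemma gauss_fourier_1:
  "integrable lborel (\<lambda>s. exp (\<i> * of_real (t * s)) * of_real (exp (- s\<^sup>2 / 2)))"
  "(\<integral>s. exp (\<i> * of_real (t * s)) * of_real (exp (- s\<^sup>2 / 2)) \<partial>lborel) = of_real (sqrt (2 * pi) * exp (- t\<^sup>2 / 2))"
proof -
  have d: "exp (\<i> * of_real (t * s)) * of_real (exp (- s\<^sup>2 / 2)) =
      of_real (sqrt (2 * pi)) * (std_normal_density s *\<^sub>R exp (\<i> * of_real (t * s)))" for s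
    by (simp add: std_normal_density_def scaleR_conv_of_real field_simps)
  have "integrable lborel (\<lambda>s. std_normal_density s *\<^sub>R exp (\<i> * of_real (t * s)))"
    by (rule Bochner_Integration.integrable_bound[of _ std_normal_density])
      (auto simp: integrable_normal_density)
  then show "integrable lborel (\<lambda>s. exp (\<i> * of_real (t * s)) * of_real (exp (- s\<^sup>2 / 2)))"
    unfolding d by (intro integrable_mult_right)
  have "(\<integral>s. std_normal_density s *\<^sub>R exp (\<i> * of_real (t * s)) \<partial>lborel) = char std_normal_distribution t"
    unfolding char_def by (subst integral_density) auto
  then show "(\<integral>s. exp (\<i> * of_real (t * s)) * of_real (exp (- s\<^sup>2 / 2)) \<partial>lborel) = of_real (sqrt (2 * pi) * exp (- t\<^sup>2 / 2))"
    unfolding d integral_mult_right_zero by (simp only: char_std_normal_distribution of_real_mult)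
qed

lemma
  fixes t :: "'a::euclidean_space"
  shows integrable_gauss_exp: "integrable lborel (\<lambda>x. exp (\<i> * of_real (t \<bullet> x)) * of_real (gauss x))"
    and integral_gauss_exp: "(\<integral>x. exp (\<i> * of_real (t \<bullet> x)) * of_real (gauss x) \<partial>lborel) =
      of_real (sqrt (2 * pi) ^ DIM('a) * gauss t)"
proof -
  have eq: "exp (\<i> * of_real (t \<bullet> x)) * of_real (gauss x) =
      (\<Prod>b\<in>Basis. exp (\<i> * of_real ((t \<bullet> b) * (x \<bullet> b))) * of_real (exp (- (x \<bullet> b)\<^sup>2 / 2)))" for x
    by (simp add: euclidean_inner[of t x] gauss_prod prod.distrib sum_distrib_left exp_sum)
  show "integrable lborel (\<lambda>x. exp (\<i> * of_real (t \<bullet> x)) * of_real (gauss x))"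
    unfolding eq by (rule integrable_coordinate_prod) (rule gauss_fourier_1)
  show "(\<integral>x. exp (\<i> * of_real (t \<bullet> x)) * of_real (gauss x) \<partial>lborel) = of_real (sqrt (2 * pi) ^ DIM('a) * gauss t)"
  proof -
    have "(\<integral>x. exp (\<i> * of_real (t \<bullet> x)) * of_real (gauss x) \<partial>lborel) =
        (\<Prod>b\<in>Basis. \<integral>s. exp (\<i> * of_real ((t \<bullet> b) * s)) * of_real (exp (- s\<^sup>2 / 2)) \<partial>lborel)"
      unfolding eq by (rule integral_coordinate_prod) (rule gauss_fourier_1)
    also have "\<dots> = (\<Prod>b\<in>Basis. of_real (sqrt (2 * pi) * exp (- (t \<bullet> b)\<^sup>2 / 2)))"
      by (intro prod.cong refl gauss_fourier_1(2))
    also have "\<dots> = of_real (sqrt (2 * pi) ^ DIM('a) * gauss t)"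
      by (simp add: gauss_prod[of t] prod.distrib)
    finally show ?thesis .
  qed
qed

lemma integrable_gauss: "integrable lborel (gauss :: 'a::euclidean_space \<Rightarrow> real)"
  and integral_gauss: "(\<integral>x. gauss (x::'a) \<partial>lborel) = sqrt (2 * pi) ^ DIM('a)"
proof -
  have "integrable lborel (\<lambda>x::'a. complex_of_real (gauss x))"
    using integrable_gauss_exp[of "0::'a"] by simp
  then show "integrable lborel (gauss :: 'a \<Rightarrow> real)" by (simp add: complex_of_real_integrable_eq)
  have "complex_of_real (\<integral>x. gauss (x::'a) \<partial>lborel) = of_real (sqrt (2 * pi) ^ DIM('a))"
    using integral_gauss_exp[of "0::'a"] by (simp add: gauss_0 flip: integral_complex_of_real)
  then show "(\<integral>x. gauss (x::'a) \<partial>lborel) = sqrt (2 * pi) ^ DIM('a)" by (simp only: of_real_eq_iff)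
qed

section \<open>Differentiation and decay of the Fourier transform\<close>

lemma Cc_measurable: "f \<in> Cc_infinity \<Longrightarrow> f \<in> borel_measurable borel"
  by (rule borel_measurable_continuous_onI) (rule Cc_continuous)

lemma Cc_integrable:
  assumes f: "f \<in> Cc_infinity" shows "integrable lborel f"
proof -
  obtain r where r: "\<And>x. norm x \<ge> r \<Longrightarrow> f x = 0" using Cc_supportE[OF f] by blast
  have "integrable lborel (\<lambda>x. indicator (cball 0 r) x *\<^sub>R f x)"
    by (rule borel_integrable_compact[OF compact_cball Cc_continuous[OF f]])
  moreover have "(\<lambda>x. indicator (cball 0 r) x *\<^sub>R f x) = f"
  proof
    fix x show "indicator (cball 0 r) x *\<^sub>R f x = f x" using r[of x] by (auto simp: indicator_def)
  qed
  ultimately show ?thesis by (simp only:)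
qed

lemma norm_exp_minus_ii: "norm (exp (- \<i> * complex_of_real t)) = 1"
  by (simp add: norm_exp_eq_Re)

lemma fourier_integrand_integrable:
  assumes f: "f \<in> Cc_infinity"
  shows "integrable lborel (\<lambda>x. complex_of_real (f x) * exp (- \<i> * of_real (x \<bullet> \<xi>)))"
proof (rule Bochner_Integration.integrable_bound[OF Cc_integrable[OF f]])
  note Cc_measurable[OF f, measurable]
  show "(\<lambda>x. complex_of_real (f x) * exp (- \<i> * of_real (x \<bullet> \<xi>))) \<in> borel_measurable lborel" by measurable
qed (auto simp: norm_mult norm_exp_minus_ii[simplified])

lemma fourier_diff:
  assumes "f \<in> Cc_infinity" "g \<in> Cc_infinity"
  shows "fourier (\<lambda>x. f x - g x) \<xi> = fourier f \<xi> - fourier g \<xi>"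
  unfolding fourier_def of_real_diff left_diff_distrib diff_divide_distrib[symmetric]
    Bochner_Integration.integral_diff[OF fourier_integrand_integrable[OF assms(1)] fourier_integrand_integrable[OF assms(2)]]
  by (rule refl)

lemma fourier_bounded:
  assumes f: "f \<in> Cc_infinity" obtains C where "\<And>\<xi>. norm (fourier f \<xi>) \<le> C"
proof (rule that)
  fix \<xi>
  have "norm (\<integral>x. complex_of_real (f x) * exp (- \<i> * of_real (x \<bullet> \<xi>)) \<partial>lborel) \<le>
      (\<integral>x. norm (complex_of_real (f x) * exp (- \<i> * of_real (x \<bullet> \<xi>))) \<partial>lborel)"
    by (rule integral_norm_bound)
  also have "\<dots> = (\<integral>x. \<bar>f x\<bar> \<partial>lborel)" by (simp only: norm_mult norm_exp_minus_ii norm_of_real mult_1_right)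
  finally show "norm (fourier f \<xi>) \<le> (\<integral>x. \<bar>f x\<bar> \<partial>lborel) / (2 * pi) ^ CARD('a)"
    unfolding fourier_def norm_divide norm_of_real by (simp add: divide_right_mono)
qed

lemma fourier_measurable:
  assumes f: "f \<in> Cc_infinity" shows "fourier f \<in> borel_measurable borel"
proof -
  note Cc_measurable[OF f, measurable]
  show ?thesis unfolding fourier_def by measurable
qed

lemma axis_line_derivative:
  assumes "f \<in> Cc_infinity"
  shows "((\<lambda>t. f (x + t *\<^sub>R axis j 1)) has_real_derivative partial_derivative j f (x + t *\<^sub>R axis j 1)) (at t)"
proof -
  define g where "g = (\<lambda>y. f (x + y))"
  have g: "g \<in> Cc_infinity" unfolding g_def by (rule Cc_translate[OF assms])
  have "axis j 1 \<bullet> gradient g (t *\<^sub>R axis j 1) = partial_derivative j g (t *\<^sub>R axis j 1)"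
    by (simp add: gradient_def inner_axis')
  also have "\<dots> = partial_derivative j f (x + t *\<^sub>R axis j 1)"
    unfolding g_def by (simp add: partial_derivative_translate Cc_differentiable assms)
  finally show ?thesis
    using line_derivative[OF Cc_differentiable[OF g], of "axis j 1" t] by (simp add: g_def)
qed

text \<open>Difference quotients take the place of integration by parts: translation by t e_j
  multiplies the transform by exp(i t xi_j), and both sides are differentiated at t = 0 along a
  sequence.\<close>

lemma fourier_partial_derivative:
  fixes f :: "real^'n::finite \<Rightarrow> real"
  assumes f: "f \<in> Cc_infinity"
  shows "fourier (partial_derivative j f) \<xi> = \<i> * of_real (\<xi> $ j) * fourier f \<xi>"
proof -
  note Cc_measurable[OF f, measurable]
  define e :: "real^'n" where "e = axis j 1"
  have e1: "norm e = 1" "e \<bullet> \<xi> = \<xi> $ j" by (simp_all add: e_def inner_axis')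
  define E where "E x = exp (- \<i> * complex_of_real (x \<bullet> \<xi>))" for x :: "real^'n"
  have Em [measurable]: "E \<in> borel_measurable borel" unfolding E_def by measurable
  have nE: "norm (E x) = 1" for x unfolding E_def by (rule norm_exp_minus_ii)
  define N where "N h = (\<integral>x. complex_of_real (h x) * E x \<partial>lborel)" for h
  have intN: "integrable lborel (\<lambda>x. complex_of_real (h x) * E x)" if "h \<in> Cc_infinity" for h
    unfolding E_def by (rule fourier_integrand_integrable[OF that])
  have shift: "N (\<lambda>x. f (t *\<^sub>R e + x)) = exp (of_real t * (\<i> * of_real (\<xi> $ j))) * N f" for t
  proof -
    define h where "h x = complex_of_real (f x) * (exp (of_real t * (\<i> * of_real (\<xi> $ j))) * E x)" for x
    have [measurable]: "h \<in> borel_measurable borel" unfolding h_def by measurable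
    have "h (t *\<^sub>R e + x) = complex_of_real (f (t *\<^sub>R e + x)) * E x" for x
      by (simp add: h_def E_def inner_add_left e1 distrib_left flip: exp_add)
    then have "N (\<lambda>x. f (t *\<^sub>R e + x)) = (\<integral>x. h (t *\<^sub>R e + x) \<partial>lborel)" by (simp add: N_def)
    also have "\<dots> = (\<integral>x. h x \<partial>lborel)" by (rule integral_lborel_translate) measurable
    also have "\<dots> = exp (of_real t * (\<i> * of_real (\<xi> $ j))) * N f"
      by (simp add: h_def N_def mult.left_commute flip: integral_mult_right_zero)
    finally show ?thesis .
  qed
  define s where "s n = inverse (real (Suc n))" for n
  have s0: "s n > 0" "s n \<le> 1" for n by (auto simp: s_def field_simps)
  have slim: "s \<longlonglongrightarrow> 0" unfolding s_def by (rule LIMSEQ_inverse_real_of_nat)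
  have sfl: "filterlim s (at 0) sequentially"
    by (rule filterlim_atI[OF slim]) (use s0(1) in \<open>auto intro!: always_eventually simp: less_imp_neq[symmetric]\<close>)
  define D where "D n x = (f (s n *\<^sub>R e + x) - f x) / s n" for n x
  have "N (D n) = (exp (of_real (s n) * (\<i> * of_real (\<xi> $ j))) - 1) / of_real (s n) * N f" for n
  proof -
    have "N (D n) = (\<integral>x. (complex_of_real (f (s n *\<^sub>R e + x)) * E x - complex_of_real (f x) * E x) / of_real (s n) \<partial>lborel)"
      by (simp add: N_def D_def left_diff_distrib)
    also have "\<dots> = (N (\<lambda>x. f (s n *\<^sub>R e + x)) - N f) / of_real (s n)"
      unfolding N_def
      by (simp add: Bochner_Integration.integral_diff intN f Cc_translate)
    finally show ?thesis by (simp add: shift left_diff_distrib)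
  qed
  moreover have "(\<lambda>n. (exp (of_real (s n) * (\<i> * of_real (\<xi> $ j))) - 1) / of_real (s n) * N f) \<longlonglongrightarrow>
      \<i> * of_real (\<xi> $ j) * N f"
  proof (rule tendsto_mult_right)
    have "((\<lambda>z. exp (z * (\<i> * of_real (\<xi> $ j)))) has_field_derivative \<i> * of_real (\<xi> $ j)) (at (0::complex))"
      by (auto intro!: derivative_eq_intros)
    then have "((\<lambda>z. (exp (z * (\<i> * of_real (\<xi> $ j))) - 1) / z) \<longlongrightarrow> \<i> * of_real (\<xi> $ j)) (at (0::complex))"
      by (simp add: DERIV_def)
    moreover have "filterlim (\<lambda>n. complex_of_real (s n)) (at 0) sequentially"
      by (rule filterlim_atI)
        (use tendsto_of_real[OF slim, where 'a = complex] s0(1) in \<open>auto intro!: always_eventually simp: less_imp_neq[symmetric]\<close>)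
    ultimately show "(\<lambda>n. (exp (of_real (s n) * (\<i> * of_real (\<xi> $ j))) - 1) / of_real (s n)) \<longlonglongrightarrow> \<i> * of_real (\<xi> $ j)"
      by (rule filterlim_compose)
  qed
  ultimately have lim1: "(\<lambda>n. N (D n)) \<longlonglongrightarrow> \<i> * of_real (\<xi> $ j) * N f" by simp
  obtain r where r: "\<And>x. norm x \<ge> r \<Longrightarrow> f x = 0" using Cc_supportE[OF f] by blast
  obtain B where B: "B \<ge> 0" "\<And>x. \<bar>partial_derivative j f x\<bar> \<le> B"
    using Cc_bounded[OF Cc_partial_derivative[OF f, of j]] by blast
  note Cc_measurable[OF Cc_partial_derivative[OF f, of j], measurable]
  have lim2: "(\<lambda>n. N (D n)) \<longlonglongrightarrow> N (partial_derivative j f)"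
    unfolding N_def
  \<comment> \<open>The mean value theorem bounds the quotients by B; steps of length at most 1 keep
    their supports in the ball of radius r + 1.\<close>
  proof (rule integral_dominated_convergence[where w = "\<lambda>x. indicator (cball 0 (r + 1)) x *\<^sub>R B"])
    show "integrable lborel (\<lambda>x::real^'n. indicator (cball 0 (r + 1)) x *\<^sub>R B)"
      by (rule borel_integrable_compact) auto
    show "(\<lambda>x. complex_of_real (D n x) * E x) \<in> borel_measurable lborel" for n
      unfolding D_def by measurable
    show "(\<lambda>x. complex_of_real (partial_derivative j f x) * E x) \<in> borel_measurable lborel"
      by measurable
    show "AE x in lborel. (\<lambda>n. complex_of_real (D n x) * E x) \<longlonglongrightarrow> complex_of_real (partial_derivative j f x) * E x"
    proof (intro AE_I2 tendsto_mult tendsto_const tendsto_of_real)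
      fix x :: "real^'n"
      have "((\<lambda>h. (f (x + h *\<^sub>R e) - f x) / h) \<longlongrightarrow> partial_derivative j f x) (at 0)"
        using axis_line_derivative[OF f, of x j 0] by (simp add: DERIV_def e_def)
      from filterlim_compose[OF this sfl] show "(\<lambda>n. D n x) \<longlonglongrightarrow> partial_derivative j f x"
        by (simp add: D_def add.commute)
    qed
    show "AE x in lborel. norm (complex_of_real (D n x) * E x) \<le> indicator (cball 0 (r + 1)) x *\<^sub>R B" for n
    proof (intro AE_I2)
      fix x :: "real^'n"
      show "norm (complex_of_real (D n x) * E x) \<le> indicator (cball 0 (r + 1)) x *\<^sub>R B"
      proof (cases "norm x \<le> r + 1")
        case True
        obtain \<tau> where "f (x + s n *\<^sub>R e) - f (x + 0 *\<^sub>R e) = (s n - 0) * partial_derivative j f (x + \<tau> *\<^sub>R e)"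
          using MVT2[OF s0(1)[of n], of "\<lambda>t. f (x + t *\<^sub>R e)" "\<lambda>t. partial_derivative j f (x + t *\<^sub>R e)"]
            axis_line_derivative[OF f] unfolding e_def by blast
        then have "D n x = partial_derivative j f (x + \<tau> *\<^sub>R e)"
          using s0(1)[of n] by (simp add: D_def add.commute)
        then show ?thesis using True B(2) by (simp add: norm_mult nE)
      next
        case False
        have "norm (s n *\<^sub>R e) \<le> 1" using s0[of n] by (simp add: e1)
        then have "norm (s n *\<^sub>R e + x) \<ge> r"
          using norm_triangle_ineq2[of x "- (s n *\<^sub>R e)"] False by (simp add: add.commute)
        then show ?thesis using False r[of x] r[of "s n *\<^sub>R e + x"] by (simp add: D_def)
      qed
    qed
  qed
  have "N (partial_derivative j f) = \<i> * of_real (\<xi> $ j) * N f"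
    by (rule LIMSEQ_unique[OF lim2 lim1])
  then show ?thesis by (simp add: fourier_def N_def E_def)
qed

text \<open>The operator 1 - d_j^2 preserves test functions and multiplies the transform by 1 +
  xi_j^2; it is applied once for each j in S.\<close>

lemma fourier_polynomial_weight:
  fixes f :: "real^'n::finite \<Rightarrow> real"
  assumes "f \<in> Cc_infinity" "finite S"
  shows "\<exists>g\<in>Cc_infinity. \<forall>\<xi>. fourier g \<xi> = of_real (\<Prod>j\<in>S. 1 + (\<xi> $ j)\<^sup>2) * fourier f \<xi>"
  using assms(2)
proof (induction S rule: finite_induct)
  case empty
  then show ?case using assms(1) by auto
next
  case (insert j S)
  then obtain g where g: "g \<in> Cc_infinity"
    "\<And>\<xi>. fourier g \<xi> = of_real (\<Prod>j\<in>S. 1 + (\<xi> $ j)\<^sup>2) * fourier f \<xi>" by blast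
  define h where "h = (\<lambda>x. g x - partial_derivative j (partial_derivative j g) x)"
  have "h \<in> Cc_infinity" unfolding h_def by (intro Cc_diff g Cc_partial_derivative)
  moreover have "fourier h \<xi> = of_real (\<Prod>j\<in>insert j S. 1 + (\<xi> $ j)\<^sup>2) * fourier f \<xi>" for \<xi>
  proof -
    have "fourier h \<xi> = fourier g \<xi> - \<i> * of_real (\<xi> $ j) * (\<i> * of_real (\<xi> $ j) * fourier g \<xi>)"
      by (simp add: h_def fourier_diff fourier_partial_derivative g(1) Cc_partial_derivative)
    also have "\<dots> = of_real (1 + (\<xi> $ j)\<^sup>2) * fourier g \<xi>"
      by (simp add: power2_eq_square algebra_simps)
    finally show ?thesis using insert.hyps by (simp add: g(2))
  qed
  ultimately show ?case by blast
qed

text \<open>Compares 1 + |xi|^2 with the product of the factors 1 + xi_j^2, the weight that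
  differentiation produces and that splits into one-dimensional integrals.\<close>

lemma one_plus_sum_le_prod:
  fixes a :: "'b \<Rightarrow> real"
  assumes "finite S" "\<And>i. i \<in> S \<Longrightarrow> 0 \<le> a i"
  shows "1 + (\<Sum>i\<in>S. a i) \<le> (\<Prod>i\<in>S. 1 + a i)"
  using assms
proof (induction S rule: finite_induct)
  case (insert i S)
  have "0 \<le> (\<Sum>i\<in>S. a i)" using insert.prems by (intro sum_nonneg) auto
  then have "1 + (a i + (\<Sum>i\<in>S. a i)) \<le> (1 + a i) * (1 + (\<Sum>i\<in>S. a i))"
    using insert.prems[of i] by (simp add: algebra_simps)
  also have "\<dots> \<le> (1 + a i) * (\<Prod>i\<in>S. 1 + a i)"
    using insert by (intro mult_left_mono) auto
  finally show ?case using insert.hyps by simp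
qed simp

lemma Basis_vec_image: "(Basis :: (real^'n::finite) set) = (\<lambda>i. axis i 1) ` UNIV"
  by (auto simp: Basis_vec_def)

lemma integrable_decay: "integrable lborel (\<lambda>\<xi>::real^'n::finite. \<Prod>j\<in>UNIV. inverse (1 + (\<xi> $ j)\<^sup>2))"
proof -
  have "integrable lborel (\<lambda>t::real. inverse (1 + t\<^sup>2))"
    using integrable_inverse_1_plus_square by (simp add: set_integrable_def)
  then have "integrable lborel (\<lambda>x::real^'n. \<Prod>b\<in>Basis. inverse (1 + (x \<bullet> b)\<^sup>2))"
    by (rule integrable_coordinate_prod)
  moreover have "(\<Prod>b\<in>Basis. inverse (1 + (x \<bullet> b)\<^sup>2)) = (\<Prod>j\<in>UNIV. inverse (1 + (x $ j)\<^sup>2))" for x :: "real^'n"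
    unfolding Basis_vec_image
    by (subst prod.reindex) (auto simp: inj_on_def axis_eq_axis inner_axis)
  ultimately show ?thesis by simp
qed

text \<open>The product weight P is applied twice, so P^2 times the transform is bounded. One factor
  P absorbs 1 + |xi|^2, and the inverse of the other is integrable.\<close>

lemma fourier_weight_integrable:
  fixes f :: "real^'n::finite \<Rightarrow> real"
  assumes f: "f \<in> Cc_infinity"
  shows "integrable lborel (\<lambda>\<xi>. (1 + (norm \<xi>)\<^sup>2) * norm (fourier f \<xi>))"
proof -
  note fourier_measurable[OF f, measurable]
  define P where "P \<xi> = (\<Prod>j\<in>UNIV. 1 + (\<xi> $ j)\<^sup>2)" for \<xi> :: "real^'n"
  obtain g where g: "g \<in> Cc_infinity" "\<And>\<xi>. fourier g \<xi> = of_real (P \<xi>) * fourier f \<xi>"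
    using fourier_polynomial_weight[OF f, of UNIV] unfolding P_def by auto
  obtain h where h: "h \<in> Cc_infinity" "\<And>\<xi>. fourier h \<xi> = of_real (P \<xi>) * fourier g \<xi>"
    using fourier_polynomial_weight[OF g(1), of UNIV] unfolding P_def by auto
  obtain C where C: "\<And>\<xi>. norm (fourier h \<xi>) \<le> C" using fourier_bounded[OF h(1)] by blast
  have P: "P \<xi> > 0" for \<xi> unfolding P_def by (intro prod_pos) (auto intro: add_pos_nonneg)
  have "integrable lborel (\<lambda>\<xi>. C * (\<Prod>j\<in>UNIV. inverse (1 + (\<xi> $ j)\<^sup>2)) :: real)"
    by (intro integrable_mult_right integrable_decay)
  then show ?thesis
  proof (rule Bochner_Integration.integrable_bound)
    show "(\<lambda>\<xi>. (1 + (norm \<xi>)\<^sup>2) * norm (fourier f \<xi>)) \<in> borel_measurable lborel" by measurable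
    show "AE \<xi> in lborel. norm ((1 + (norm \<xi>)\<^sup>2) * norm (fourier f \<xi>)) \<le> norm (C * (\<Prod>j\<in>UNIV. inverse (1 + (\<xi> $ j)\<^sup>2)))"
    proof (intro AE_I2)
      fix \<xi> :: "real^'n"
      have n: "(norm \<xi>)\<^sup>2 = (\<Sum>j\<in>UNIV. (\<xi> $ j)\<^sup>2)"
        unfolding power2_norm_eq_inner inner_vec_def by (simp add: power2_eq_square)
      have "P \<xi> * (P \<xi> * norm (fourier f \<xi>)) \<le> C"
        using C[of \<xi>] P[of \<xi>] by (simp add: h(2) g(2) norm_mult)
      then have "P \<xi> * norm (fourier f \<xi>) \<le> C * inverse (P \<xi>)"
        using P[of \<xi>] by (simp add: field_simps)
      moreover have "(1 + (norm \<xi>)\<^sup>2) * norm (fourier f \<xi>) \<le> P \<xi> * norm (fourier f \<xi>)"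
        unfolding n P_def by (intro mult_right_mono one_plus_sum_le_prod) auto
      ultimately have "(1 + (norm \<xi>)\<^sup>2) * norm (fourier f \<xi>) \<le> C * inverse (P \<xi>)" by simp
      then have "norm ((1 + (norm \<xi>)\<^sup>2) * norm (fourier f \<xi>)) \<le> norm (C * inverse (P \<xi>))"
        by simp
      then show "norm ((1 + (norm \<xi>)\<^sup>2) * norm (fourier f \<xi>)) \<le> norm (C * (\<Prod>j\<in>UNIV. inverse (1 + (\<xi> $ j)\<^sup>2)))"
        using prod_inversef[of "\<lambda>j. 1 + (\<xi> $ j)\<^sup>2" UNIV] by (simp add: P_def o_def)
    qed
  qed
qed

lemma fourier_integrable_weighted:
  fixes f :: "real^'n::finite \<Rightarrow> real" and g :: "real^'n \<Rightarrow> complex"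
  assumes f: "f \<in> Cc_infinity" and [measurable]: "g \<in> borel_measurable borel"
    and g: "\<And>\<xi>. norm (g \<xi>) \<le> K * (1 + (norm \<xi>)\<^sup>2)"
  shows "integrable lborel (\<lambda>\<xi>. g \<xi> * fourier f \<xi>)"
proof (rule Bochner_Integration.integrable_bound[OF integrable_mult_right[of K, OF fourier_weight_integrable[OF f]]])
  note fourier_measurable[OF f, measurable]
  show "(\<lambda>\<xi>. g \<xi> * fourier f \<xi>) \<in> borel_measurable lborel" by measurable
  show "AE \<xi> in lborel. norm (g \<xi> * fourier f \<xi>) \<le> norm (K * ((1 + (norm \<xi>)\<^sup>2) * norm (fourier f \<xi>)))"
  proof (intro AE_I2)
    fix \<xi>
    have "norm (g \<xi> * fourier f \<xi>) \<le> K * (1 + (norm \<xi>)\<^sup>2) * norm (fourier f \<xi>)"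
      unfolding norm_mult by (intro mult_right_mono g) simp
    then show "norm (g \<xi> * fourier f \<xi>) \<le> norm (K * ((1 + (norm \<xi>)\<^sup>2) * norm (fourier f \<xi>)))"
      by (simp only: mult.assoc real_norm_def)
  qed
qed

section \<open>Fourier inversion by Gaussian regularization\<close>

lemma norm_exp_ii [simp]: "norm (exp (\<i> * complex_of_real t)) = 1"
  by (simp add: norm_exp_eq_Re)

lemma integral_scaled_gauss_exp:
  fixes t :: "'a::euclidean_space"
  assumes s: "s > 0"
  shows "(\<integral>\<xi>. exp (\<i> * of_real (t \<bullet> \<xi>)) * of_real (gauss (s *\<^sub>R \<xi>)) \<partial>lborel) =
    of_real ((1 / s) ^ DIM('a) * (sqrt (2 * pi) ^ DIM('a) * gauss ((1 / s) *\<^sub>R t)))"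
proof -
  have "(\<integral>\<xi>. exp (\<i> * of_real (t \<bullet> \<xi>)) * of_real (gauss (s *\<^sub>R \<xi>)) \<partial>lborel) =
      (\<integral>\<xi>. \<bar>1 / s\<bar> ^ DIM('a) *\<^sub>R (exp (\<i> * of_real (t \<bullet> (0 + (1 / s) *\<^sub>R \<xi>))) * of_real (gauss (s *\<^sub>R (0 + (1 / s) *\<^sub>R \<xi>)))) \<partial>lborel)"
    using s by (intro integral_lborel_affine) auto
  also have "\<dots> = (\<integral>\<xi>. of_real ((1 / s) ^ DIM('a)) * (exp (\<i> * of_real (((1 / s) *\<^sub>R t) \<bullet> \<xi>)) * of_real (gauss \<xi>)) \<partial>lborel)"
    using s by (simp add: scaleR_conv_of_real)
  also have "\<dots> = of_real ((1 / s) ^ DIM('a)) * of_real (sqrt (2 * pi) ^ DIM('a) * gauss ((1 / s) *\<^sub>R t))"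
    unfolding integral_mult_right_zero integral_gauss_exp ..
  finally show ?thesis by (simp only: of_real_mult)
qed

text \<open>The Gaussian factor makes the double integral over xi and z absolutely convergent. After
  the exchange the xi-integral is a Gaussian in x - z, and substituting x + s z for z turns the
  result into an average of f around x.\<close>

lemma fourier_gauss_regularized:
  fixes f :: "real^'n::finite \<Rightarrow> real"
  assumes f: "f \<in> Cc_infinity" and s: "s > 0"
  shows "(\<integral>\<xi>. exp (\<i> * of_real (x \<bullet> \<xi>)) * fourier f \<xi> * of_real (gauss (s *\<^sub>R \<xi>)) \<partial>lborel) =
    of_real ((\<integral>z. f (x + s *\<^sub>R z) * gauss z \<partial>lborel) / sqrt (2 * pi) ^ CARD('n))"
proof -
  note Cc_measurable[OF f, measurable]
  define d where "d = CARD('n)"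
  define F where "F \<xi> z = exp (\<i> * of_real (x \<bullet> \<xi>)) * of_real (gauss (s *\<^sub>R \<xi>)) *
    (complex_of_real (f z) * exp (- \<i> * of_real (z \<bullet> \<xi>)))" for \<xi> z
  have Fm: "(\<lambda>p. F (fst p) (snd p)) \<in> borel_measurable (lborel \<Otimes>\<^sub>M lborel)" unfolding F_def by measurable
  have nF: "norm (F \<xi> z) = gauss (s *\<^sub>R \<xi>) * \<bar>f z\<bar>" for \<xi> z
    unfolding F_def norm_mult norm_exp_minus_ii norm_exp_ii by (simp add: gauss_nonneg)
  have gs: "integrable lborel (\<lambda>\<xi>::real^'n. gauss (s *\<^sub>R \<xi>))"
  proof -
    have "gauss (s *\<^sub>R \<xi>) = (\<Prod>b\<in>Basis. exp (- (s * (\<xi> \<bullet> b))\<^sup>2 / 2))" for \<xi> :: "real^'n" by (simp add: gauss_prod)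
    moreover have 1: "integrable lborel (\<lambda>t. exp (- (s * t)\<^sup>2 / 2))"
    proof -
      have "integrable lborel (\<lambda>t::real. exp (- t\<^sup>2 / 2))"
        using gauss_fourier_1(1)[of 0] by (simp add: complex_of_real_integrable_eq)
      from lborel_integrable_real_affine[OF this, of s 0] show ?thesis using s by simp
    qed
    moreover have "integrable lborel (\<lambda>\<xi>::real^'n. \<Prod>b\<in>Basis. exp (- (s * (\<xi> \<bullet> b))\<^sup>2 / 2))"
      by (rule integrable_coordinate_prod[OF 1])
    ultimately show ?thesis by (simp only:)
  qed
  have int: "integrable (lborel \<Otimes>\<^sub>M lborel) (\<lambda>(\<xi>, z). F \<xi> z)"
  proof (rule lborel_pair.Fubini_integrable)
    show "(\<lambda>(\<xi>, z). F \<xi> z) \<in> borel_measurable (lborel \<Otimes>\<^sub>M lborel)" using Fm by (simp add: case_prod_beta')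
    show "integrable lborel (\<lambda>\<xi>. \<integral>z. norm (case (\<xi>, z) of (\<xi>, z) \<Rightarrow> F \<xi> z) \<partial>lborel)"
      using gs by (simp add: nF)
    have "integrable lborel (\<lambda>z. F \<xi> z)" for \<xi>
      unfolding F_def by (rule integrable_mult_right[OF fourier_integrand_integrable[OF f]])
    then show "AE \<xi> in lborel. integrable lborel (\<lambda>z. case (\<xi>, z) of (\<xi>, z) \<Rightarrow> F \<xi> z)" by simp
  qed
  have "(\<integral>\<xi>. exp (\<i> * of_real (x \<bullet> \<xi>)) * fourier f \<xi> * of_real (gauss (s *\<^sub>R \<xi>)) \<partial>lborel) =
      (\<integral>\<xi>. (\<integral>z. F \<xi> z \<partial>lborel) / of_real ((2 * pi) ^ d) \<partial>lborel)"
    unfolding F_def fourier_def integral_mult_right_zero d_def by (simp add: mult_ac)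
  also have "\<dots> = (\<integral>\<xi>. (\<integral>z. F \<xi> z \<partial>lborel) \<partial>lborel) / of_real ((2 * pi) ^ d)"
    by (rule integral_divide_zero)
  also have "(\<integral>\<xi>. (\<integral>z. F \<xi> z \<partial>lborel) \<partial>lborel) = (\<integral>z. (\<integral>\<xi>. F \<xi> z \<partial>lborel) \<partial>lborel)"
    by (rule lborel_pair.Fubini_integral[OF int, symmetric])
  also have "(\<lambda>z. \<integral>\<xi>. F \<xi> z \<partial>lborel) =
      (\<lambda>z. complex_of_real (f z * ((1 / s) ^ d * (sqrt (2 * pi) ^ d * gauss ((1 / s) *\<^sub>R (x - z))))))"
  proof
    fix z
    have "F \<xi> z = complex_of_real (f z) * (exp (\<i> * of_real ((x - z) \<bullet> \<xi>)) * of_real (gauss (s *\<^sub>R \<xi>)))" for \<xi>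
    proof -
      have "exp (\<i> * of_real ((x - z) \<bullet> \<xi>)) = exp (\<i> * of_real (x \<bullet> \<xi>)) * exp (- \<i> * of_real (z \<bullet> \<xi>))"
        by (simp add: inner_diff_left right_diff_distrib flip: exp_add)
      then show ?thesis by (simp only: F_def mult_ac)
    qed
    then show "(\<integral>\<xi>. F \<xi> z \<partial>lborel) =
        complex_of_real (f z * ((1 / s) ^ d * (sqrt (2 * pi) ^ d * gauss ((1 / s) *\<^sub>R (x - z)))))"
      by (simp only: integral_mult_right_zero integral_scaled_gauss_exp[OF s] of_real_mult d_def DIM_cart DIM_real mult_1_right)
  qed
  also have "(\<integral>z. complex_of_real (f z * ((1 / s) ^ d * (sqrt (2 * pi) ^ d * gauss ((1 / s) *\<^sub>R (x - z))))) \<partial>lborel) =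
      of_real (\<integral>z. f z * ((1 / s) ^ d * (sqrt (2 * pi) ^ d * gauss ((1 / s) *\<^sub>R (x - z)))) \<partial>lborel)"
    by (rule integral_complex_of_real)
  also have "(\<integral>z. f z * ((1 / s) ^ d * (sqrt (2 * pi) ^ d * gauss ((1 / s) *\<^sub>R (x - z)))) \<partial>lborel) =
      (\<integral>z. \<bar>s\<bar> ^ d *\<^sub>R (f (x + s *\<^sub>R z) * ((1 / s) ^ d * (sqrt (2 * pi) ^ d * gauss ((1 / s) *\<^sub>R (x - (x + s *\<^sub>R z)))))) \<partial>lborel)"
    using s unfolding d_def by (subst integral_lborel_affine[where c = s and t = x]) auto
  also have "\<dots> = (\<integral>z. sqrt (2 * pi) ^ d * (f (x + s *\<^sub>R z) * gauss z) \<partial>lborel)"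
  proof (rule Bochner_Integration.integral_cong[OF refl])
    fix z :: "real^'n"
    have "gauss ((1 / s) *\<^sub>R (x - (x + s *\<^sub>R z))) = gauss z" using s by (simp add: gauss_def)
    moreover have "\<bar>s\<bar> ^ d * (1 / s) ^ d = 1" using s by (simp flip: power_mult_distrib)
    moreover have "\<bar>s\<bar> ^ d *\<^sub>R (F * ((1 / s) ^ d * (c * g))) = (\<bar>s\<bar> ^ d * (1 / s) ^ d) * (c * (F * g))"
      for F c g :: real
      by (simp only: real_scaleR_def mult_ac)
    ultimately show "\<bar>s\<bar> ^ d *\<^sub>R (f (x + s *\<^sub>R z) * ((1 / s) ^ d * (sqrt (2 * pi) ^ d * gauss ((1 / s) *\<^sub>R (x - (x + s *\<^sub>R z)))))) =
        sqrt (2 * pi) ^ d * (f (x + s *\<^sub>R z) * gauss z)"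
      by (simp only: mult_1_left)
  qed
  also have "\<dots> = sqrt (2 * pi) ^ d * (\<integral>z. f (x + s *\<^sub>R z) * gauss z \<partial>lborel)"
    by (rule integral_mult_right_zero)
  also have "complex_of_real \<dots> / of_real ((2 * pi) ^ d) =
      of_real (sqrt (2 * pi) ^ d * (\<integral>z. f (x + s *\<^sub>R z) * gauss z \<partial>lborel) / (2 * pi) ^ d)"
    by (simp only: of_real_divide)
  \<comment> \<open>The normalization (2 pi)^d is the square of sqrt(2 pi)^d, and one of these
    factors cancels against the Gaussian integral.\<close>
  also have "sqrt (2 * pi) ^ d * (\<integral>z. f (x + s *\<^sub>R z) * gauss z \<partial>lborel) / (2 * pi) ^ d =
      (\<integral>z. f (x + s *\<^sub>R z) * gauss z \<partial>lborel) / sqrt (2 * pi) ^ d"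
  proof -
    have "(2 * pi) ^ d = (sqrt (2 * pi) * sqrt (2 * pi)) ^ d" by simp
    then have "(2 * pi) ^ d = sqrt (2 * pi) ^ d * sqrt (2 * pi) ^ d" by (simp only: power_mult_distrib)
    moreover have "A * X / (A * A) = X / A" if "A \<noteq> 0" for A X :: real using that by simp
    moreover have "sqrt (2 * pi) ^ d \<noteq> 0" by simp
    ultimately show ?thesis by (simp only: not_False_eq_True)
  qed
  finally show ?thesis unfolding d_def .
qed

text \<open>The regularized identity is taken to the limit s -> 0 on both sides: on the left the
  integrable transform dominates, on the right a bound of f times the Gaussian, and f is averaged
  with total weight 1 ever closer to x.\<close>

theorem fourier_inversion:
  fixes f :: "real^'n::finite \<Rightarrow> real"
  assumes f: "f \<in> Cc_infinity"
  shows "(\<integral>\<xi>. exp (\<i> * of_real (x \<bullet> \<xi>)) * fourier f \<xi> \<partial>lborel) = of_real (f x)"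
proof -
  note Cc_measurable[OF f, measurable] fourier_measurable[OF f, measurable]
  define s where "s n = inverse (real (Suc n))" for n
  have s0: "s n > 0" for n by (simp add: s_def)
  have slim: "s \<longlonglongrightarrow> 0" unfolding s_def by (rule LIMSEQ_inverse_real_of_nat)
  define J where "J n = (\<integral>\<xi>. exp (\<i> * of_real (x \<bullet> \<xi>)) * fourier f \<xi> * of_real (gauss (s n *\<^sub>R \<xi>)) \<partial>lborel)" for n
  have "J \<longlonglongrightarrow> (\<integral>\<xi>. exp (\<i> * of_real (x \<bullet> \<xi>)) * fourier f \<xi> \<partial>lborel)"
    unfolding J_def
  proof (rule integral_dominated_convergence[where w = "\<lambda>\<xi>. norm (1 * fourier f \<xi>)"])
    show "integrable lborel (\<lambda>\<xi>. norm (1 * fourier f \<xi>))"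
      by (intro integrable_norm fourier_integrable_weighted[OF f, of _ 1]) auto
    show "AE \<xi> in lborel. (\<lambda>n. exp (\<i> * of_real (x \<bullet> \<xi>)) * fourier f \<xi> * of_real (gauss (s n *\<^sub>R \<xi>)))
        \<longlonglongrightarrow> exp (\<i> * of_real (x \<bullet> \<xi>)) * fourier f \<xi>"
    proof (intro AE_I2)
      fix \<xi> :: "real^'n"
      have "(\<lambda>n. gauss (s n *\<^sub>R \<xi>)) \<longlonglongrightarrow> exp (- (norm (0 *\<^sub>R \<xi>))\<^sup>2 / 2)"
        unfolding gauss_def by (intro tendsto_intros slim) simp
      then have "(\<lambda>n. exp (\<i> * of_real (x \<bullet> \<xi>)) * fourier f \<xi> * of_real (gauss (s n *\<^sub>R \<xi>)))
          \<longlonglongrightarrow> exp (\<i> * of_real (x \<bullet> \<xi>)) * fourier f \<xi> * of_real (exp (- (norm (0 *\<^sub>R \<xi>))\<^sup>2 / 2))"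
        by (intro tendsto_mult tendsto_const tendsto_of_real)
      then show "(\<lambda>n. exp (\<i> * of_real (x \<bullet> \<xi>)) * fourier f \<xi> * of_real (gauss (s n *\<^sub>R \<xi>)))
          \<longlonglongrightarrow> exp (\<i> * of_real (x \<bullet> \<xi>)) * fourier f \<xi>" by simp
    qed
    show "AE \<xi> in lborel. norm (exp (\<i> * of_real (x \<bullet> \<xi>)) * fourier f \<xi> * of_real (gauss (s n *\<^sub>R \<xi>)))
        \<le> norm (1 * fourier f \<xi>)" for n
    proof (intro AE_I2)
      fix \<xi> :: "real^'n"
      show "norm (exp (\<i> * of_real (x \<bullet> \<xi>)) * fourier f \<xi> * of_real (gauss (s n *\<^sub>R \<xi>))) \<le> norm (1 * fourier f \<xi>)"
        using gauss_nonneg[of "s n *\<^sub>R \<xi>"] gauss_le_1[of "s n *\<^sub>R \<xi>"]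
        by (simp add: norm_mult mult_left_le)
    qed
  qed measurable
  moreover have "J \<longlonglongrightarrow> of_real (f x)"
  proof -
    obtain B where B: "\<And>x. \<bar>f x\<bar> \<le> B" using Cc_bounded[OF f] by blast
    have "(\<lambda>n. \<integral>z. f (x + s n *\<^sub>R z) * gauss z \<partial>lborel) \<longlonglongrightarrow> (\<integral>z. f x * gauss (z :: real^'n) \<partial>lborel)"
    proof (rule integral_dominated_convergence[where w = "\<lambda>z. B * gauss z"])
      show "integrable lborel (\<lambda>z::real^'n. B * gauss z)" by (intro integrable_mult_right integrable_gauss)
      show "AE z in lborel. (\<lambda>n. f (x + s n *\<^sub>R z) * gauss z) \<longlonglongrightarrow> f x * gauss z"
      proof (intro AE_I2 tendsto_mult tendsto_const)
        fix z :: "real^'n"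
        have "(\<lambda>n. x + s n *\<^sub>R z) \<longlonglongrightarrow> x + 0 *\<^sub>R z" by (intro tendsto_intros slim)
        from continuous_on_tendsto_compose[OF Cc_continuous[OF f, of UNIV] this]
        show "(\<lambda>n. f (x + s n *\<^sub>R z)) \<longlonglongrightarrow> f x" by simp
      qed
      show "AE z in lborel. norm (f (x + s n *\<^sub>R z) * gauss z) \<le> B * gauss z" for n
      proof (intro AE_I2)
        fix z :: "real^'n"
        show "norm (f (x + s n *\<^sub>R z) * gauss z) \<le> B * gauss z"
          using mult_right_mono[OF B[of "x + s n *\<^sub>R z"] gauss_nonneg[of z]]
          by (simp add: abs_mult abs_of_nonneg[OF gauss_nonneg])
      qed
    qed measurable
    then have "(\<lambda>n. (\<integral>z. f (x + s n *\<^sub>R z) * gauss z \<partial>lborel) / sqrt (2 * pi) ^ CARD('n)) \<longlonglongrightarrow>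
        (\<integral>z. f x * gauss (z :: real^'n) \<partial>lborel) / sqrt (2 * pi) ^ CARD('n)"
      by (intro tendsto_divide tendsto_const) auto
    then have "(\<lambda>n. (\<integral>z. f (x + s n *\<^sub>R z) * gauss z \<partial>lborel) / sqrt (2 * pi) ^ CARD('n)) \<longlonglongrightarrow> f x"
      by (simp add: integral_gauss)
    then show ?thesis
      unfolding J_def fourier_gauss_regularized[OF f s0] by (rule tendsto_of_real)
  qed
  ultimately show ?thesis by (rule LIMSEQ_unique)
qed

section \<open>Pseudo-differential operators with negative definite symbols\<close>

lemma levy_measure_ident_measurable:
  assumes "levy_measure \<nu>" shows "(\<lambda>y. y) \<in> measurable \<nu> borel"
proof -
  have "sets \<nu> = sets (restrict_space borel (- {0}))" using assms by (simp add: levy_measure_def)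
  moreover have "(\<lambda>y. y) \<in> measurable (restrict_space borel (- {0})) borel"
    by (rule measurable_restrict_space1) simp
  ultimately show ?thesis by (simp cong: measurable_cong_sets)
qed

lemma levy_measure_space: "levy_measure \<nu> \<Longrightarrow> space \<nu> = - {0}"
  using sets_eq_imp_space_eq[of \<nu> "restrict_space borel (- {0})"]
  by (simp add: levy_measure_def space_restrict_space)

text \<open>Prepares Fubini's theorem. The sets on which n min(1, |y|^2) \<ge> 1 exhaust the
  punctured space, and Markov's inequality gives them finite measure.\<close>

lemma levy_measure_sigma_finite:
  fixes \<nu> :: "(real^'n::finite) measure"
  assumes \<nu>: "levy_measure \<nu>" shows "sigma_finite_measure \<nu>"
proof -
  note levy_measure_ident_measurable[OF \<nu>, measurable]
  define m where "m y = ennreal (min 1 ((norm y)\<^sup>2))" for y :: "real^'n"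
  have [measurable]: "m \<in> borel_measurable \<nu>" unfolding m_def by measurable
  have fin: "(\<integral>\<^sup>+ y. m y \<partial>\<nu>) < \<infinity>" using \<nu> by (simp add: levy_measure_def m_def)
  define A where "A n = {y \<in> space \<nu>. 1 \<le> ennreal (real n) * m y}" for n
  have "\<Union> (range A) = space \<nu>"
  proof
    show "space \<nu> \<subseteq> \<Union> (range A)"
    proof
      fix y assume y: "y \<in> space \<nu>"
      then have "0 < min 1 ((norm y)\<^sup>2)" using levy_measure_space[OF \<nu>] by simp
      moreover obtain n :: nat where "1 / min 1 ((norm y)\<^sup>2) < real n" using reals_Archimedean2 by blast
      ultimately have "1 \<le> real n * min 1 ((norm y)\<^sup>2)" by (simp only: pos_divide_less_eq)
      then have "ennreal 1 \<le> ennreal (real n * min 1 ((norm y)\<^sup>2))" by (rule ennreal_leI)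
      then have "y \<in> A n" using y by (simp add: A_def m_def ennreal_mult)
      then show "y \<in> \<Union> (range A)" by blast
    qed
  qed (auto simp: A_def)
  moreover have "emeasure \<nu> (A n) \<noteq> \<infinity>" for n
  proof -
    have "emeasure \<nu> (A n) \<le> ennreal (real n) * (\<integral>\<^sup>+ y. m y * indicator (space \<nu>) y \<partial>\<nu>)"
      unfolding A_def by (rule nn_integral_Markov_inequality) auto
    also have "(\<integral>\<^sup>+ y. m y * indicator (space \<nu>) y \<partial>\<nu>) = (\<integral>\<^sup>+ y. m y \<partial>\<nu>)"
      by (intro nn_integral_cong) simp
    also have "ennreal (real n) * (\<integral>\<^sup>+ y. m y \<partial>\<nu>) < \<infinity>"
      using fin by (simp add: ennreal_mult_less_top)
    finally show ?thesis by simp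
  qed
  moreover have "A n \<in> sets \<nu>" for n unfolding A_def by measurable
  ultimately show ?thesis
    by (intro sigma_finite_measure.intro exI[of _ "range A"]) auto
qed

definition levy_kernel :: "real^'n::finite \<Rightarrow> real^'n \<Rightarrow> complex" where
  "levy_kernel \<xi> y = 1 - exp (\<i> * of_real (y \<bullet> \<xi>)) + \<i> * of_real ((y \<bullet> \<xi>) * indicator {0<..<1} (norm y))"

text \<open>The bound separates the variables: the factor in y is integrable for a Levy measure, and
  the factor in xi is integrable against the transform of a test function. For |y| < 1 it is the
  second order estimate of exp(i t), otherwise the triangle inequality.\<close>

lemma levy_kernel_bound: "norm (levy_kernel \<xi> y) \<le> 2 * min 1 ((norm y)\<^sup>2) * (1 + (norm \<xi>)\<^sup>2)"
proof -
  consider "y = 0" | "0 < norm y" "norm y < 1" | "norm y \<ge> 1" by fastforce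
  then show ?thesis
  proof cases
    case 1 then show ?thesis by (simp add: levy_kernel_def)
  next
    case 2
    have "levy_kernel \<xi> y = - (iexp (y \<bullet> \<xi>) - (\<Sum>k\<le>1. (\<i> * (y \<bullet> \<xi>)) ^ k / fact k))"
      using 2 by (simp add: levy_kernel_def)
    then have "norm (levy_kernel \<xi> y) \<le> (y \<bullet> \<xi>)\<^sup>2 / 2"
      using iexp_approx1[of "y \<bullet> \<xi>" 1] by (simp add: norm_minus_cancel power2_eq_square norm_minus_commute)
    also have "\<dots> \<le> (norm y * norm \<xi>)\<^sup>2 / 2"
      using Cauchy_Schwarz_ineq2[of y \<xi>] by (simp add: abs_le_square_iff[symmetric])
    also have "\<dots> \<le> 2 * (norm y)\<^sup>2 * (1 + (norm \<xi>)\<^sup>2)"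
      by (simp add: power_mult_distrib algebra_simps)
    also have "(norm y)\<^sup>2 = min 1 ((norm y)\<^sup>2)" using 2 by (simp add: power_le_one min_absorb2)
    finally show ?thesis .
  next
    case 3
    have "norm (levy_kernel \<xi> y) = norm (1 - exp (\<i> * complex_of_real (y \<bullet> \<xi>)))"
      using 3 by (simp add: levy_kernel_def)
    also have "\<dots> \<le> norm (1::complex) + norm (exp (\<i> * complex_of_real (y \<bullet> \<xi>)))" by (rule norm_triangle_ineq4)
    also have "\<dots> \<le> 2 * min 1 ((norm y)\<^sup>2) * (1 + (norm \<xi>)\<^sup>2)"
      using 3 by (simp add: one_le_power)
    finally show ?thesis .
  qed
qed

lemma levy_kernel_measurable: "(\<lambda>p. levy_kernel (fst p) (snd p)) \<in> borel_measurable (borel \<Otimes>\<^sub>M borel)"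
  unfolding levy_kernel_def by measurable

lemma negdef_symbol_kernel:
  "negdef_symbol c b Q \<nu> \<xi> = of_real c - \<i> * of_real (b \<bullet> \<xi>) + of_real (1/2 * (\<xi> \<bullet> (Q *v \<xi>))) +
     (\<integral>y. levy_kernel \<xi> y \<partial>\<nu>)"
  unfolding negdef_symbol_def levy_kernel_def ..

text \<open>By inversion, multiplication of the transform by xi_j corresponds to -i d_j and
  multiplication by exp(i y xi) to translation by y. Each term of the symbol is translated in this
  way, the jump term after exchanging the integrals over xi and y.\<close>

theorem pseudo_diff_eq_levy_operator:
  fixes f :: "real^'n::finite \<Rightarrow> real"
  assumes f: "f \<in> Cc_infinity" and \<nu>: "levy_measure \<nu>" and q: "q x = negdef_symbol c b Q \<nu>"
  shows "- pseudo_diff q f x = complex_of_real (levy_operator c b Q \<nu> f x)"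
proof -
  \<comment> \<open>The base point x is absorbed into u, so that the moments of u are f and its
    derivatives at x.\<close>
  define u where "u \<xi> = exp (\<i> * of_real (x \<bullet> \<xi>)) * fourier f \<xi>" for \<xi>
  note fourier_measurable[OF f, measurable]
  have um [measurable]: "u \<in> borel_measurable borel" unfolding u_def by measurable
  have int_weighted: "integrable lborel (\<lambda>\<xi>. g \<xi> * u \<xi>)"
    if [measurable]: "g \<in> borel_measurable borel" and "\<And>\<xi>. norm (g \<xi>) \<le> K * (1 + (norm \<xi>)\<^sup>2)"
    for g :: "real^'n \<Rightarrow> complex" and K
    unfolding u_def mult.assoc[symmetric]
    by (rule fourier_integrable_weighted[OF f, of _ K]) (use that in \<open>auto simp: norm_mult\<close>)
  have comp1: "\<bar>\<xi> $ j\<bar> \<le> 1 * (1 + (norm \<xi>)\<^sup>2)" for j and \<xi> :: "real^'n"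
  proof -
    have "norm \<xi> \<le> 1 + (norm \<xi>)\<^sup>2"
    proof (cases "norm \<xi> \<le> 1")
      case False
      then have "norm \<xi> * 1 \<le> norm \<xi> * norm \<xi>" by (intro mult_left_mono) auto
      then show ?thesis by (simp add: power2_eq_square)
    qed (simp add: add_increasing2)
    then show ?thesis using component_le_norm_cart[of \<xi> j] by simp
  qed
  have comp2: "\<bar>\<xi> $ i * \<xi> $ j\<bar> \<le> 1 * (1 + (norm \<xi>)\<^sup>2)" for i j and \<xi> :: "real^'n"
    using mult_mono[OF component_le_norm_cart[of \<xi> i] component_le_norm_cart[of \<xi> j]]
    by (simp add: abs_mult power2_eq_square)
  have i0: "integrable lborel u" using int_weighted[of "\<lambda>_. 1" 1] by simp
  have i1: "integrable lborel (\<lambda>\<xi>. of_real (\<xi> $ j) * u \<xi>)" for j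
    by (rule int_weighted[of _ 1]) (use comp1 in auto)
  have i2: "integrable lborel (\<lambda>\<xi>. of_real (\<xi> $ i * \<xi> $ j) * u \<xi>)" for i j
    by (rule int_weighted[of _ 1]) (use comp2 in \<open>auto simp del: of_real_mult\<close>)
  have v0: "(\<integral>\<xi>. exp (\<i> * of_real (y \<bullet> \<xi>)) * u \<xi> \<partial>lborel) = of_real (f (x + y))" for y
  proof -
    have "exp (\<i> * of_real (y \<bullet> \<xi>)) * u \<xi> = exp (\<i> * of_real ((x + y) \<bullet> \<xi>)) * fourier f \<xi>" for \<xi>
      by (simp add: u_def inner_add_left distrib_left exp_add mult_ac)
    then show ?thesis using fourier_inversion[OF f, of "x + y"] by (simp only:)
  qed
  have u0: "(\<integral>\<xi>. u \<xi> \<partial>lborel) = of_real (f x)" using v0[of 0] by simp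
  have v1: "(\<integral>\<xi>. of_real (\<xi> $ j) * u \<xi> \<partial>lborel) = - \<i> * of_real (partial_derivative j f x)" for j
  proof -
    have "of_real (\<xi> $ j) * u \<xi> = - \<i> * (exp (\<i> * of_real (x \<bullet> \<xi>)) * fourier (partial_derivative j f) \<xi>)" for \<xi>
      by (simp add: u_def fourier_partial_derivative[OF f] mult_ac)
    then show ?thesis
      using fourier_inversion[OF Cc_partial_derivative[OF f, of j], of x] by (simp only: integral_mult_right_zero)
  qed
  \<comment> \<open>The transposed entry of the Hessian appears, which is the pairing of indices in
    the trace of \<open>Q ** hessian f x\<close>.\<close>
  have v2: "(\<integral>\<xi>. of_real (\<xi> $ i * \<xi> $ j) * u \<xi> \<partial>lborel) = - of_real (hessian f x $ j $ i)" for i j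
  proof -
    have "of_real (\<xi> $ i * \<xi> $ j) * u \<xi> = (- 1) * (exp (\<i> * of_real (x \<bullet> \<xi>)) *
        fourier (partial_derivative j (partial_derivative i f)) \<xi>)" for \<xi>
      by (simp add: u_def fourier_partial_derivative[OF f] fourier_partial_derivative[OF Cc_partial_derivative[OF f]] mult_ac)
    then show ?thesis
      using fourier_inversion[OF Cc_partial_derivative[OF Cc_partial_derivative[OF f, of i], of j], of x]
      by (simp only: integral_mult_right_zero) (simp add: hessian_def)
  qed
  have ii: "(\<i> * z) * (- \<i> * w) = z * w" for z w
    by (simp add: complex_eq_iff algebra_simps)
  define L where "L y = f (x + y) - f x - (y \<bullet> gradient f x) * indicator {0<..<1} (norm y)" for y
  have kernel_integral: "(\<integral>\<xi>. levy_kernel \<xi> y * u \<xi> \<partial>lborel) = - of_real (L y)" for y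
  proof -
    define a where "a = indicator {0<..<1} (norm y) * (1::real)"
    have split: "levy_kernel \<xi> y * u \<xi> = u \<xi> - exp (\<i> * of_real (y \<bullet> \<xi>)) * u \<xi> +
        (\<Sum>j\<in>UNIV. (\<i> * of_real (a * y $ j)) * (of_real (\<xi> $ j) * u \<xi>))" for \<xi>
      by (simp add: levy_kernel_def a_def inner_vec_def algebra_simps sum_distrib_left sum_distrib_right)
    have ie: "integrable lborel (\<lambda>\<xi>. exp (\<i> * of_real (y \<bullet> \<xi>)) * u \<xi>)"
      by (rule int_weighted[of _ 1]) auto
    have "(\<integral>\<xi>. levy_kernel \<xi> y * u \<xi> \<partial>lborel) = (\<integral>\<xi>. u \<xi> \<partial>lborel) - (\<integral>\<xi>. exp (\<i> * of_real (y \<bullet> \<xi>)) * u \<xi> \<partial>lborel) +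
        (\<Sum>j\<in>UNIV. (\<i> * of_real (a * y $ j)) * (\<integral>\<xi>. of_real (\<xi> $ j) * u \<xi> \<partial>lborel))"
      unfolding split
      by (subst Bochner_Integration.integral_add Bochner_Integration.integral_diff Bochner_Integration.integral_sum;
          (intro Bochner_Integration.integrable_diff Bochner_Integration.integrable_sum integrable_mult_right i0 ie i1)?)+
        (simp only: integral_mult_right_zero)
    also have "\<dots> = of_real (f x) - of_real (f (x + y)) + (\<Sum>j\<in>UNIV. of_real (a * y $ j * partial_derivative j f x))"
      by (simp only: u0 v0 v1 ii of_real_mult)
    also have "\<dots> = - of_real (L y)"
      by (simp add: L_def a_def inner_vec_def gradient_def sum_distrib_left sum_distrib_right mult_ac)
    finally show ?thesis .
  qed

  interpret sigma_finite_measure \<nu> by (rule levy_measure_sigma_finite[OF \<nu>])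
  interpret P: pair_sigma_finite lborel \<nu> ..
  note idm = levy_measure_ident_measurable[OF \<nu>]
  define m where "m y = min 1 ((norm y)\<^sup>2)" for y :: "real^'n"
  have m_int: "integrable \<nu> m"
  proof (rule integrableI_nonneg)
    show "m \<in> borel_measurable \<nu>" unfolding m_def by (rule measurable_compose[OF idm]) measurable
    show "(\<integral>\<^sup>+ y. ennreal (m y) \<partial>\<nu>) < \<infinity>" using \<nu> by (simp add: levy_measure_def m_def)
  qed (simp add: m_def)
  have km: "(\<lambda>p. levy_kernel (fst p) (snd p) * u (fst p)) \<in> borel_measurable (lborel \<Otimes>\<^sub>M \<nu>)"
  proof -
    have "(\<lambda>p. (fst p, snd p)) \<in> measurable (lborel \<Otimes>\<^sub>M \<nu>) (borel \<Otimes>\<^sub>M borel)"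
      by (intro measurable_Pair measurable_compose[OF measurable_snd idm]) simp
    from measurable_compose[OF this levy_kernel_measurable]
    have [measurable]: "(\<lambda>p. levy_kernel (fst p) (snd p)) \<in> borel_measurable (lborel \<Otimes>\<^sub>M \<nu>)" by simp
    show ?thesis by measurable
  qed
  define v where "v \<xi> = 2 * ((1 + (norm \<xi>)\<^sup>2) * norm (fourier f \<xi>))" for \<xi>
  have kb: "norm (levy_kernel \<xi> y * u \<xi>) \<le> m y * v \<xi>" for \<xi> y
    using mult_right_mono[OF levy_kernel_bound[of \<xi> y], of "norm (fourier f \<xi>)"]
    by (simp add: u_def v_def norm_mult m_def mult_ac)
  have kint: "integrable \<nu> (\<lambda>y. levy_kernel \<xi> y * u \<xi>)" for \<xi>
  proof (rule Bochner_Integration.integrable_bound[OF integrable_mult_left[OF m_int]])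
    show "(\<lambda>y. levy_kernel \<xi> y * u \<xi>) \<in> borel_measurable \<nu>"
      unfolding levy_kernel_def by (rule measurable_compose[OF idm]) measurable
    show "AE y in \<nu>. norm (levy_kernel \<xi> y * u \<xi>) \<le> norm (m y * v \<xi>)"
      using kb[of \<xi>] by (intro AE_I2) (metis abs_ge_self order_trans real_norm_def)
  qed
  have prod_int: "integrable (lborel \<Otimes>\<^sub>M \<nu>) (\<lambda>(\<xi>, y). levy_kernel \<xi> y * u \<xi>)"
  proof (rule P.Fubini_integrable)
    show "(\<lambda>(\<xi>, y). levy_kernel \<xi> y * u \<xi>) \<in> borel_measurable (lborel \<Otimes>\<^sub>M \<nu>)"
      using km by (simp add: case_prod_beta')
    have "integrable lborel (\<lambda>\<xi>. \<integral>y. norm (levy_kernel \<xi> y * u \<xi>) \<partial>\<nu>)"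
    proof (rule Bochner_Integration.integrable_bound)
      show "integrable lborel (\<lambda>\<xi>. (\<integral>y. m y \<partial>\<nu>) * v \<xi>)"
        unfolding v_def by (intro integrable_mult_right fourier_weight_integrable f)
      have "(\<lambda>(\<xi>, y). norm (levy_kernel \<xi> y * u \<xi>)) \<in> borel_measurable (lborel \<Otimes>\<^sub>M \<nu>)"
        using measurable_compose[OF km borel_measurable_norm] by (simp add: case_prod_beta')
      then show "(\<lambda>\<xi>. \<integral>y. norm (levy_kernel \<xi> y * u \<xi>) \<partial>\<nu>) \<in> borel_measurable lborel"
        by (rule borel_measurable_lebesgue_integral)
      show "AE \<xi> in lborel. norm (\<integral>y. norm (levy_kernel \<xi> y * u \<xi>) \<partial>\<nu>)
          \<le> norm ((\<integral>y. m y \<partial>\<nu>) * v \<xi>)"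
      proof (intro AE_I2)
        fix \<xi> :: "real^'n"
        have "(\<integral>y. norm (levy_kernel \<xi> y * u \<xi>) \<partial>\<nu>) \<le> (\<integral>y. m y * v \<xi> \<partial>\<nu>)"
          by (intro integral_mono integrable_norm kint integrable_mult_left m_int kb)
        also have "\<dots> = (\<integral>y. m y \<partial>\<nu>) * v \<xi>"
          by (rule integral_mult_left_zero)
        finally have "(\<integral>y. norm (levy_kernel \<xi> y * u \<xi>) \<partial>\<nu>) \<le> \<dots>" .
        moreover have "0 \<le> (\<integral>y. norm (levy_kernel \<xi> y * u \<xi>) \<partial>\<nu>)" by (intro integral_nonneg_AE) simp
        ultimately show "norm (\<integral>y. norm (levy_kernel \<xi> y * u \<xi>) \<partial>\<nu>)
          \<le> norm ((\<integral>y. m y \<partial>\<nu>) * v \<xi>)"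
          unfolding real_norm_def by linarith
      qed
    qed
    then show "integrable lborel (\<lambda>\<xi>. \<integral>y. norm (case (\<xi>, y) of (\<xi>, y) \<Rightarrow> levy_kernel \<xi> y * u \<xi>) \<partial>\<nu>)" by simp
    show "AE \<xi> in lborel. integrable \<nu> (\<lambda>y. case (\<xi>, y) of (\<xi>, y) \<Rightarrow> levy_kernel \<xi> y * u \<xi>)" using kint by simp
  qed
  have jump_int: "integrable lborel (\<lambda>\<xi>. (\<integral>y. levy_kernel \<xi> y \<partial>\<nu>) * u \<xi>)"
    using P.integrable_fst[OF prod_int] by simp
  have jump: "(\<integral>\<xi>. (\<integral>y. levy_kernel \<xi> y \<partial>\<nu>) * u \<xi> \<partial>lborel) = - of_real (\<integral>y. L y \<partial>\<nu>)"
  proof -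
    have "(\<integral>\<xi>. (\<integral>y. levy_kernel \<xi> y \<partial>\<nu>) * u \<xi> \<partial>lborel) = (\<integral>\<xi>. (\<integral>y. levy_kernel \<xi> y * u \<xi> \<partial>\<nu>) \<partial>lborel)" by simp
    also have "\<dots> = (\<integral>y. (\<integral>\<xi>. levy_kernel \<xi> y * u \<xi> \<partial>lborel) \<partial>\<nu>)"
      by (rule P.Fubini_integral[OF prod_int, symmetric])
    also have "\<dots> = (\<integral>y. of_real (- L y) \<partial>\<nu>)" by (simp add: kernel_integral)
    also have "\<dots> = of_real (\<integral>y. - L y \<partial>\<nu>)" by (rule integral_complex_of_real)
    finally show ?thesis by simp
  qed
  have split: "q x \<xi> * exp (\<i> * of_real (x \<bullet> \<xi>)) * fourier f \<xi> = of_real c * u \<xi> -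
      (\<Sum>j\<in>UNIV. (\<i> * of_real (b $ j)) * (of_real (\<xi> $ j) * u \<xi>)) +
      (\<Sum>i\<in>UNIV. \<Sum>j\<in>UNIV. of_real (1/2 * Q $ i $ j) * (of_real (\<xi> $ i * \<xi> $ j) * u \<xi>)) +
      (\<integral>y. levy_kernel \<xi> y \<partial>\<nu>) * u \<xi>" for \<xi>
  proof -
    have 1: "(\<Sum>j\<in>UNIV. (\<i> * of_real (b $ j)) * (of_real (\<xi> $ j) * u \<xi>)) = \<i> * of_real (b \<bullet> \<xi>) * u \<xi>"
      by (simp add: inner_vec_def sum_distrib_left sum_distrib_right mult_ac)
    have 2: "(\<Sum>i\<in>UNIV. \<Sum>j\<in>UNIV. of_real (1/2 * Q $ i $ j) * (of_real (\<xi> $ i * \<xi> $ j) * u \<xi>)) =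
        of_real (1/2 * (\<xi> \<bullet> (Q *v \<xi>))) * u \<xi>"
      by (simp add: inner_vec_def matrix_vector_mult_def sum_distrib_left sum_distrib_right sum_divide_distrib mult_ac)
    show ?thesis unfolding 1 2 q negdef_symbol_kernel
      by (simp add: u_def algebra_simps)
  qed
  have "pseudo_diff q f x = of_real c * (\<integral>\<xi>. u \<xi> \<partial>lborel) -
      (\<Sum>j\<in>UNIV. (\<i> * of_real (b $ j)) * (\<integral>\<xi>. of_real (\<xi> $ j) * u \<xi> \<partial>lborel)) +
      (\<Sum>i\<in>UNIV. \<Sum>j\<in>UNIV. of_real (1/2 * Q $ i $ j) * (\<integral>\<xi>. of_real (\<xi> $ i * \<xi> $ j) * u \<xi> \<partial>lborel)) +
      (\<integral>\<xi>. (\<integral>y. levy_kernel \<xi> y \<partial>\<nu>) * u \<xi> \<partial>lborel)"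
  proof -
    have j0: "integrable lborel (\<lambda>\<xi>. of_real c * u \<xi>)" by (rule integrable_mult_right[OF i0])
    have j1: "integrable lborel (\<lambda>\<xi>. \<Sum>j\<in>UNIV. (\<i> * of_real (b $ j)) * (of_real (\<xi> $ j) * u \<xi>))"
      by (intro Bochner_Integration.integrable_sum integrable_mult_right i1)
    have j2: "integrable lborel (\<lambda>\<xi>. \<Sum>j\<in>UNIV. of_real (1/2 * Q $ i $ j) * (of_real (\<xi> $ i * \<xi> $ j) * u \<xi>))" for i
      by (intro Bochner_Integration.integrable_sum integrable_mult_right i2)
    have j3: "integrable lborel (\<lambda>\<xi>. \<Sum>i\<in>UNIV. \<Sum>j\<in>UNIV. of_real (1/2 * Q $ i $ j) * (of_real (\<xi> $ i * \<xi> $ j) * u \<xi>))"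
      by (intro Bochner_Integration.integrable_sum j2)
    show ?thesis
      unfolding pseudo_diff_def split
        Bochner_Integration.integral_add[OF Bochner_Integration.integrable_add[OF Bochner_Integration.integrable_diff[OF j0 j1] j3] jump_int]
        Bochner_Integration.integral_add[OF Bochner_Integration.integrable_diff[OF j0 j1] j3]
        Bochner_Integration.integral_diff[OF j0 j1]
        Bochner_Integration.integral_sum[OF j2]
        Bochner_Integration.integral_sum[OF integrable_mult_right[OF i1]]
        Bochner_Integration.integral_sum[OF integrable_mult_right[OF i2]]
        integral_mult_right_zero ..
  qed
  also have "\<dots> = of_real (c * f x - (\<Sum>j\<in>UNIV. b $ j * partial_derivative j f x) -
      (\<Sum>i\<in>UNIV. \<Sum>j\<in>UNIV. 1/2 * Q $ i $ j * hessian f x $ j $ i) - (\<integral>y. L y \<partial>\<nu>))"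
    unfolding u0 v1 v2 jump ii by (simp add: sum_negf)
  also have "\<dots> = - of_real (levy_operator c b Q \<nu> f x)"
    by (simp add: levy_operator_def L_def inner_vec_def[of b] gradient_def trace_def matrix_matrix_mult_def sum_distrib_left mult_ac
        flip: of_real_minus)
  finally show ?thesis by simp
qed

section \<open>The generator\<close>

lemma levy_operator_translate:
  assumes f: "f \<in> Cc_infinity"
  shows "levy_operator c b Q \<nu> (\<lambda>y. f (x + y)) 0 = levy_operator c b Q \<nu> f x"
proof -
  have "partial_derivative i (\<lambda>y. f (x + y)) = (\<lambda>y. partial_derivative i f (x + y))" for i
    by (simp add: partial_derivative_translate Cc_differentiable f)
  moreover have "partial_derivative i (\<lambda>y. partial_derivative j f (x + y)) 0 = partial_derivative i (partial_derivative j f) x" for i j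
    by (subst partial_derivative_translate) (simp_all add: Cc_differentiable Cc_partial_derivative f)
  ultimately have "gradient (\<lambda>y. f (x + y)) 0 = gradient f x" "hessian (\<lambda>y. f (x + y)) 0 = hessian f x"
    by (simp_all add: gradient_def hessian_def)
  then show ?thesis by (simp add: levy_operator_def)
qed

lemma generator_limit:
  assumes "f \<in> generator_domain H T"
  shows "((\<lambda>t. (T t f x - f x) / t) \<longlongrightarrow> generator T f x) (at_right 0)"
proof -
  obtain g where "((\<lambda>t. (T t f x - f x) / t) \<longlongrightarrow> g x) (at_right 0)"
    using assms unfolding generator_domain_def by blast
  moreover from this have "generator T f x = g x"
    unfolding generator_def by (rule tendsto_Lim[OF trivial_limit_at_right_real])
  ultimately show ?thesis by simp
qed

text \<open>Sublinearity passes from the difference quotients to the limit. If f' has its maximum f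
  0 \<ge> 0 at x, monotonicity compares it with that constant, so T_t f' at x is at most f 0 times
  T_t 1 at x, hence at most f' x; all quotients are nonpositive.\<close>

lemma generator_maximum_principle:
  fixes x :: "real^'n::finite"
  assumes T: "sublinear_markov_semigroup H T" and D: "Cc_infinity \<subseteq> generator_domain H T"
  shows "maximum_principle (\<lambda>f. generator T (\<lambda>z. f (- x + z)) x)"
proof
  have S: "sublinear_operator_on H (T t)" if "t \<ge> 0" for t
    using T that by (simp add: sublinear_markov_semigroup_def)
  have CH: "f \<in> H" if "f \<in> Cc_infinity" for f
    using that D by (auto simp: generator_domain_def)
  have lim: "((\<lambda>t. (T t f x - f x) / t) \<longlongrightarrow> generator T f x) (at_right 0)" if "f \<in> Cc_infinity" for f
    by (rule generator_limit[OF subsetD[OF D that]])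
  have pos: "eventually (\<lambda>t::real. t > 0) (at_right 0)" by (simp add: eventually_at_right_less)
  show "sublinear_on Cc_infinity (\<lambda>f. generator T (\<lambda>z. f (- x + z)) x)"
    unfolding sublinear_on_def
  proof (intro conjI ballI allI impI)
    fix f g :: "real^'n \<Rightarrow> real" assume fg: "f \<in> Cc_infinity" "g \<in> Cc_infinity"
    define f' g' where "f' = (\<lambda>z. f (- x + z))" and "g' = (\<lambda>z. g (- x + z))"
    have C: "f' \<in> Cc_infinity" "g' \<in> Cc_infinity" unfolding f'_def g'_def by (rule Cc_translate[OF fg(1)], rule Cc_translate[OF fg(2)])
    have "generator T (\<lambda>z. f' z + g' z) x \<le> generator T f' x + generator T g' x"
    proof (rule tendsto_le[OF trivial_limit_at_right_real tendsto_add[OF lim[OF C(1)] lim[OF C(2)]] lim[OF Cc_add[OF C]]])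
      show "eventually (\<lambda>t. (T t (\<lambda>z. f' z + g' z) x - (f' x + g' x)) / t \<le> (T t f' x - f' x) / t + (T t g' x - g' x) / t) (at_right 0)"
        using pos
      proof eventually_elim
        fix t :: real assume t: "t > 0"
        have "T t (\<lambda>z. f' z + g' z) \<le> (\<lambda>z. T t f' z + T t g' z)"
          using S[of t] t CH[OF C(1)] CH[OF C(2)] by (simp add: sublinear_operator_on_def)
        then have "T t (\<lambda>z. f' z + g' z) x \<le> T t f' x + T t g' x" by (simp add: le_fun_def)
        then show "(T t (\<lambda>z. f' z + g' z) x - (f' x + g' x)) / t \<le> (T t f' x - f' x) / t + (T t g' x - g' x) / t"
          using t by (simp add: divide_right_mono flip: add_divide_distrib)
      qed
    qed
    then show "generator T (\<lambda>z. f (- x + z) + g (- x + z)) x \<le>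
        generator T (\<lambda>z. f (- x + z)) x + generator T (\<lambda>z. g (- x + z)) x"
      by (simp add: f'_def g'_def)
  next
    fix f :: "real^'n \<Rightarrow> real" and a :: real assume f: "f \<in> Cc_infinity" and a: "0 \<le> a"
    define f' where "f' = (\<lambda>z. f (- x + z))"
    have C: "f' \<in> Cc_infinity" unfolding f'_def by (rule Cc_translate[OF f])
    have "generator T (\<lambda>z. a * f' z) x = a * generator T f' x"
    proof (rule tendsto_unique[OF trivial_limit_at_right_real lim[OF Cc_cmult[OF C]]])
      have "eventually (\<lambda>t. a * ((T t f' x - f' x) / t) = (T t (\<lambda>z. a * f' z) x - a * f' x) / t) (at_right 0)"
        using pos
      proof eventually_elim
        fix t :: real assume t: "t > 0"
        have "T t (\<lambda>z. a * f' z) = (\<lambda>z. a * T t f' z)"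
          using S[of t] t CH[OF C] a by (simp add: sublinear_operator_on_def)
        then show "a * ((T t f' x - f' x) / t) = (T t (\<lambda>z. a * f' z) x - a * f' x) / t"
          by (simp add: right_diff_distrib)
      qed
      then show "((\<lambda>t. (T t (\<lambda>z. a * f' z) x - a * f' x) / t) \<longlongrightarrow> a * generator T f' x) (at_right 0)"
        by (rule Lim_transform_eventually[OF tendsto_mult[OF tendsto_const lim[OF C]]])
    qed
    then show "generator T (\<lambda>z. a * f (- x + z)) x = a * generator T (\<lambda>z. f (- x + z)) x"
      by (simp add: f'_def)
  qed
  show "generator T (\<lambda>z. f (- x + z)) x \<le> 0"
    if f: "f \<in> Cc_infinity" and max: "\<And>y. f y \<le> f 0" and f0: "0 \<le> f 0" for f
  proof -
    define f' where "f' = (\<lambda>z. f (- x + z))"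
    have C: "f' \<in> Cc_infinity" unfolding f'_def by (rule Cc_translate[OF f])
    have "generator T f' x \<le> 0"
    proof (rule tendsto_upperbound[OF lim[OF C] _ trivial_limit_at_right_real])
      show "eventually (\<lambda>t. (T t f' x - f' x) / t \<le> 0) (at_right 0)"
        using pos
      proof eventually_elim
        fix t :: real assume t: "t > 0"
        have one: "(\<lambda>z. 1) \<in> H" and const: "(\<lambda>z. f 0) \<in> H"
          using T by (simp_all add: sublinear_markov_semigroup_def function_cone_def)
        have "T t f' \<le> T t (\<lambda>z. f 0)"
          using T t CH[OF C] const max unfolding sublinear_markov_semigroup_def f'_def
          by (simp add: le_fun_def)
        then have "T t f' x \<le> T t (\<lambda>z. f 0 * 1) x" by (simp add: le_fun_def)
        \<comment> \<open>Here f 0 \<ge> 0 enters: a sublinear operator commutes with nonnegative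
          factors only.\<close>
        also have "T t (\<lambda>z. f 0 * 1) = (\<lambda>z. f 0 * T t (\<lambda>z. 1) z)"
          using S[of t] t one f0 unfolding sublinear_operator_on_def by (meson less_imp_le)
        also have "f 0 * T t (\<lambda>z. 1) x \<le> f 0"
        proof -
          have "T t (\<lambda>z. 1) \<le> (\<lambda>z. 1)" using T t by (simp add: sublinear_markov_semigroup_def)
          then have "T t (\<lambda>z. 1) x \<le> 1" by (simp add: le_fun_def)
          then show ?thesis using f0 mult_left_mono[of "T t (\<lambda>z. 1) x" 1 "f 0"] by simp
        qed
        finally have "T t f' x \<le> f' x" by (simp add: f'_def)
        then show "(T t f' x - f' x) / t \<le> 0" using t by (simp add: divide_nonpos_pos)
      qed
    qed
    then show ?thesis by (simp add: f'_def)
  qed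
qed

text \<open>At each x there are characteristics whose operator lies below the generator on all test
  functions and meets it at a prescribed one. An index selects such characteristics at all points
  simultaneously, so each supremum is a maximum.\<close>

theorem corollary4p3:
  fixes H :: "(real^'n::finite \<Rightarrow> real) set"
    and T :: "real \<Rightarrow> (real^'n \<Rightarrow> real) \<Rightarrow> real^'n \<Rightarrow> real"
  assumes "sublinear_markov_semigroup H T"
    and "Cc_infinity \<subseteq> generator_domain H T"
  shows "\<exists>(I :: ('n characteristics_field) set)
            (q :: 'n characteristics_field \<Rightarrow> real^'n \<Rightarrow> real^'n \<Rightarrow> complex)
            (c :: 'n characteristics_field \<Rightarrow> real^'n \<Rightarrow> real)
            (b :: 'n characteristics_field \<Rightarrow> real^'n \<Rightarrow> real^'n)
            (Q :: 'n characteristics_field \<Rightarrow> real^'n \<Rightarrow> real^'n^'n)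
            (\<nu> :: 'n characteristics_field \<Rightarrow> real^'n \<Rightarrow> (real^'n) measure).
     (\<forall>\<theta>\<in>I. \<forall>x. cnd_with_characteristics (q \<theta> x) (c \<theta> x) (b \<theta> x) (Q \<theta> x) (\<nu> \<theta> x)) \<and>
     (\<forall>f\<in>Cc_infinity. \<forall>x.
        (\<forall>\<theta>\<in>I. - pseudo_diff (q \<theta>) f x =
           complex_of_real (levy_operator (c \<theta> x) (b \<theta> x) (Q \<theta> x) (\<nu> \<theta> x) f x)) \<and>
        ereal (generator T f x) = (SUP \<theta>\<in>I. ereal (Re (- pseudo_diff (q \<theta>) f x))) \<and>
        ereal (generator T f x) =
          (SUP \<theta>\<in>I. ereal (levy_operator (c \<theta> x) (b \<theta> x) (Q \<theta> x) (\<nu> \<theta> x) f x))) \<and>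
     (\<forall>x. (SUP \<theta>\<in>I. ennreal (c \<theta> x + norm (b \<theta> x) + norm (Q \<theta> x)) +
                    (\<integral>\<^sup>+ y. ennreal (min 1 ((norm y)\<^sup>2)) \<partial>(\<nu> \<theta> x))) < \<infinity>)"
proof -
  define good where "good K x \<tau> \<longleftrightarrow> (case \<tau> of (c, b, Q, \<nu>) \<Rightarrow> levy_triplet_bound K c b Q \<nu> \<and>
      (\<forall>g\<in>Cc_infinity. levy_operator c b Q \<nu> g x \<le> generator T g x))"
    for K and x :: "real^'n" and \<tau> :: "real \<times> (real^'n) \<times> (real^'n^'n) \<times> (real^'n) measure"
  have ex: "\<exists>K. \<forall>f\<in>Cc_infinity. \<exists>\<tau>. good K x \<tau> \<and>
      (case \<tau> of (c, b, Q, \<nu>) \<Rightarrow> levy_operator c b Q \<nu> f x = generator T f x)" for x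
  proof -
    interpret maximum_principle "\<lambda>f. generator T (\<lambda>z. f (- x + z)) x"
      by (rule generator_maximum_principle[OF assms])
    obtain K where K: "\<And>f. f \<in> Cc_infinity \<Longrightarrow> \<exists>c b Q \<nu>. levy_triplet_bound K c b Q \<nu> \<and>
        (\<forall>g\<in>Cc_infinity. levy_operator c b Q \<nu> g 0 \<le> generator T (\<lambda>z. g (- x + z)) x) \<and>
        levy_operator c b Q \<nu> f 0 = generator T (\<lambda>z. f (- x + z)) x"
      by (rule levy_family) (rule that)
    have "\<exists>\<tau>. good K x \<tau> \<and> (case \<tau> of (c, b, Q, \<nu>) \<Rightarrow> levy_operator c b Q \<nu> f x = generator T f x)"
      if f: "f \<in> Cc_infinity" for f
    proof -
      obtain c b Q \<nu> where *: "levy_triplet_bound K c b Q \<nu>"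
        "\<forall>g\<in>Cc_infinity. levy_operator c b Q \<nu> g 0 \<le> generator T (\<lambda>z. g (- x + z)) x"
        "levy_operator c b Q \<nu> (\<lambda>y. f (x + y)) 0 = generator T (\<lambda>z. f (x + (- x + z))) x"
        using K[OF Cc_translate[OF f, of x]] by blast
      have "levy_operator c b Q \<nu> g x \<le> generator T g x" if g: "g \<in> Cc_infinity" for g
        using bspec[OF *(2) Cc_translate[OF g, of x]] levy_operator_translate[OF g, of c b Q \<nu> x] by simp
      moreover have "levy_operator c b Q \<nu> f x = generator T f x"
        using *(3) levy_operator_translate[OF f, of c b Q \<nu> x] by simp
      ultimately show ?thesis using *(1) by (intro exI[of _ "(c, b, Q, \<nu>)"]) (simp add: good_def)
    qed
    then show ?thesis by blast
  qed
  \<comment> \<open>The bound is fixed for each x before any characteristics are chosen; this yields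
    uniformity in the index.\<close>
  from choice[OF allI[OF ex]] obtain K where K: "\<forall>x. \<forall>f\<in>Cc_infinity. \<exists>\<tau>. good (K x) x \<tau> \<and>
      (case \<tau> of (c, b, Q, \<nu>) \<Rightarrow> levy_operator c b Q \<nu> f x = generator T f x)" ..
  define I :: "('n characteristics_field) set" where "I = {\<theta>. \<forall>x. good (K x) x (\<theta> x)}"
  define c :: "'n characteristics_field \<Rightarrow> real^'n \<Rightarrow> real" where "c \<theta> x = fst (\<theta> x)" for \<theta> x
  define b :: "'n characteristics_field \<Rightarrow> real^'n \<Rightarrow> real^'n" where "b \<theta> x = fst (snd (\<theta> x))" for \<theta> x
  define Q :: "'n characteristics_field \<Rightarrow> real^'n \<Rightarrow> real^'n^'n" where "Q \<theta> x = fst (snd (snd (\<theta> x)))" for \<theta> x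
  define \<nu> :: "'n characteristics_field \<Rightarrow> real^'n \<Rightarrow> (real^'n) measure" where "\<nu> \<theta> x = snd (snd (snd (\<theta> x)))" for \<theta> x
  define q where "q \<theta> x = negdef_symbol (c \<theta> x) (b \<theta> x) (Q \<theta> x) (\<nu> \<theta> x)" for \<theta> x
  define A where "A \<theta> f x = levy_operator (c \<theta> x) (b \<theta> x) (Q \<theta> x) (\<nu> \<theta> x) f x" for \<theta> f x
  have bound: "levy_triplet_bound (K x) (c \<theta> x) (b \<theta> x) (Q \<theta> x) (\<nu> \<theta> x)"
    and le: "g \<in> Cc_infinity \<Longrightarrow> A \<theta> g x \<le> generator T g x"
    if "\<theta> \<in> I" for \<theta> x g
    using that by (auto simp: I_def good_def A_def c_def b_def Q_def \<nu>_def split_beta)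
  have attained: "\<exists>\<theta>\<in>I. A \<theta> f x = generator T f x"
    if f: "f \<in> Cc_infinity" for f x
  proof -
    obtain \<tau> where \<tau>: "good (K x) x \<tau>" "case \<tau> of (c, b, Q, \<nu>) \<Rightarrow> levy_operator c b Q \<nu> f x = generator T f x"
      using bspec[OF spec[OF K] f] by blast
    have "\<forall>x. \<exists>\<tau>. good (K x) x \<tau>" using bspec[OF spec[OF K] f] by blast
    from choice[OF this] obtain \<theta> where \<theta>: "\<forall>x. good (K x) x (\<theta> x)" ..
    \<comment> \<open>Membership in \<open>I\<close> is a condition at each point separately, so an
      index may be altered at the single point x to attain the value for f there.\<close>
    have "\<theta>(x := \<tau>) \<in> I" using \<tau>(1) \<theta> by (simp add: I_def)
    moreover have "A (\<theta>(x := \<tau>)) f x = generator T f x"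
      using \<tau>(2) by (simp add: A_def c_def b_def Q_def \<nu>_def split_beta)
    ultimately show ?thesis by blast
  qed
  have pd: "- pseudo_diff (q \<theta>) f x = complex_of_real (A \<theta> f x)"
    if "\<theta> \<in> I" "f \<in> Cc_infinity" for \<theta> f x
    unfolding A_def using bound[OF that(1), of x] by (intro pseudo_diff_eq_levy_operator that) (auto simp: levy_triplet_bound_def q_def)
  have sup: "ereal (generator T f x) = (SUP \<theta>\<in>I. ereal (A \<theta> f x))"
    if f: "f \<in> Cc_infinity" for f x
  proof (rule antisym)
    obtain \<theta> where \<theta>: "\<theta> \<in> I" "A \<theta> f x = generator T f x"
      using attained[OF f] by blast
    show "ereal (generator T f x) \<le> (SUP \<theta>\<in>I. ereal (A \<theta> f x))"
      by (rule SUP_upper2[OF \<theta>(1)]) (simp add: \<theta>(2))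
    show "(SUP \<theta>\<in>I. ereal (A \<theta> f x)) \<le> ereal (generator T f x)"
      by (rule SUP_least) (simp add: le f)
  qed
  show ?thesis
  proof (intro exI[of _ I] exI[of _ q] exI[of _ c] exI[of _ b] exI[of _ Q] exI[of _ \<nu>] conjI ballI allI)
    show "cnd_with_characteristics (q \<theta> x) (c \<theta> x) (b \<theta> x) (Q \<theta> x) (\<nu> \<theta> x)" if "\<theta> \<in> I" for \<theta> x
      using bound[OF that, of x] by (simp add: cnd_with_characteristics_def levy_triplet_bound_def q_def)
  next
    fix f x assume f: "f \<in> (Cc_infinity :: (real^'n \<Rightarrow> real) set)"
    show "- pseudo_diff (q \<theta>) f x = complex_of_real (levy_operator (c \<theta> x) (b \<theta> x) (Q \<theta> x) (\<nu> \<theta> x) f x)"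
      if "\<theta> \<in> I" for \<theta>
      using pd[OF that f] unfolding A_def .
    have "(SUP \<theta>\<in>I. ereal (Re (- pseudo_diff (q \<theta>) f x))) =
        (SUP \<theta>\<in>I. ereal (A \<theta> f x))"
      by (intro SUP_cong refl) (simp only: pd[OF _ f] Re_complex_of_real)
    then show "ereal (generator T f x) = (SUP \<theta>\<in>I. ereal (Re (- pseudo_diff (q \<theta>) f x)))"
      using sup[OF f] by (simp only:)
    show "ereal (generator T f x) =
        (SUP \<theta>\<in>I. ereal (levy_operator (c \<theta> x) (b \<theta> x) (Q \<theta> x) (\<nu> \<theta> x) f x))"
      using sup[OF f] unfolding A_def .
  next
    fix x
    have "(SUP \<theta>\<in>I. ennreal (c \<theta> x + norm (b \<theta> x) + norm (Q \<theta> x)) +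
        (\<integral>\<^sup>+ y. ennreal (min 1 ((norm y)\<^sup>2)) \<partial>(\<nu> \<theta> x))) \<le> ennreal (K x)"
    proof (rule SUP_least)
      fix \<theta> assume "\<theta> \<in> I"
      from bound[OF this, of x]
      show "ennreal (c \<theta> x + norm (b \<theta> x) + norm (Q \<theta> x)) +
          (\<integral>\<^sup>+ y. ennreal (min 1 ((norm y)\<^sup>2)) \<partial>(\<nu> \<theta> x)) \<le> ennreal (K x)"
        unfolding levy_triplet_bound_def by (elim conjE)
    qed
    also have "\<dots> < \<infinity>" by simp
    finally show "(SUP \<theta>\<in>I. ennreal (c \<theta> x + norm (b \<theta> x) + norm (Q \<theta> x)) +
        (\<integral>\<^sup>+ y. ennreal (min 1 ((norm y)\<^sup>2)) \<partial>(\<nu> \<theta> x))) < \<infinity>" .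
  qed
qed

end
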